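(* The $C^*$-algebra $$\mathcal A_\infty=\{a\in\mathrm{UHF}(3^\infty):\ a=\lim_{n\to\infty}a_n \text{ in norm, for some sequence } a_n\in\mathcal A_n\}$$ is nuclear.
   Context: Indices $j\in\{1,2,3\}$ are taken mod $3$. $M_3(\mathbb C)$ has matrix units $e_{ij}$. $\mathrm{UHF}(3^\infty)$ is the $C^*$-inductive limit of $M_3(\mathbb C)^{\otimes n}$ under $x\mapsto x\otimes I_3$; each $M_3(\mathbb C)^{\otimes n}$ is regarded as a unital subalgebra of it. For $n\ge0$ put $\alpha^n_j=e_{jj}\otimes e_{22}^{\otimes n}\in M_3(\mathbb C)^{\otimes(n+1)}$, and for $k\ge1$ put $\beta^k_j=(e_{jj}\otimes e_{11}+e_{j+2,j+2}\otimes e_{33})\otimes e_{22}^{\otimes(k-1)}\in M_3(\mathbb C)^{\otimes(k+1)}$. The finite-dimensional $*$-algebra $\mathcal A_n\subset M_3(\mathbb C)^{\otimes(n+1)}\subset\mathrm{UHF}(3^\infty)$ is the linear span of the $\alpha^n_j$ and of the $x\otimes\beta^k_j$ with $j=1,2,3$, $k=1,\dots,n$, $x\in M_3(\mathbb C)^{\otimes(n-k)}$. $\mathcal A_\infty$ is a $C^*$-subalgebra of $\mathrm{UHF}(3^\infty)$. *)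

theory Defs
  imports
    "HOL-Analysis.Elementary_Topology"
    "Jordan_Normal_Form.Schur_Decomposition"
begin

hide_const (open) Multiset.mult Polynomial.smult

section \<open>C*-algebras\<close>

class unital_cstar_algebra = real_normed_algebra_1 + complete_space +
  fixes scaleC :: "complex \<Rightarrow> 'a \<Rightarrow> 'a"  (infixr "*\<^sub>C" 75)
    and star :: "'a \<Rightarrow> 'a"
  assumes scaleC_add_right: "c *\<^sub>C (x + y) = c *\<^sub>C x + c *\<^sub>C y"
    and scaleC_add_left: "(c + d) *\<^sub>C x = c *\<^sub>C x + d *\<^sub>C x"
    and scaleC_scaleC: "c *\<^sub>C d *\<^sub>C x = (c * d) *\<^sub>C x"
    and scaleC_of_real: "complex_of_real r *\<^sub>C x = r *\<^sub>R x"
    and mult_scaleC_left: "(c *\<^sub>C x) * y = c *\<^sub>C (x * y)"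
    and mult_scaleC_right: "x * (c *\<^sub>C y) = c *\<^sub>C (x * y)"
    and norm_scaleC: "norm (c *\<^sub>C x) = cmod c * norm x"
    and star_add: "star (x + y) = star x + star y"
    and star_scaleC: "star (c *\<^sub>C x) = cnj c *\<^sub>C star x"
    and star_mult: "star (x * y) = star y * star x"
    and star_star: "star (star x) = x"
    and cstar_identity: "norm (star x * x) = (norm x)\<^sup>2"

lemma vector_space_scaleC: "vector_space (scaleC :: complex \<Rightarrow> 'a \<Rightarrow> 'a :: unital_cstar_algebra)"
  using scaleC_of_real[of 1]
  by (unfold_locales) (auto simp: scaleC_add_right scaleC_add_left scaleC_scaleC)

abbreviation cspan :: "'a :: unital_cstar_algebra set \<Rightarrow> 'a set" where
  "cspan \<equiv> Modules.module.span scaleC"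

definition cstar_subalgebra :: "'a :: unital_cstar_algebra set \<Rightarrow> bool" where
  "cstar_subalgebra S \<longleftrightarrow>
     0 \<in> S \<and> (\<forall>x\<in>S. \<forall>y\<in>S. x + y \<in> S) \<and> (\<forall>c. \<forall>x\<in>S. c *\<^sub>C x \<in> S) \<and>
     (\<forall>x\<in>S. \<forall>y\<in>S. x * y \<in> S) \<and> (\<forall>x\<in>S. star x \<in> S) \<and> closed S"

text \<open>
  Completely positive maps run between subalgebras of a type of class
  \<^class>\<open>unital_cstar_algebra\<close> and matrix algebras of variable size. Records put both on the
  same footing.
\<close>

record 'a star_algebra = "(complex, 'a) module" +
  adj :: "'a \<Rightarrow> 'a"
  nrm :: "'a \<Rightarrow> real"

text \<open>The field \<^const>\<open>one\<close> is not used below; subalgebras need not be unital.\<close>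

definition subalg :: "'a :: unital_cstar_algebra set \<Rightarrow> 'a star_algebra" where
  "subalg S = \<lparr>carrier = S, mult = (*), one = 1, zero = 0, add = (+), smult = scaleC,
     adj = star, nrm = norm\<rparr>"

definition l2_norm :: "complex vec \<Rightarrow> real" where
  "l2_norm v = sqrt (\<Sum>i<dim_vec v. (cmod (vec_index v i))\<^sup>2)"

definition op_norm :: "complex mat \<Rightarrow> real" where
  "op_norm A = Sup {l2_norm (A *\<^sub>v v) |v. v \<in> carrier_vec (dim_col A) \<and> l2_norm v \<le> 1}"

definition mat_alg :: "nat \<Rightarrow> complex mat star_algebra" where
  "mat_alg n = \<lparr>carrier = carrier_mat n n, mult = (*), one = 1\<^sub>m n, zero = 0\<^sub>m n n, add = (+),
     smult = (\<cdot>\<^sub>m), adj = mat_adjoint, nrm = op_norm\<rparr>"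


section \<open>Nuclearity\<close>

text \<open>
  Positivity in the C*-algebra of \<open>m \<times> m\<close> matrices over \<open>A\<close>: the matrix \<open>a\<close> has the
  form \<open>x\<^sup>* x\<close> with \<open>x\<close> an \<open>m \<times> m\<close> matrix over \<open>A\<close>.
\<close>

definition matrix_positive ::
    "('a, 'r) star_algebra_scheme \<Rightarrow> nat \<Rightarrow> (nat \<Rightarrow> nat \<Rightarrow> 'a) \<Rightarrow> bool" where
  "matrix_positive A m a \<longleftrightarrow>
     (\<exists>x. (\<forall>i<m. \<forall>j<m. x i j \<in> carrier A) \<and>
          (\<forall>i<m. \<forall>j<m. a i j = (\<Oplus>\<^bsub>A\<^esub>k\<in>{..<m}. adj A (x k i) \<otimes>\<^bsub>A\<^esub> x k j)))"

definition star_alg_linear ::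
    "('a, 'r) star_algebra_scheme \<Rightarrow> ('b, 's) star_algebra_scheme \<Rightarrow> ('a \<Rightarrow> 'b) \<Rightarrow> bool" where
  "star_alg_linear A B f \<longleftrightarrow>
     f \<in> carrier A \<rightarrow> carrier B \<and>
     (\<forall>x\<in>carrier A. \<forall>y\<in>carrier A. f (x \<oplus>\<^bsub>A\<^esub> y) = f x \<oplus>\<^bsub>B\<^esub> f y) \<and>
     (\<forall>c. \<forall>x\<in>carrier A. f (c \<odot>\<^bsub>A\<^esub> x) = c \<odot>\<^bsub>B\<^esub> f x)"

definition completely_positive ::
    "('a, 'r) star_algebra_scheme \<Rightarrow> ('b, 's) star_algebra_scheme \<Rightarrow> ('a \<Rightarrow> 'b) \<Rightarrow> bool" where
  "completely_positive A B f \<longleftrightarrow>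
     star_alg_linear A B f \<and>
     (\<forall>m a. matrix_positive A m a \<longrightarrow> matrix_positive B m (\<lambda>i j. f (a i j)))"

definition contractive_cp ::
    "('a, 'r) star_algebra_scheme \<Rightarrow> ('b, 's) star_algebra_scheme \<Rightarrow> ('a \<Rightarrow> 'b) \<Rightarrow> bool" where
  "contractive_cp A B f \<longleftrightarrow>
     completely_positive A B f \<and> (\<forall>x\<in>carrier A. nrm B (f x) \<le> nrm A x)"

text \<open>
  Nuclearity as in Brown and Ozawa, \<open>C*-algebras and finite-dimensional approximations\<close>: the
  identity is a point-norm limit of contractive completely positive maps factoring through full
  matrix algebras. Unlike the definition by uniqueness of C*-norms on tensor products with all
  C*-algebras, it does not quantify over types.
\<close>

definition nuclear :: "('a, 'r) star_algebra_scheme \<Rightarrow> bool" where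
  "nuclear A \<longleftrightarrow>
     (\<forall>F \<epsilon>. finite F \<and> F \<subseteq> carrier A \<and> \<epsilon> > 0 \<longrightarrow>
       (\<exists>n \<phi> \<psi>. n \<ge> 1 \<and> contractive_cp A (mat_alg n) \<phi> \<and> contractive_cp (mat_alg n) A \<psi> \<and>
          (\<forall>a\<in>F. nrm A (\<psi> (\<phi> a) \<ominus>\<^bsub>A\<^esub> a) < \<epsilon>)))"


section \<open>The UHF algebra\<close>

text \<open>
  The \<open>n\<close>-fold tensor power of the algebra of \<open>3 \<times> 3\<close> matrices is the algebra of
  \<open>3\<^sup>n \<times> 3\<^sup>n\<close> matrices, with the Kronecker product as tensor product of elements.
\<close>

definition kron :: "complex mat \<Rightarrow> complex mat \<Rightarrow> complex mat"  (infixl "\<otimes>\<^sub>K" 71) where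
  "A \<otimes>\<^sub>K B = mat (dim_row A * dim_row B) (dim_col A * dim_col B)
     (\<lambda>(i, j). A $$ (i div dim_row B, j div dim_col B) * B $$ (i mod dim_row B, j mod dim_col B))"

primrec kron_power :: "complex mat \<Rightarrow> nat \<Rightarrow> complex mat" where
  "kron_power A 0 = 1\<^sub>m 1"
| "kron_power A (Suc n) = kron_power A n \<otimes>\<^sub>K A"

abbreviation M3 :: "nat \<Rightarrow> complex mat set" where
  "M3 n \<equiv> carrier_mat (3 ^ n) (3 ^ n)"

text \<open>
  C*-inductive limit of the algebras \<^term>\<open>M3 n\<close>: a completion of their algebraic direct limit,
  given by the canonical embeddings.
\<close>

locale UHF_3_infinity =
  fixes emb :: "nat \<Rightarrow> complex mat \<Rightarrow> 'u :: unital_cstar_algebra"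
  assumes emb_add: "A \<in> M3 n \<Longrightarrow> B \<in> M3 n \<Longrightarrow> emb n (A + B) = emb n A + emb n B"
    and emb_smult: "A \<in> M3 n \<Longrightarrow> emb n (c \<cdot>\<^sub>m A) = c *\<^sub>C emb n A"
    and emb_mult: "A \<in> M3 n \<Longrightarrow> B \<in> M3 n \<Longrightarrow> emb n (A * B) = emb n A * emb n B"
    and emb_one: "emb n (1\<^sub>m (3 ^ n)) = 1"
    and emb_adjoint: "A \<in> M3 n \<Longrightarrow> emb n (mat_adjoint A) = star (emb n A)"
    and emb_norm: "A \<in> M3 n \<Longrightarrow> norm (emb n A) = op_norm A"
    and emb_connecting: "A \<in> M3 n \<Longrightarrow> emb (Suc n) (A \<otimes>\<^sub>K 1\<^sub>m 3) = emb n A"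
    and emb_dense: "closure (\<Union>n. emb n ` M3 n) = UNIV"


section \<open>The algebras \<open>\<A>\<^sub>n\<close> and \<open>\<A>\<^sub>\<infinity>\<close>\<close>

text \<open>
  Matrix units with indices read modulo 3: the indices 1, 2, 3 of the text denote the matrix
  positions 0, 1, 2, and \<open>(i + 2) mod 3\<close> is \<open>i - 1\<close> modulo 3.
\<close>

definition mat_unit :: "nat \<Rightarrow> nat \<Rightarrow> complex mat" where
  "mat_unit i j = mat 3 3 (\<lambda>(p, q). if p = (i + 2) mod 3 \<and> q = (j + 2) mod 3 then 1 else 0)"

definition \<alpha> :: "nat \<Rightarrow> nat \<Rightarrow> complex mat" where
  "\<alpha> n j = mat_unit j j \<otimes>\<^sub>K kron_power (mat_unit 2 2) n"

definition \<beta> :: "nat \<Rightarrow> nat \<Rightarrow> complex mat" where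
  "\<beta> k j = (mat_unit j j \<otimes>\<^sub>K mat_unit 1 1 + mat_unit (j + 2) (j + 2) \<otimes>\<^sub>K mat_unit 3 3)
     \<otimes>\<^sub>K kron_power (mat_unit 2 2) (k - 1)"

definition A_fin :: "(nat \<Rightarrow> complex mat \<Rightarrow> 'u :: unital_cstar_algebra) \<Rightarrow> nat \<Rightarrow> 'u set" where
  "A_fin emb n = cspan (emb (n + 1) `
     ({\<alpha> n j |j. j \<in> {1..3}} \<union>
      {x \<otimes>\<^sub>K \<beta> k j |x k j. j \<in> {1..3} \<and> k \<in> {1..n} \<and> x \<in> M3 (n - k)}))"

definition A_inf :: "(nat \<Rightarrow> complex mat \<Rightarrow> 'u :: unital_cstar_algebra) \<Rightarrow> 'u set" where
  "A_inf emb = {a. \<exists>s. (\<forall>n. s n \<in> A_fin emb n) \<and> s \<longlonglongrightarrow> a}"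

end

theory Submission
  imports Defs
    "HOL-Analysis.L2_Norm"
    "HOL-Analysis.Elementary_Metric_Spaces"
    "HOL-Computational_Algebra.Formal_Power_Series"
begin

text \<open>
  Write \<open>L\<^sub>n\<close> for the image of the \<open>n\<close>-fold tensor power of the \<open>3 \<times> 3\<close> matrices and \<open>q\<close> for
  the projection \<open>e\<^sub>2\<^sub>2\<close> in the last tensor factor. Then \<open>\<A>\<^sub>n\<^sub>+\<^sub>1 = \<A>\<^sub>n q + \<Sum>\<^sub>j L\<^sub>n \<beta>\<^sup>1\<^sub>j\<close>. The algebras
  \<open>\<A>\<^sub>n\<close> are not nested, but the unital completely positive maps
  \<open>x \<mapsto> q x q + (1 - q) T(x) (1 - q)\<close>, where \<open>T : L\<^sub>n\<^sub>+\<^sub>1 \<rightarrow> L\<^sub>n\<close> is the normalized partial trace,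
  send \<open>\<A>\<^sub>n\<close> to \<open>\<A>\<^sub>n\<^sub>+\<^sub>1\<close> and fix \<open>L\<^sub>n\<close>. They contract \<open>\<parallel>x - T(x)\<parallel>\<close> by the factor \<open>2/3\<close> at each
  step, so their compositions converge to completely positive maps \<open>\<A>\<^sub>n \<rightarrow> \<A>\<^sub>\<infinity>\<close>. An element of
  \<open>\<A>\<^sub>\<infinity>\<close> is close both to \<open>L\<^sub>n\<close> and to \<open>\<A>\<^sub>n\<close> for large \<open>n\<close>, hence is almost fixed by the
  composition of the conditional expectations onto \<open>L\<^sub>n\<^sub>+\<^sub>1\<close> and \<open>\<A>\<^sub>n\<close> with this limit map.

  All these maps are point-norm limits of maps \<open>x \<mapsto> \<Sum> c\<^sup>* x c\<close>, so they send Gram matrices to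
  limits of Gram matrices. In a closed unital *-subalgebra such a limit \<open>H\<close> factors as \<open>R\<^sup>* R\<close>, with
  \<open>R\<close> given by the binomial series of \<open>\<surd>(1 - D)\<close> for \<open>D = 1 - H/t\<close>. The series converges since the
  entries of all powers of \<open>D\<close> have norm at most 1, which is tested on vector states of the \<open>L\<^sub>n\<close>.
\<close>

section \<open>Operator norms and Kronecker products\<close>

lemma mat_adjoint_carrier [simp]: "A \<in> carrier_mat m n \<Longrightarrow> mat_adjoint A \<in> carrier_mat n m"
  by (auto simp: mat_adjoint_def)

lemma dim_mat_adjoint [simp]:
  "dim_row (mat_adjoint A) = dim_col A" "dim_col (mat_adjoint A) = dim_row A"
  by (auto simp: mat_adjoint_def)

lemma index_mat_adjoint [simp]:
  "i < dim_col A \<Longrightarrow> j < dim_row A \<Longrightarrow> mat_adjoint A $$ (i, j) = conjugate (A $$ (j, i))"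
  by (auto simp: mat_adjoint_def mat_of_rows_def)

lemma l2_norm_nonneg [simp]: "l2_norm v \<ge> 0"
  by (simp add: l2_norm_def sum_nonneg)

lemma l2_norm_eq_L2_set: "l2_norm v = L2_set (\<lambda>i. cmod (v $ i)) {..<dim_vec v}"
  by (simp add: l2_norm_def L2_set_def)

lemma l2_norm_square: "(l2_norm v)\<^sup>2 = Re (v \<bullet>c v)"
proof -
  have "(l2_norm v)\<^sup>2 = (\<Sum>i<dim_vec v. (cmod (v $ i))\<^sup>2)"
    by (simp add: l2_norm_def sum_nonneg)
  also have "\<dots> = Re (\<Sum>i = 0..<dim_vec v. v $ i * cnj (v $ i))"
    by (simp add: complex_mult_cnj cmod_def flip: atLeast0LessThan)
  finally show ?thesis by (simp add: scalar_prod_def conjugate_complex_def)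
qed

lemma cmod_index_le_l2_norm: "i < dim_vec v \<Longrightarrow> cmod (v $ i) \<le> l2_norm v"
  unfolding l2_norm_eq_L2_set
  by (rule member_le_L2_set) auto

lemma l2_norm_smult: "l2_norm (c \<cdot>\<^sub>v v) = cmod c * l2_norm v"
  by (simp add: l2_norm_def norm_mult power_mult_distrib real_sqrt_mult flip: sum_distrib_left)

lemma l2_norm_eq_0_iff: "v \<in> carrier_vec n \<Longrightarrow> l2_norm v = 0 \<longleftrightarrow> v = 0\<^sub>v n"
  by (auto simp: l2_norm_def sum_nonneg_eq_0_iff intro!: eq_vecI)

text \<open>A crude bound; it makes the set whose supremum is \<open>op_norm\<close> bounded
  above.\<close>

lemma l2_norm_mult_mat_vec_le_entries:
  assumes "A \<in> carrier_mat m n" "v \<in> carrier_vec n" "l2_norm v \<le> 1"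
  shows "l2_norm (A *\<^sub>v v) \<le> (\<Sum>i<m. \<Sum>j<n. cmod (A $$ (i, j)))"
proof -
  have "cmod ((A *\<^sub>v v) $ i) \<le> (\<Sum>j<n. cmod (A $$ (i, j)))" if "i < m" for i
  proof -
    have "cmod ((A *\<^sub>v v) $ i) = cmod (\<Sum>j<n. A $$ (i, j) * v $ j)"
      using assms that by (simp add: scalar_prod_def atLeast0LessThan)
    also have "\<dots> \<le> (\<Sum>j<n. cmod (A $$ (i, j) * v $ j))" by (rule norm_sum)
    also have "\<dots> \<le> (\<Sum>j<n. cmod (A $$ (i, j)))"
      using assms cmod_index_le_l2_norm[of _ v]
      by (intro sum_mono) (fastforce simp: norm_mult intro!: mult_left_le)
    finally show ?thesis .
  qed
  then have "(\<Sum>i<m. cmod ((A *\<^sub>v v) $ i)) \<le> (\<Sum>i<m. \<Sum>j<n. cmod (A $$ (i, j)))"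
    by (intro sum_mono) auto
  moreover have "l2_norm (A *\<^sub>v v) \<le> (\<Sum>i<m. cmod ((A *\<^sub>v v) $ i))"
    using assms L2_set_le_sum[of "{..<m}" "\<lambda>i. cmod ((A *\<^sub>v v) $ i)"]
    by (simp add: l2_norm_eq_L2_set)
  ultimately show ?thesis by linarith
qed

lemma op_norm_bdd_above:
  "bdd_above {l2_norm (A *\<^sub>v v) |v. v \<in> carrier_vec (dim_col A) \<and> l2_norm v \<le> 1}"
  using l2_norm_mult_mat_vec_le_entries[of A "dim_row A" "dim_col A"]
  by (intro bdd_aboveI) auto

lemma op_norm_le:
  assumes "A \<in> carrier_mat m n"
    and "\<And>v. v \<in> carrier_vec n \<Longrightarrow> l2_norm v \<le> 1 \<Longrightarrow> l2_norm (A *\<^sub>v v) \<le> c"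
  shows "op_norm A \<le> c"
  unfolding op_norm_def
proof (rule cSup_least)
  have "l2_norm (0\<^sub>v (dim_col A)) \<le> 1" by (simp add: l2_norm_def)
  then show "{l2_norm (A *\<^sub>v v) |v. v \<in> carrier_vec (dim_col A) \<and> l2_norm v \<le> 1} \<noteq> {}"
    by (auto intro: exI[of _ "0\<^sub>v (dim_col A)"])
qed (use assms in auto)

lemma l2_norm_mult_mat_vec_le:
  assumes A: "A \<in> carrier_mat m n" and v: "v \<in> carrier_vec n"
  shows "l2_norm (A *\<^sub>v v) \<le> op_norm A * l2_norm v"
proof (cases "l2_norm v = 0")
  case True
  then have "v = 0\<^sub>v n" using v l2_norm_eq_0_iff by blast
  then have "A *\<^sub>v v = 0\<^sub>v m" using A by (auto intro!: eq_vecI simp: scalar_prod_def)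
  then show ?thesis using True by (simp add: l2_norm_def)
next
  case False
  \<comment> \<open>Normalizing \<open>v\<close> makes it a competitor in the supremum defining
    \<open>op_norm\<close>.\<close>
  let ?c = "complex_of_real (inverse (l2_norm v))"
  have "l2_norm (?c \<cdot>\<^sub>v v) = 1"
    using False l2_norm_nonneg[of v] by (simp add: l2_norm_smult norm_inverse del: l2_norm_nonneg)
  then have "l2_norm (A *\<^sub>v (?c \<cdot>\<^sub>v v)) \<le> op_norm A"
    unfolding op_norm_def using A v
    by (intro cSup_upper op_norm_bdd_above) auto
  moreover have "A *\<^sub>v (?c \<cdot>\<^sub>v v) = ?c \<cdot>\<^sub>v (A *\<^sub>v v)"
    using A v by (rule mult_mat_vec)
  ultimately have "inverse (l2_norm v) * l2_norm (A *\<^sub>v v) \<le> op_norm A"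
    using l2_norm_nonneg[of v] by (simp add: l2_norm_smult norm_inverse del: l2_norm_nonneg)
  then show ?thesis
    using False l2_norm_nonneg[of v] by (simp add: field_simps del: l2_norm_nonneg)
qed

lemma adjoint_cscalar_prod:
  fixes A :: "complex mat"
  assumes A: "A \<in> carrier_mat m n" and v: "v \<in> carrier_vec n" and w: "w \<in> carrier_vec m"
  shows "(mat_adjoint A *\<^sub>v w) \<bullet>c v = w \<bullet>c (A *\<^sub>v v)"
proof -
  have "(mat_adjoint A *\<^sub>v w) \<bullet>c v = (\<Sum>i<n. (\<Sum>j<m. cnj (A $$ (j, i)) * w $ j) * cnj (v $ i))"
    using assms by (auto simp: scalar_prod_def atLeast0LessThan conjugate_complex_def intro!: sum.cong)
  also have "\<dots> = (\<Sum>j<m. w $ j * (\<Sum>i<n. cnj (A $$ (j, i) * v $ i)))"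
    unfolding sum_distrib_left sum_distrib_right
    by (subst sum.swap) (auto intro!: sum.cong)
  also have "\<dots> = w \<bullet>c (A *\<^sub>v v)"
    using assms by (auto simp: scalar_prod_def atLeast0LessThan conjugate_complex_def intro!: sum.cong)
  finally show ?thesis .
qed

lemma smult_mat_mult_vec:
  "v \<in> carrier_vec (dim_col A) \<Longrightarrow> (c \<cdot>\<^sub>m A) *\<^sub>v v = c \<cdot>\<^sub>v (A *\<^sub>v (v :: complex vec))"
  by (rule eq_vecI) (auto simp: scalar_prod_def sum_distrib_left mult.assoc)

section \<open>Kronecker products\<close>

text \<open>An index of a Kronecker product is a pair of quotient and remainder, so the sum in a
  product of two Kronecker products splits into one sum per tensor factor.\<close>

lemma sum_lessThan_mult:
  fixes f :: "nat \<Rightarrow> 'a :: comm_monoid_add"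
  shows "(\<Sum>k<a * b. f k) = (\<Sum>i<a. \<Sum>j<b. f (i * b + j))"
proof -
  have "(\<Sum>k<a * b. f k) = (\<Sum>i<a. sum f {i * b..<i * b + b})"
    by (rule sum.nat_group[symmetric])
  also have "\<dots> = (\<Sum>i<a. \<Sum>j<b. f (i * b + j))"
    by (simp add: sum.atLeastLessThan_shift_0 atLeast0LessThan)
  finally show ?thesis .
qed

lemma less_mult_nat_E:
  assumes "i < a * (b :: nat)"
  shows "i div b < a" "i mod b < b" "b > 0"
  using assms by (auto simp: less_mult_imp_div_less intro!: mod_less_divisor gr0I)

lemma dim_kron [simp]:
  "dim_row (A \<otimes>\<^sub>K B) = dim_row A * dim_row B" "dim_col (A \<otimes>\<^sub>K B) = dim_col A * dim_col B"
  by (auto simp: kron_def)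

lemma kron_carrier [simp]:
  "A \<in> carrier_mat a b \<Longrightarrow> B \<in> carrier_mat c d \<Longrightarrow> A \<otimes>\<^sub>K B \<in> carrier_mat (a * c) (b * d)"
  by (auto simp: kron_def)

lemma index_kron [simp]:
  "i < dim_row A * dim_row B \<Longrightarrow> j < dim_col A * dim_col B \<Longrightarrow> (A \<otimes>\<^sub>K B) $$ (i, j) =
    A $$ (i div dim_row B, j div dim_col B) * B $$ (i mod dim_row B, j mod dim_col B)"
  by (auto simp: kron_def)

lemma kron_mult:
  assumes "A \<in> carrier_mat a1 a2" "B \<in> carrier_mat b1 b2" "C \<in> carrier_mat a2 c2" "D \<in> carrier_mat b2 d2"
  shows "(A \<otimes>\<^sub>K B) * (C \<otimes>\<^sub>K D) = (A * C) \<otimes>\<^sub>K (B * D)"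
proof (rule eq_matI)
  fix i j assume "i < dim_row ((A * C) \<otimes>\<^sub>K (B * D))" "j < dim_col ((A * C) \<otimes>\<^sub>K (B * D))"
  then have i: "i < a1 * b1" and j: "j < c2 * d2" using assms by auto
  note ij = less_mult_nat_E[OF i] less_mult_nat_E[OF j]
  have lt: "k * b2 + l < a2 * b2" if "k < a2" "l < b2" for k l
  proof -
    have "k * b2 + l < Suc k * b2" using that by simp
    also have "\<dots> \<le> a2 * b2" using that by (intro mult_le_mono1) simp
    finally show ?thesis .
  qed
  have "((A \<otimes>\<^sub>K B) * (C \<otimes>\<^sub>K D)) $$ (i, j) =
    (\<Sum>k<a2 * b2. (A \<otimes>\<^sub>K B) $$ (i, k) * (C \<otimes>\<^sub>K D) $$ (k, j))"
    using assms i j by (simp add: scalar_prod_def atLeast0LessThan)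
  also have "\<dots> = (\<Sum>k<a2. \<Sum>l<b2. (A $$ (i div b1, k) * C $$ (k, j div d2)) *
      (B $$ (i mod b1, l) * D $$ (l, j mod d2)))"
    unfolding sum_lessThan_mult using assms i j lt by (intro sum.cong refl) auto
  also have "\<dots> = (\<Sum>k<a2. A $$ (i div b1, k) * C $$ (k, j div d2)) *
      (\<Sum>l<b2. B $$ (i mod b1, l) * D $$ (l, j mod d2))"
    by (simp add: sum_product)
  also have "\<dots> = ((A * C) \<otimes>\<^sub>K (B * D)) $$ (i, j)"
    using assms i j ij by (simp add: scalar_prod_def atLeast0LessThan)
  finally show "((A \<otimes>\<^sub>K B) * (C \<otimes>\<^sub>K D)) $$ (i, j) = ((A * C) \<otimes>\<^sub>K (B * D)) $$ (i, j)" .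
qed (use assms in auto)

lemma mod_mult_div: "(i mod (b * c)) div c = i div c mod (b :: nat)"
  by (cases "c = 0") (simp_all add: mult.commute[of b] mod_mult2_eq)

lemma kron_assoc: "(A \<otimes>\<^sub>K B) \<otimes>\<^sub>K C = A \<otimes>\<^sub>K (B \<otimes>\<^sub>K C)"
proof (rule eq_matI)
  fix i j assume ij: "i < dim_row (A \<otimes>\<^sub>K (B \<otimes>\<^sub>K C))" "j < dim_col (A \<otimes>\<^sub>K (B \<otimes>\<^sub>K C))"
  then have i: "i < dim_row A * dim_row B * dim_row C" and j: "j < dim_col A * dim_col B * dim_col C"
    by (auto simp: mult.assoc)
  have [simp]: "i mod (dim_row B * dim_row C) < dim_row B * dim_row C"
    "j mod (dim_col B * dim_col C) < dim_col B * dim_col C"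
    using less_mult_nat_E(2)[OF ij(1)[unfolded dim_kron]] less_mult_nat_E(2)[OF ij(2)[unfolded dim_kron]]
    by auto
  show "((A \<otimes>\<^sub>K B) \<otimes>\<^sub>K C) $$ (i, j) = (A \<otimes>\<^sub>K (B \<otimes>\<^sub>K C)) $$ (i, j)"
    using i j less_mult_nat_E[OF i] less_mult_nat_E[OF j] ij
    by (simp add: mult.assoc mod_mult_div mod_mod_cancel)
      (simp add: div_mult2_eq mult.commute[of "dim_row B"] mult.commute[of "dim_col B"])
qed (auto simp: mult.assoc)

lemma kron_one_right: "A \<otimes>\<^sub>K 1\<^sub>m (Suc 0) = A"
  by (rule eq_matI) auto

lemma kron_add_right:
  assumes "B \<in> carrier_mat a b" "B' \<in> carrier_mat a b"
  shows "A \<otimes>\<^sub>K (B + B') = A \<otimes>\<^sub>K B + A \<otimes>\<^sub>K B'"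
  by (rule eq_matI) (use assms in \<open>auto simp: distrib_left less_mult_nat_E\<close>)

lemma kron_adjoint: "mat_adjoint (A \<otimes>\<^sub>K B) = mat_adjoint A \<otimes>\<^sub>K mat_adjoint (B :: complex mat)"
  by (rule eq_matI)
    (auto simp: less_mult_nat_E)

section \<open>Matrix units and blocks\<close>

text \<open>Matrix units with indices from 0. Index \<open>j\<close> of \<open>mat_unit\<close> is
  position \<open>(j + 2) mod 3\<close> here, so the cyclic reading of indices is settled
  once.\<close>

definition matE :: "nat \<Rightarrow> nat \<Rightarrow> complex mat" where
  "matE i j = mat 3 3 (\<lambda>(p, q). if p = i \<and> q = j then 1 else 0)"

lemma matE_carrier [simp]: "matE i j \<in> carrier_mat 3 3"
  by (simp add: matE_def)

lemma dim_matE [simp]: "dim_row (matE i j) = 3" "dim_col (matE i j) = 3"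
  by (simp_all add: matE_def)

lemma mat_unit_eq_matE: "mat_unit i j = matE ((i + 2) mod 3) ((j + 2) mod 3)"
  by (auto simp: mat_unit_def matE_def)

lemma matE_mult:
  assumes "i < 3" "j < 3" "k < 3" "l < 3"
  shows "matE i j * matE k l = (if j = k then matE i l else 0\<^sub>m 3 3)"
proof (rule eq_matI)
  fix p q assume "p < dim_row (if j = k then matE i l else 0\<^sub>m 3 3)"
    "q < dim_col (if j = k then matE i l else 0\<^sub>m 3 3)"
  then have "p < 3" "q < 3" by (auto split: if_splits)
  then have "(matE i j * matE k l) $$ (p, q) = (\<Sum>r<3. (if p = i \<and> r = j then 1 else 0) * (if r = k \<and> q = l then 1 else 0))"
    by (simp add: matE_def scalar_prod_def atLeast0LessThan)
  also have "\<dots> = (\<Sum>r<3. if r = j then (if p = i \<and> j = k \<and> q = l then 1 else 0) else 0)"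
    by (intro sum.cong) auto
  also have "\<dots> = (if p = i \<and> j = k \<and> q = l then 1 else 0)"
    using assms by simp
  also have "\<dots> = (if j = k then matE i l else 0\<^sub>m 3 3) $$ (p, q)"
    using \<open>p < 3\<close> \<open>q < 3\<close> by (auto simp: matE_def)
  finally show "(matE i j * matE k l) $$ (p, q) = (if j = k then matE i l else 0\<^sub>m 3 3) $$ (p, q)" .
qed auto

lemma matE_adjoint [simp]: "mat_adjoint (matE i j) = matE j i"
  by (rule eq_matI) (auto simp: matE_def)

lemma matE_sum_one: "matE 0 0 + matE 1 1 + matE 2 2 = 1\<^sub>m 3"
  by (rule eq_matI) (auto simp: matE_def numeral_3_eq_3 less_Suc_eq)

text \<open>The coefficient of \<open>matE i j\<close> when the last tensor factor is split off: the
  residue of a position modulo 3 belongs to that factor, the quotient to the others.\<close>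

definition kron_block :: "nat \<Rightarrow> complex mat \<Rightarrow> nat \<Rightarrow> nat \<Rightarrow> complex mat" where
  "kron_block n A i j = mat n n (\<lambda>(p, q). A $$ (3 * p + i, 3 * q + j))"

lemma kron_block_carrier [simp]: "kron_block n A i j \<in> carrier_mat n n"
  by (simp add: kron_block_def)

text \<open>The nine summands are written out because matrices of all dimensions share one type and
  have no common zero.\<close>

lemma kron_block_decomp:
  assumes "A \<in> carrier_mat (n * 3) (n * 3)"
  defines "B i j \<equiv> kron_block n A i j \<otimes>\<^sub>K matE i j"
  shows "A = (B 0 0 + B 0 1 + B 0 2) + (B 1 0 + B 1 1 + B 1 2) + (B 2 0 + B 2 1 + B 2 2)"
proof (rule eq_matI)
  fix i j assume "i < dim_row ((B 0 0 + B 0 1 + B 0 2) + (B 1 0 + B 1 1 + B 1 2) + (B 2 0 + B 2 1 + B 2 2))"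
    "j < dim_col ((B 0 0 + B 0 1 + B 0 2) + (B 1 0 + B 1 1 + B 1 2) + (B 2 0 + B 2 1 + B 2 2))"
  then have ij: "i < n * 3" "j < n * 3" by (auto simp: B_def kron_block_def)
  have B: "B k l $$ (i, j) = (if i mod 3 = k \<and> j mod 3 = l then A $$ (i, j) else 0)" for k l
    using ij less_mult_nat_E[OF ij(1)] less_mult_nat_E[OF ij(2)]
    by (auto simp: B_def kron_block_def matE_def)
  have d: "dim_row (B k l) = n * 3" "dim_col (B k l) = n * 3" for k l
    by (auto simp: B_def kron_block_def)
  have "i mod 3 = 0 \<or> i mod 3 = 1 \<or> i mod 3 = 2" "j mod 3 = 0 \<or> j mod 3 = 1 \<or> j mod 3 = 2" by linarith+
  then show "A $$ (i, j) = ((B 0 0 + B 0 1 + B 0 2) + (B 1 0 + B 1 1 + B 1 2) + (B 2 0 + B 2 1 + B 2 2)) $$ (i, j)"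
    using ij by (elim disjE) (simp_all add: B d)
qed (use assms in \<open>auto simp: B_def kron_block_def\<close>)

section \<open>The finite stages of the UHF algebra\<close>

interpretation cspace: vector_space "scaleC :: complex \<Rightarrow> 'a \<Rightarrow> 'a :: unital_cstar_algebra"
  by (rule vector_space_scaleC)

lemma scaleC_sum_right: "c *\<^sub>C (\<Sum>i\<in>I. f i) = (\<Sum>i\<in>I. c *\<^sub>C (f i :: 'a :: unital_cstar_algebra))"
  by (rule cspace.scale_sum_right)

lemma scaleR_eq_scaleC: "r *\<^sub>R x = complex_of_real r *\<^sub>C (x :: 'a :: unital_cstar_algebra)"
  by (simp add: scaleC_of_real)

lemma star_zero [simp]: "star (0 :: 'a :: unital_cstar_algebra) = 0"
  by (metis add_cancel_right_right star_add)

lemma star_minus [simp]: "star (- x :: 'a :: unital_cstar_algebra) = - star x"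
  by (metis add.right_inverse add_eq_0_iff star_add star_zero)

lemma star_diff: "star (x - y :: 'a :: unital_cstar_algebra) = star x - star y"
  using star_add[of x "- y"] by simp

lemma star_one [simp]: "star (1 :: 'a :: unital_cstar_algebra) = 1"
  by (metis mult.right_neutral star_mult star_star)

lemma star_scaleR: "star (r *\<^sub>R x :: 'a :: unital_cstar_algebra) = r *\<^sub>R star x"
  by (simp add: scaleR_eq_scaleC star_scaleC)

lemma star_sum: "star (\<Sum>i\<in>I. f i) = (\<Sum>i\<in>I. star (f i :: 'a :: unital_cstar_algebra))"
  by (induction I rule: infinite_finite_induct) (auto simp: star_add)

text \<open>The C*-identity and submultiplicativity give one inequality for every element; applied
  to \<open>star x\<close> it gives the other.\<close>

lemma norm_star [simp]: "norm (star x :: 'a :: unital_cstar_algebra) = norm x"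
proof -
  have le: "norm y \<le> norm (star y)" for y :: 'a
  proof (cases "norm y = 0")
    case False
    have "norm y * norm y \<le> norm (star y) * norm y"
      using norm_mult_ineq[of "star y" y] by (simp add: cstar_identity power2_eq_square)
    then show ?thesis using False by (simp add: mult_le_cancel_right)
  qed simp
  show ?thesis using le[of x] le[of "star x"] by (simp add: star_star)
qed

lemma bounded_linear_star: "bounded_linear (star :: 'a :: unital_cstar_algebra \<Rightarrow> 'a)"
  by (rule bounded_linear_intro[of _ 1]) (auto simp: star_add star_scaleR)

lemmas tendsto_star [tendsto_intros] = bounded_linear.tendsto[OF bounded_linear_star]

lemma bounded_linear_scaleC: "bounded_linear (scaleC c :: 'a :: unital_cstar_algebra \<Rightarrow> 'a)"
  by (rule bounded_linear_intro[of _ "cmod c"])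
    (auto simp: scaleC_add_right scaleR_eq_scaleC scaleC_scaleC norm_scaleC mult.commute)

lemmas tendsto_scaleC [tendsto_intros] = bounded_linear.tendsto[OF bounded_linear_scaleC]

lemma norm_self_adjoint_square:
  "star x = x \<Longrightarrow> norm (x * x) = (norm (x :: 'a :: unital_cstar_algebra))\<^sup>2"
  by (metis cstar_identity)

lemma norm_projection_le_one:
  fixes p :: "'a :: unital_cstar_algebra"
  assumes "star p = p" "p * p = p"
  shows "norm p \<le> 1"
proof (rule ccontr)
  assume "\<not> norm p \<le> 1"
  moreover have "norm p = (norm p)\<^sup>2" using assms norm_self_adjoint_square by metis
  ultimately show False by (simp add: power2_eq_square)
qed

instance unital_cstar_algebra \<subseteq> banach ..

text \<open>Keeps \<open>3 ^ Suc n\<close> folded, so that membership in \<open>M3 (Suc n)\<close>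
  stays recognizable.\<close>

declare power_Suc [simp del]

section \<open>The stages and the matrix units of their tensor factors\<close>

context UHF_3_infinity
begin

definition L :: "nat \<Rightarrow> 'u set" where
  "L n = emb n ` M3 n"

text \<open>The matrix unit in the \<open>n\<close>-th tensor factor, factors and indices counted from 0.\<close>

definition f :: "nat \<Rightarrow> nat \<Rightarrow> nat \<Rightarrow> 'u" where
  "f n i j = emb (Suc n) (1\<^sub>m (3 ^ n) \<otimes>\<^sub>K matE i j)"

lemma kron_M3 [simp]: "A \<in> M3 n \<Longrightarrow> B \<in> carrier_mat 3 3 \<Longrightarrow> A \<otimes>\<^sub>K B \<in> M3 (Suc n)"
  unfolding power_Suc2 by (rule kron_carrier)

lemma L_I: "A \<in> M3 n \<Longrightarrow> emb n A \<in> L n"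
  by (auto simp: L_def)

lemma L_add: "x \<in> L n \<Longrightarrow> y \<in> L n \<Longrightarrow> x + y \<in> L n"
  by (force simp: L_def simp flip: emb_add)

lemma L_mult: "x \<in> L n \<Longrightarrow> y \<in> L n \<Longrightarrow> x * y \<in> L n"
  by (force simp: L_def simp flip: emb_mult)

lemma L_scaleC: "x \<in> L n \<Longrightarrow> c *\<^sub>C x \<in> L n"
  by (force simp: L_def simp flip: emb_smult)

lemma L_star: "x \<in> L n \<Longrightarrow> star x \<in> L n"
  by (auto simp: L_def simp flip: emb_adjoint)

lemma L_one: "1 \<in> L n"
  using L_I[of "1\<^sub>m (3 ^ n)" n] by (simp add: emb_one)

lemma L_scaleR: "x \<in> L n \<Longrightarrow> r *\<^sub>R x \<in> L n"
  unfolding scaleR_eq_scaleC by (rule L_scaleC)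

lemma L_zero: "0 \<in> L n"
  using L_scaleR[OF L_one, of 0] by simp

lemma L_uminus: "x \<in> L n \<Longrightarrow> - x \<in> L n"
  using L_scaleR[of x n "-1"] by simp

lemma L_diff: "x \<in> L n \<Longrightarrow> y \<in> L n \<Longrightarrow> x - y \<in> L n"
  using L_add[of x n "- y"] L_uminus by simp

lemma L_sum: "(\<And>i. i \<in> I \<Longrightarrow> g i \<in> L n) \<Longrightarrow> (\<Sum>i\<in>I. g i) \<in> L n"
  by (induction I rule: infinite_finite_induct) (auto simp: L_zero L_add)

lemma L_Suc: "x \<in> L n \<Longrightarrow> x \<in> L (Suc n)"
  by (auto simp: L_def simp flip: emb_connecting)

lemma L_mono: "x \<in> L m \<Longrightarrow> m \<le> n \<Longrightarrow> x \<in> L n"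
  by (rotate_tac, induction n rule: dec_induct) (auto simp: L_Suc)

lemmas L_closed = L_add L_mult L_scaleC L_star L_one L_scaleR L_zero L_uminus L_diff L_sum

lemma emb_zero: "emb n (0\<^sub>m (3 ^ n) (3 ^ n)) = 0"
proof -
  have "0 \<cdot>\<^sub>m 1\<^sub>m (3 ^ n) = (0\<^sub>m (3 ^ n) (3 ^ n) :: complex mat)" by (rule eq_matI) auto
  then show ?thesis using emb_smult[of "1\<^sub>m (3 ^ n)" n 0] by simp
qed

lemma f_L [simp]: "f n i j \<in> L (Suc n)"
  unfolding f_def by (intro L_I kron_M3) auto

lemma emb_kron_matE: "A \<in> M3 n \<Longrightarrow> emb (Suc n) (A \<otimes>\<^sub>K matE i j) = emb n A * f n i j"
  by (simp add: f_def emb_mult[symmetric] emb_connecting[of _ n, symmetric]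
      kron_mult[of _ "3 ^ n" "3 ^ n" _ 3 3 _ "3 ^ n" _ 3])

lemma f_commute: "x \<in> L n \<Longrightarrow> f n i j * x = x * f n i j"
  by (auto simp: L_def f_def emb_mult[symmetric] emb_connecting[of _ n, symmetric]
      kron_mult[of _ "3 ^ n" "3 ^ n" _ 3 3 _ "3 ^ n" _ 3])

lemma f_mult:
  "i < 3 \<Longrightarrow> j < 3 \<Longrightarrow> k < 3 \<Longrightarrow> l < 3 \<Longrightarrow> f n i j * f n k l = (if j = k then f n i l else 0)"
proof -
  assume ijkl: "i < 3" "j < 3" "k < 3" "l < 3"
  have "f n i j * f n k l = emb (Suc n) (1\<^sub>m (3 ^ n) \<otimes>\<^sub>K (matE i j * matE k l))"
    by (simp add: f_def emb_mult[symmetric] kron_mult[of _ "3 ^ n" "3 ^ n" _ 3 3 _ "3 ^ n" _ 3])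
  moreover have "1\<^sub>m (3 ^ n) \<otimes>\<^sub>K 0\<^sub>m 3 3 = 0\<^sub>m (3 ^ Suc n) (3 ^ Suc n)"
    by (rule eq_matI) (auto simp: less_mult_nat_E mult.commute power_Suc)
  ultimately show ?thesis using ijkl emb_zero[of "Suc n"] by (simp add: matE_mult f_def power_Suc mult.commute)
qed

lemma star_f [simp]: "star (f n i j) = f n j i"
proof -
  have "mat_adjoint (1\<^sub>m (3 ^ n)) = (1\<^sub>m (3 ^ n) :: complex mat)"
    by (rule eq_matI) auto
  then show ?thesis by (simp add: f_def emb_adjoint[symmetric] kron_adjoint)
qed

lemma f_sum_one: "f n 0 0 + f n 1 1 + f n 2 2 = 1"
proof -
  have "f n 0 0 + f n 1 1 + f n 2 2 = emb (Suc n) (1\<^sub>m (3 ^ n) \<otimes>\<^sub>K (matE 0 0 + matE 1 1 + matE 2 2))"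
    by (simp add: f_def emb_add[symmetric] kron_add_right[of _ 3 3])
  also have "\<dots> = 1" 
    unfolding matE_sum_one using emb_connecting[of "1\<^sub>m (3 ^ n)" n] by (simp add: emb_one)
  finally show ?thesis .
qed

lemma sum_lessThan_3: "(\<Sum>i<3. g i) = (g 0 + g 1 + g (2 :: nat) :: 'b :: comm_monoid_add)"
  by (simp add: numeral_3_eq_3 numeral_2_eq_2)

text \<open>Each stage consists of the 3 by 3 matrices over the preceding one; the slice maps below
  read off the coefficients \<open>y i j\<close>.\<close>

lemma L_Suc_decomp:
  assumes "x \<in> L (Suc n)"
  obtains y where "\<And>i j. y i j \<in> L n" "x = (\<Sum>i<3. \<Sum>j<3. y i j * f n i j)"
proof -
  obtain A where A: "A \<in> M3 (Suc n)" and x: "x = emb (Suc n) A" using assms by (auto simp: L_def)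
  define B where "B i j = kron_block (3 ^ n) A i j" for i j
  have [simp]: "B i j \<in> M3 n" for i j by (simp add: B_def)
  let ?B = "\<lambda>i j. B i j \<otimes>\<^sub>K matE i j"
  have [simp]: "?B i j \<in> M3 (Suc n)" for i j by (rule kron_M3) auto
  have eq: "A = (?B 0 0 + ?B 0 1 + ?B 0 2) + (?B 1 0 + ?B 1 1 + ?B 1 2) + (?B 2 0 + ?B 2 1 + ?B 2 2)"
    unfolding B_def by (rule kron_block_decomp) (use A in \<open>simp add: mult.commute power_Suc\<close>)
  have "x = (\<Sum>i<3. \<Sum>j<3. emb n (B i j) * f n i j)"
    unfolding x by (subst eq) (simp add: sum_lessThan_3 emb_add emb_kron_matE)
  then show thesis using that[of "\<lambda>i j. emb n (B i j)"] by (auto simp: L_I)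
qed

lemma L_0: "x \<in> L 0 \<Longrightarrow> \<exists>c. x = c *\<^sub>C 1"
proof -
  assume "x \<in> L 0"
  then obtain A where A: "A \<in> carrier_mat 1 1" "x = emb 0 A" by (auto simp: L_def)
  have "A = A $$ (0, 0) \<cdot>\<^sub>m 1\<^sub>m (3 ^ 0)" by (rule eq_matI) (use A in auto)
  then have "x = A $$ (0, 0) *\<^sub>C emb 0 (1\<^sub>m (3 ^ 0))"
    using A(2) emb_smult[of "1\<^sub>m (3 ^ 0)" 0] by (metis one_carrier_mat)
  then show ?thesis by (metis emb_one)
qed

section \<open>Isometry and vector states\<close>

text \<open>An isometry sends only 0 to 0: a difference of operator norm 0 kills every unit vector.
  This carries identities in the C*-algebra back to matrices.\<close>

lemma emb_inj:
  assumes A: "A \<in> M3 n" and B: "B \<in> M3 n" and eq: "emb n A = emb n B"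
  shows "A = B"
proof -
  let ?C = "A + (- 1) \<cdot>\<^sub>m B"
  have C: "?C \<in> M3 n" using A B by auto
  have "emb n ?C = emb n A + (- 1) *\<^sub>C emb n B" using A B by (simp add: emb_add emb_smult)
  also have "\<dots> = 0" using eq by (metis add.right_inverse cspace.scale_minus_left cspace.scale_one)
  finally have 0: "op_norm ?C = 0" using emb_norm[OF C] by simp
  have "?C $$ (i, j) = 0" if "i < 3 ^ n" "j < 3 ^ n" for i j
  proof -
    have "cmod ((?C *\<^sub>v unit_vec (3 ^ n) j) $ i) \<le> l2_norm (?C *\<^sub>v unit_vec (3 ^ n) j)"
      using that A B by (intro cmod_index_le_l2_norm) auto
    also have "\<dots> \<le> 0"
      using l2_norm_mult_mat_vec_le[OF C, of "unit_vec (3 ^ n) j"] 0 by simp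
    finally show ?thesis using that A B by simp
  qed
  then have "A $$ (i, j) = B $$ (i, j)" if "i < 3 ^ n" "j < 3 ^ n" for i j
    using that A B by fastforce
  then show ?thesis by (intro eq_matI) (use A B in auto)
qed

text \<open>The properties of \<open>A \<mapsto> Re \<langle>v, A v\<rangle>\<close> with \<open>\<parallel>v\<parallel> \<le> 1\<close> that enter the norm estimates.\<close>

definition vstate :: "nat \<Rightarrow> ('u \<Rightarrow> real) \<Rightarrow> bool" where
  "vstate n r \<longleftrightarrow>
     (\<forall>x\<in>L n. \<forall>y\<in>L n. r (x + y) = r x + r y) \<and> (\<forall>c. \<forall>x\<in>L n. r (c *\<^sub>R x) = c * r x) \<and>
     (\<forall>x\<in>L n. r (star x) = r x) \<and> (\<forall>x\<in>L n. 0 \<le> r (star x * x)) \<and>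
     (\<forall>x\<in>L n. \<forall>y\<in>L n. r (star (x * y) * (x * y)) \<le> (norm x)\<^sup>2 * r (star y * y)) \<and> r 1 \<le> 1"

text \<open>The squared operator norm of a matrix \<open>A\<close> is the supremum of the squared
  lengths of \<open>A v\<close> over vectors of length at most 1, and each such vector gives a
  \<open>vstate\<close>. Norm estimates thus become inequalities between real numbers.\<close>

lemma norm_square_le_vstate:
  assumes x: "x \<in> L n" and le: "\<And>r. vstate n r \<Longrightarrow> r (star x * x) \<le> c"
  shows "(norm x)\<^sup>2 \<le> c"
proof -
  define r where "r v y = Re ((inv_into (M3 n) (emb n) y *\<^sub>v v) \<bullet>c v)" for v y
  have inv [simp]: "inv_into (M3 n) (emb n) (emb n B) = B" if "B \<in> M3 n" for B
    using that by (intro inv_into_f_f) (auto intro: inj_onI emb_inj)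
  have emb_star_mult: "star (emb n B) * emb n B' = emb n (mat_adjoint B * B')"
    if "B \<in> M3 n" "B' \<in> M3 n" for B B'
    using that by (simp add: emb_mult emb_adjoint)
  have prod: "mat_adjoint B * B \<in> M3 n" if "B \<in> M3 n" for B :: "complex mat"
    using mult_carrier_mat[OF mat_adjoint_carrier[OF that] that] .
  have r_square: "r v (star (emb n B) * emb n B) = (l2_norm (B *\<^sub>v v))\<^sup>2"
    if "B \<in> M3 n" "v \<in> carrier_vec (3 ^ n)" for B v
    using that unfolding l2_norm_square
    by (simp add: emb_star_mult r_def prod adjoint_cscalar_prod[of _ "3 ^ n" "3 ^ n"]
        assoc_mult_mat_vec[of _ "3 ^ n" "3 ^ n"])
  have r: "vstate n (r v)" if v: "v \<in> carrier_vec (3 ^ n)" "l2_norm v \<le> 1" for v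
    unfolding vstate_def
  proof (intro conjI ballI allI)
    show "r v 1 \<le> 1"
      using r_square[of "1\<^sub>m (3 ^ n)" v] v power_le_one[of "l2_norm v" 2] by (simp add: emb_one)
  next
    fix y z assume "y \<in> L n" "z \<in> L n"
    then obtain B C where B: "B \<in> M3 n" "y = emb n B" and C: "C \<in> M3 n" "z = emb n C"
      by (auto simp: L_def)
    show "r v (y + z) = r v y + r v z"
      unfolding B C using B C v
      by (simp add: emb_add[symmetric] r_def add_mult_distrib_mat_vec[of _ "3 ^ n" "3 ^ n"]
          add_scalar_prod_distrib[of _ "3 ^ n"])
    have "l2_norm (B *\<^sub>v (C *\<^sub>v v)) \<le> op_norm B * l2_norm (C *\<^sub>v v)"
      using B C v by (intro l2_norm_mult_mat_vec_le) auto
    then have "(l2_norm (B * C *\<^sub>v v))\<^sup>2 \<le> (op_norm B)\<^sup>2 * (l2_norm (C *\<^sub>v v))\<^sup>2"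
      unfolding power_mult_distrib[symmetric] using B C v by (intro power_mono) auto
    then show "r v (star (y * z) * (y * z)) \<le> (norm y)\<^sup>2 * r v (star z * z)"
      unfolding B C using B C v by (simp add: emb_mult[symmetric] r_square emb_norm)
  next
    fix y assume "y \<in> L n"
    then obtain B where B: "B \<in> M3 n" "y = emb n B" by (auto simp: L_def)
    show "r v (c *\<^sub>R y) = c * r v y" for c
      unfolding B scaleR_eq_scaleC using B v
      by (simp add: emb_smult[symmetric] r_def smult_mat_mult_vec)
    have "(B *\<^sub>v v) \<bullet>c v = cnj (v \<bullet>c (B *\<^sub>v v))"
      using B v by (simp add: scalar_prod_def mult.commute)
    then show "r v (star y) = r v y"
      unfolding B using B v 
      by (simp add: emb_adjoint[symmetric] r_def adjoint_cscalar_prod[of _ "3 ^ n" "3 ^ n"])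
    show "0 \<le> r v (star y * y)" unfolding B using B v by (simp add: r_square)
  qed
  obtain A where A: "A \<in> M3 n" "x = emb n A" using x by (auto simp: L_def)
  \<comment> \<open>The zero vector is admissible and shows that \<open>c\<close> is nonnegative, so
    \<open>sqrt c\<close> squares back to \<open>c\<close>.\<close>
  have "0 \<le> r (0\<^sub>v (3 ^ n)) (star x * x)" unfolding A using A by (simp add: r_square)
  moreover have "l2_norm (0\<^sub>v (3 ^ n)) \<le> 1" by (simp add: l2_norm_def)
  ultimately have "c \<ge> 0" using le[OF r[of "0\<^sub>v (3 ^ n)"]] by simp
  have "op_norm A \<le> sqrt c"
  proof (rule op_norm_le[OF A(1)])
    fix v assume v: "v \<in> carrier_vec (3 ^ n)" "l2_norm v \<le> 1"
    have "(l2_norm (A *\<^sub>v v))\<^sup>2 \<le> c"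
      using le[OF r[OF v]] A v by (simp add: r_square)
    then show "l2_norm (A *\<^sub>v v) \<le> sqrt c" by (rule real_le_rsqrt)
  qed
  then have "(norm x)\<^sup>2 \<le> (sqrt c)\<^sup>2" unfolding A using A
    by (intro power_mono) (simp_all add: emb_norm[symmetric])
  then show ?thesis using \<open>c \<ge> 0\<close> by simp
qed

end

section \<open>Limits of sequences running through given sets\<close>

text \<open>The eventual form is the one that combines over finitely many points and passes to
  closures; both \<open>A_inf\<close> and the density of the stages are used through it.\<close>

lemma seq_limit_in_sets_iff:
  fixes x :: "'a :: metric_space"
  assumes ne: "\<And>n :: nat. A n \<noteq> {}"
  shows "(\<exists>s. (\<forall>n. s n \<in> A n) \<and> s \<longlonglongrightarrow> x) \<longleftrightarrow>
    (\<forall>e>0. \<forall>\<^sub>F n in sequentially. \<exists>y\<in>A n. dist y x < e)"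
proof safe
  fix s and e :: real
  assume s: "\<forall>n. s n \<in> A n" "s \<longlonglongrightarrow> x" and "e > 0"
  then have "\<forall>\<^sub>F n in sequentially. dist (s n) x < e" by (simp add: tendsto_iff)
  then show "\<forall>\<^sub>F n in sequentially. \<exists>y\<in>A n. dist y x < e"
    by eventually_elim (use s in blast)
next
  assume ev: "\<forall>e>0. \<forall>\<^sub>F n in sequentially. \<exists>y\<in>A n. dist y x < e"
  \<comment> \<open>A nearest point may not exist, so a point within \<open>1 / (n + 1)\<close> of
    the distance is chosen.\<close>
  have "\<exists>y\<in>A n. dist x y < infdist x (A n) + inverse (real (Suc n))" for n
  proof -
    have "(INF a\<in>A n. dist x a) < infdist x (A n) + inverse (real (Suc n))"
      using ne by (simp add: infdist_def)
    then show ?thesis using ne by (subst (asm) cINF_less_iff) auto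
  qed
  then obtain s where s: "\<And>n. s n \<in> A n" "\<And>n. dist x (s n) < infdist x (A n) + inverse (real (Suc n))"
    by metis
  have "(\<lambda>n. infdist x (A n)) \<longlonglongrightarrow> 0"
  proof (rule tendstoI)
    fix e :: real assume "e > 0"
    from ev[rule_format, OF this] show "\<forall>\<^sub>F n in sequentially. dist (infdist x (A n)) 0 < e"
    proof eventually_elim
      case (elim n)
      then obtain y where "y \<in> A n" "dist y x < e" by blast
      then have "infdist x (A n) < e" using infdist_le[of y "A n" x] by (simp add: dist_commute)
      then show ?case using infdist_nonneg[of x "A n"] by simp
    qed
  qed
  then have "(\<lambda>n. infdist x (A n) + inverse (real (Suc n))) \<longlonglongrightarrow> 0"
    using LIMSEQ_inverse_real_of_nat tendsto_add_zero by blast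
  then have "(\<lambda>n. dist x (s n)) \<longlonglongrightarrow> 0"
    by (rule tendsto_0_le[of _ _ _ 1])
      (auto intro!: always_eventually less_imp_le[OF less_le_trans[OF s(2)]])
  then have "s \<longlonglongrightarrow> x" by (simp add: tendsto_dist_iff[of s] dist_commute)
  then show "\<exists>s. (\<forall>n. s n \<in> A n) \<and> s \<longlonglongrightarrow> x" using s by blast
qed

lemma tendsto_sum_list:
  fixes g :: "'b \<Rightarrow> nat \<Rightarrow> 'a :: real_normed_vector"
  shows "(\<And>x. x \<in> set xs \<Longrightarrow> g x \<longlonglongrightarrow> a x) \<Longrightarrow> (\<lambda>l. \<Sum>x\<leftarrow>xs. g x l) \<longlonglongrightarrow> (\<Sum>x\<leftarrow>xs. a x)"
  by (induction xs) (auto intro!: tendsto_add)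

section \<open>Powers of matrices over an algebra\<close>

primrec mat_pow :: "nat \<Rightarrow> (nat \<Rightarrow> nat \<Rightarrow> 'a :: ring_1) \<Rightarrow> nat \<Rightarrow> nat \<Rightarrow> nat \<Rightarrow> 'a" where
  "mat_pow m D 0 = (\<lambda>i j. if i = j then 1 else 0)"
| "mat_pow m D (Suc k) = (\<lambda>i j. \<Sum>l<m. D i l * mat_pow m D k l j)"

lemma sum_delta_mult:
  "i < (m :: nat) \<Longrightarrow> (\<Sum>l<m. (if i = l then 1 else 0) * g l) = (g i :: 'a :: ring_1)"
proof -
  assume "i < m"
  have "(\<Sum>l<m. (if i = l then 1 else 0) * g l) = (\<Sum>l<m. if i = l then g l else 0)"
    by (intro sum.cong) auto
  also have "\<dots> = g i" using \<open>i < m\<close> by simp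
  finally show ?thesis .
qed

lemma sum_mult_delta:
  "i < (m :: nat) \<Longrightarrow> (\<Sum>l<m. g l * (if l = i then 1 else 0)) = (g i :: 'a :: ring_1)"
proof -
  assume "i < m"
  have "(\<Sum>l<m. g l * (if l = i then 1 else 0)) = (\<Sum>l<m. if l = i then g l else 0)"
    by (intro sum.cong) auto
  also have "\<dots> = g i" using \<open>i < m\<close> by simp
  finally show ?thesis .
qed

lemma mat_pow_add:
  "i < m \<Longrightarrow> mat_pow m D (k + l) i j = (\<Sum>p<m. mat_pow m D k i p * mat_pow m D l p j)"
proof (induction k arbitrary: i)
  case 0
  then show ?case by (simp add: sum_delta_mult)
next
  case (Suc k)
  have "mat_pow m D (Suc k + l) i j = (\<Sum>q<m. D i q * (\<Sum>p<m. mat_pow m D k q p * mat_pow m D l p j))"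
    by (simp add: Suc)
  also have "\<dots> = (\<Sum>p<m. (\<Sum>q<m. D i q * mat_pow m D k q p) * mat_pow m D l p j)"
    unfolding sum_distrib_left sum_distrib_right
    by (subst sum.swap) (simp add: mult.assoc)
  finally show ?case by simp
qed

lemma mat_pow_1: "j < m \<Longrightarrow> mat_pow m D (Suc 0) i j = D i j"
  by (simp add: sum_mult_delta)

lemma star_mat_pow:
  fixes D :: "nat \<Rightarrow> nat \<Rightarrow> 'a :: unital_cstar_algebra"
  assumes "\<And>i j. i < m \<Longrightarrow> j < m \<Longrightarrow> star (D i j) = D j i"
  shows "i < m \<Longrightarrow> j < m \<Longrightarrow> star (mat_pow m D k i j) = mat_pow m D k j i"
proof (induction k arbitrary: i j)
  case (Suc k)
  have "star (mat_pow m D (Suc k) i j) = (\<Sum>l<m. mat_pow m D k j l * D l i)"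
    using Suc assms by (auto simp: star_sum star_mult intro!: sum.cong)
  \<comment> \<open>The adjoint reverses the product, so the extra factor stands on the right, where
    \<open>mat_pow_add\<close> with \<open>k + Suc 0\<close> splits it off.\<close>
  also have "\<dots> = mat_pow m D (k + Suc 0) j i"
    using Suc.prems by (simp only: mat_pow_add mat_pow_1)
  finally show ?case by simp
qed auto

lemma tendsto_mat_pow:
  fixes D :: "nat \<Rightarrow> nat \<Rightarrow> nat \<Rightarrow> 'a :: real_normed_algebra_1"
  assumes "\<And>i j. i < m \<Longrightarrow> j < m \<Longrightarrow> (\<lambda>l. D l i j) \<longlonglongrightarrow> D' i j"
  shows "i < m \<Longrightarrow> j < m \<Longrightarrow> (\<lambda>l. mat_pow m (D l) k i j) \<longlonglongrightarrow> mat_pow m D' k i j"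
  by (induction k arbitrary: i j) (auto intro!: tendsto_intros assms)

text \<open>The matrix \<open>D\<close> with \<open>H = t (1 - D)\<close>, so that a square root of
  \<open>H\<close> is \<open>sqrt t\<close> times a power series in \<open>D\<close>.\<close>

definition one_minus :: "real \<Rightarrow> (nat \<Rightarrow> nat \<Rightarrow> 'a) \<Rightarrow> nat \<Rightarrow> nat \<Rightarrow> 'a :: real_normed_algebra_1" where
  "one_minus t H i j = (if i = j then 1 else 0) - (1 / t) *\<^sub>R H i j"

section \<open>Coefficients of the square root\<close>

text \<open>The coefficients of the power series of \<open>sqrt (1 - z)\<close>.\<close>

definition sqrt_coeff :: "nat \<Rightarrow> real" where
  "sqrt_coeff n = (1 / 2 gchoose n) * (- 1) ^ n"

text \<open>The square of the series is \<open>1 - z\<close>: by Vandermonde with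
  \<open>1/2 + 1/2 = 1\<close> the convolution is, up to sign, \<open>1 choose n\<close>.\<close>

lemma sqrt_coeff_convolution:
  "(\<Sum>l\<le>n. sqrt_coeff l * sqrt_coeff (n - l)) = (if n = 0 then 1 else if n = 1 then - 1 else 0)"
proof -
  have "(\<Sum>l\<le>n. sqrt_coeff l * sqrt_coeff (n - l)) =
      (\<Sum>l\<le>n. (- 1) ^ n * ((1 / 2 gchoose l) * (1 / 2 gchoose (n - l))))"
    by (intro sum.cong refl) (simp add: sqrt_coeff_def flip: power_add)
  also have "\<dots> = (- 1) ^ n * (\<Sum>l = 0..n. (1 / 2 gchoose l) * (1 / 2 gchoose (n - l)))"
    by (simp add: sum_distrib_left atMost_atLeast0)
  also have "\<dots> = (- 1) ^ n * (1 gchoose n)"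
    using gbinomial_Vandermonde[of "1 / 2 :: real" "1 / 2" n] by simp
  also have "(1 gchoose n :: real) = real (1 choose n)"
    using binomial_gbinomial[of 1 n, where ?'a = real] by simp
  also have "(- 1) ^ n * \<dots> = (if n = 0 then 1 else if n = 1 then - 1 else 0)"
    by (auto simp: binomial_eq_0)
  finally show ?thesis .
qed

lemma sqrt_coeff_eq_pochhammer: "sqrt_coeff n = pochhammer (- (1 / 2)) n / fact n"
  by (simp add: sqrt_coeff_def gbinomial_pochhammer mult.commute[of _ "(- 1) ^ n"])

lemma sqrt_coeff_Suc_nonpos: "sqrt_coeff (Suc n) \<le> 0"
  unfolding sqrt_coeff_eq_pochhammer pochhammer_rec
  by (intro divide_nonpos_nonneg mult_nonpos_nonneg pochhammer_nonneg) auto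

text \<open>The partial sum has the closed form \<open>pochhammer (1/2) n / fact n\<close>.\<close>

lemma sqrt_coeff_partial_sum_nonneg: "(\<Sum>k\<le>n. sqrt_coeff k) \<ge> 0"
proof -
  have "(\<Sum>k\<le>n. sqrt_coeff k) = (- 1) ^ n * ((1 / 2 - 1) gchoose n)"
    unfolding sqrt_coeff_def by (rule gbinomial_sum_lower_neg)
  also have "\<dots> \<ge> 0"
    by (simp add: gbinomial_pochhammer pochhammer_nonneg)
  finally show ?thesis .
qed

text \<open>The coefficient at 0 is 1 and all others are at most 0, so absolute values sum to 2
  minus the nonnegative partial sum. Hence the series converges even when the powers of
  \<open>D\<close> are only bounded.\<close>

lemma summable_abs_sqrt_coeff: "summable (\<lambda>n. \<bar>sqrt_coeff n\<bar>)"
proof (rule bounded_imp_summable[of _ 2])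
  fix n
  have "(\<Sum>k\<le>n. \<bar>sqrt_coeff k\<bar>) = 2 - (\<Sum>k\<le>n. sqrt_coeff k)"
    by (induction n) (use sqrt_coeff_Suc_nonpos in \<open>simp_all add: sqrt_coeff_def[of 0]\<close>)
  then show "(\<Sum>k\<le>n. \<bar>sqrt_coeff k\<bar>) \<le> 2" using sqrt_coeff_partial_sum_nonneg[of n] by simp
qed simp

section \<open>Gram matrices and positivity\<close>

text \<open>Each list entry is a row. Lists leave the number of rows free, which grows under Kraus
  maps.\<close>

definition gram :: "(nat \<Rightarrow> 'a :: unital_cstar_algebra) list \<Rightarrow> nat \<Rightarrow> nat \<Rightarrow> 'a" where
  "gram xs i j = (\<Sum>x\<leftarrow>xs. star (x i) * x j)"

lemma gram_simps [simp]:
  "gram [] i j = 0" "gram (x # xs) i j = star (x i) * x j + gram xs i j"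
  "gram (xs @ ys) i j = gram xs i j + gram ys i j"
  by (simp_all add: gram_def)

lemma star_gram: "star (gram xs i j) = gram xs j i"
  by (induction xs) (auto simp: star_add star_mult star_star)

text \<open>Positivity up to entrywise limits, with no bound on the number of rows along the
  sequence. It passes to limits of maps at once; \<open>pos_mat_factor\<close> later returns to a
  single square factor, as \<open>matrix_positive\<close> demands.\<close>

definition pos_mat :: "nat \<Rightarrow> (nat \<Rightarrow> nat \<Rightarrow> 'a :: unital_cstar_algebra) \<Rightarrow> bool" where
  "pos_mat m H \<longleftrightarrow> (\<exists>X. \<forall>i<m. \<forall>j<m. (\<lambda>l. gram (X l) i j) \<longlonglongrightarrow> H i j)"

lemma pos_matI:
  assumes "\<And>e. e > 0 \<Longrightarrow> \<exists>xs. \<forall>i<m. \<forall>j<m. norm (gram xs i j - H i j) < e"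
  shows "pos_mat m H"
proof -
  have "\<forall>l. \<exists>xs. \<forall>i<m. \<forall>j<m. norm (gram xs i j - H i j) < inverse (real (Suc l))"
    by (intro allI assms) auto
  then obtain X where X: "\<And>l. \<forall>i<m. \<forall>j<m. norm (gram (X l) i j - H i j) < inverse (real (Suc l))"
    by metis
  have "(\<lambda>l. gram (X l) i j) \<longlonglongrightarrow> H i j" if "i < m" "j < m" for i j
    by (rule LIM_zero_cancel, rule tendsto_0_le[OF LIMSEQ_inverse_real_of_nat, of _ 1])
      (use X that in \<open>auto intro!: always_eventually less_imp_le\<close>)
  then show ?thesis unfolding pos_mat_def by blast
qed

lemma pos_mat_limit:
  assumes pos: "\<And>l. pos_mat m (H l)" and lim: "\<And>i j. i < m \<Longrightarrow> j < m \<Longrightarrow> (\<lambda>l. H l i j) \<longlonglongrightarrow> H' i j"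
  shows "pos_mat m H'"
proof (rule pos_matI)
  fix e :: real assume e: "e > 0"
  have "\<forall>\<^sub>F l in sequentially. \<forall>i\<in>{..<m}. \<forall>j\<in>{..<m}. dist (H l i j) (H' i j) < e / 2"
    by (intro eventually_ball_finite ballI tendstoD lim) (use e in auto)
  from eventually_happens'[OF sequentially_bot this]
  obtain l where l: "\<And>i j. i < m \<Longrightarrow> j < m \<Longrightarrow> norm (H l i j - H' i j) < e / 2"
    by (auto simp: dist_norm)
  obtain X where X: "\<forall>i<m. \<forall>j<m. (\<lambda>n. gram (X n) i j) \<longlonglongrightarrow> H l i j"
    using pos unfolding pos_mat_def by blast
  have "\<forall>\<^sub>F n in sequentially. \<forall>i\<in>{..<m}. \<forall>j\<in>{..<m}. dist (gram (X n) i j) (H l i j) < e / 2"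
    by (intro eventually_ball_finite ballI tendstoD) (use X e in auto)
  from eventually_happens'[OF sequentially_bot this]
  obtain n where n: "\<And>i j. i < m \<Longrightarrow> j < m \<Longrightarrow> norm (gram (X n) i j - H l i j) < e / 2"
    by (auto simp: dist_norm)
  have "norm (gram (X n) i j - H' i j) < e" if "i < m" "j < m" for i j
    using l[OF that] n[OF that] norm_triangle_ineq[of "gram (X n) i j - H l i j" "H l i j - H' i j"]
    by simp
  then show "\<exists>xs. \<forall>i<m. \<forall>j<m. norm (gram xs i j - H' i j) < e" by blast
qed

lemma pos_mat_gram: "pos_mat m (gram xs)"
  unfolding pos_mat_def by (auto intro!: exI[of _ "\<lambda>_. xs"])

lemma pos_mat_star:
  assumes "pos_mat m H" "i < m" "j < m"
  shows "star (H i j) = H j i"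
proof -
  obtain X where X: "\<forall>i<m. \<forall>j<m. (\<lambda>n. gram (X n) i j) \<longlonglongrightarrow> H i j"
    using assms unfolding pos_mat_def by blast
  then have "(\<lambda>n. star (gram (X n) i j)) \<longlonglongrightarrow> star (H i j)"
    using assms by (intro tendsto_star) auto
  then show ?thesis using X assms LIMSEQ_unique unfolding star_gram by blast
qed

section \<open>Kraus maps\<close>

definition kraus :: "'a list \<Rightarrow> 'a \<Rightarrow> 'a :: unital_cstar_algebra" where
  "kraus cs x = (\<Sum>c\<leftarrow>cs. star c * x * c)"

lemma kraus_simps [simp]:
  "kraus [] x = 0" "kraus (c # cs) x = star c * x * c + kraus cs x"
  "kraus (cs @ ds) x = kraus cs x + kraus ds x"
  by (simp_all add: kraus_def)

lemma kraus_add: "kraus cs (x + y) = kraus cs x + kraus cs y"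
  by (induction cs) (auto simp: algebra_simps)

lemma kraus_scaleC: "kraus cs (a *\<^sub>C x) = a *\<^sub>C kraus cs x"
  by (induction cs) (auto simp: mult_scaleC_left mult_scaleC_right scaleC_add_right)

lemma kraus_scaleR: "kraus cs (a *\<^sub>R x) = a *\<^sub>R kraus cs x"
  by (simp add: scaleR_eq_scaleC kraus_scaleC)

lemma kraus_zero [simp]: "kraus cs 0 = 0"
  by (induction cs) auto

lemma kraus_comp: "kraus cs (kraus ds x) = kraus (concat (map (\<lambda>c. map (\<lambda>d. d * c) ds) cs)) x"
proof (induction cs)
  case (Cons c cs)
  have "star c * kraus ds x * c = kraus (map (\<lambda>d. d * c) ds) x"
    by (induction ds) (auto simp: algebra_simps star_mult)
  then show ?case using Cons by simp
qed simp

lemma norm_kraus_le: "norm (kraus cs x) \<le> (\<Sum>c\<leftarrow>cs. (norm c)\<^sup>2) * norm x"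
proof (induction cs)
  case (Cons c cs)
  have "norm (star c * x * c) \<le> norm (star c * x) * norm c" by (rule norm_mult_ineq)
  also have "\<dots> \<le> (norm (star c) * norm x) * norm c"
    by (intro mult_right_mono norm_mult_ineq) auto
  finally have "norm (star c * x * c) \<le> (norm c)\<^sup>2 * norm x"
    by (simp add: power2_eq_square mult_ac)
  then show ?case using Cons norm_triangle_ineq[of "star c * x * c" "kraus cs x"]
    by (simp add: algebra_simps)
qed simp

lemma bounded_linear_kraus: "bounded_linear (kraus cs)"
  by (rule bounded_linear_intro[of _ "\<Sum>c\<leftarrow>cs. (norm c)\<^sup>2"])
    (simp_all add: kraus_add kraus_scaleR, metis norm_kraus_le mult.commute)

text \<open>Complete positivity made explicit: compressing by \<open>c\<close> multiplies each row
  by \<open>c\<close> on the right.\<close>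

lemma kraus_gram:
  "kraus cs (gram xs i j) = gram (concat (map (\<lambda>c. map (\<lambda>x i. x i * c) xs) cs)) i j"
proof (induction cs)
  case (Cons c cs)
  have "star c * gram xs i j * c = gram (map (\<lambda>x i. x i * c) xs) i j"
    by (induction xs) (auto simp: algebra_simps star_mult)
  then show ?case using Cons by simp
qed simp

lemma pos_mat_kraus:
  assumes "pos_mat m H"
  shows "pos_mat m (\<lambda>i j. kraus cs (H i j))"
proof -
  obtain X where X: "\<forall>i<m. \<forall>j<m. (\<lambda>l. gram (X l) i j) \<longlonglongrightarrow> H i j"
    using assms unfolding pos_mat_def by blast
  then have "\<forall>i<m. \<forall>j<m. (\<lambda>l. kraus cs (gram (X l) i j)) \<longlonglongrightarrow> kraus cs (H i j)"
    by (auto intro!: bounded_linear.tendsto[OF bounded_linear_kraus])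
  then show ?thesis
    unfolding pos_mat_def kraus_gram
    by (rule exI[of _ "\<lambda>l. concat (map (\<lambda>c. map (\<lambda>x i. x i * c) (X l)) cs)"])
qed

text \<open>The Kadison-Schwarz inequality with its defect as a sum of squares. For
  \<open>kraus cs 1 = 1\<close> and \<open>y = kraus cs x\<close> the last three terms collapse to
  \<open>star y * y\<close>. Keeping \<open>y\<close> independent of \<open>cs\<close> lets the
  induction go through.\<close>

lemma kadison_schwarz_identity:
  "kraus cs (star x * x) = (\<Sum>c\<leftarrow>cs. star (x * c - c * y) * (x * c - c * y))
     + star y * kraus cs x + star (kraus cs x) * y - star y * kraus cs 1 * y"
proof (induction cs)
  case (Cons c cs)
  have "star (x * c - c * y) * (x * c - c * y) =
      star c * (star x * x) * c - star c * star x * c * y - star y * (star c * x * c) + star y * (star c * c) * y"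
    by (simp add: algebra_simps star_mult star_diff)
  then show ?case
    unfolding kraus_simps list.map sum_list.Cons Cons.IH
    by (simp add: algebra_simps star_mult star_add star_star)
qed simp

section \<open>Factorization of positive matrices\<close>

lemma gram_sandwich:
  "(\<Sum>x\<leftarrow>xs. star (\<Sum>i<m. x i * u i) * (\<Sum>j<m. x j * w j)) =
    (\<Sum>i<m. star (u i) * (\<Sum>j<m. gram xs i j * w j))"
proof (induction xs)
  case (Cons x xs)
  have "star (\<Sum>i<m. x i * u i) * (\<Sum>j<m. x j * w j) =
      (\<Sum>i<m. star (u i) * (\<Sum>j<m. star (x i) * x j * w j))"
    by (simp add: star_sum star_mult sum_distrib_left sum_distrib_right mult.assoc)
      (rule sum.swap)
  then show ?case using Cons
    by (simp add: sum.distrib distrib_right distrib_left)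
qed simp

text \<open>The binomial series of \<open>sqrt (1 - D)\<close> for \<open>D = one_minus t H\<close>
  converges absolutely in each entry, since its coefficients are summable and the powers of
  \<open>D\<close> are bounded. Its sum \<open>R\<close> is Hermitian with entries in the closed set
  \<open>S\<close>, and \<open>R\<close> squares to \<open>1 - D = H / t\<close>.\<close>

lemma sqrt_eq_gram:
  fixes H :: "nat \<Rightarrow> nat \<Rightarrow> 'a :: unital_cstar_algebra"
  assumes t: "t > 0" and herm: "\<And>i j. i < m \<Longrightarrow> j < m \<Longrightarrow> star (H i j) = H j i"
    and bound: "\<And>k i j. i < m \<Longrightarrow> j < m \<Longrightarrow> norm (mat_pow m (one_minus t H) k i j) \<le> 1"
    and S: "closed S" "0 \<in> S" "1 \<in> S" "\<And>x y. x \<in> S \<Longrightarrow> y \<in> S \<Longrightarrow> x + y \<in> S"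
      "\<And>c x. x \<in> S \<Longrightarrow> c *\<^sub>R x \<in> S" "\<And>x y. x \<in> S \<Longrightarrow> y \<in> S \<Longrightarrow> x * y \<in> S"
    and HS: "\<And>i j. i < m \<Longrightarrow> j < m \<Longrightarrow> H i j \<in> S"
  obtains R where "\<And>i j. i < m \<Longrightarrow> j < m \<Longrightarrow> R i j \<in> S"
    "\<And>i j. i < m \<Longrightarrow> j < m \<Longrightarrow> H i j = (\<Sum>k<m. star (R k i) * R k j)"
proof -
  define D where "D = one_minus t H"
  have S_sum: "(\<Sum>i\<in>I. g i) \<in> S" if "\<And>i. i \<in> I \<Longrightarrow> g i \<in> S" for I and g :: "nat \<Rightarrow> 'a"
    using that by (induction I rule: infinite_finite_induct) (auto simp: S)
  have S_diff: "x - y \<in> S" if "x \<in> S" "y \<in> S" for x y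
    using S(4)[OF that(1) S(5)[OF that(2), of "-1"]] by simp
  have D_herm: "star (D i j) = D j i" if "i < m" "j < m" for i j
    using that herm by (auto simp: D_def one_minus_def star_diff star_scaleR)
  have D_S: "D i j \<in> S" if "i < m" "j < m" for i j
    unfolding D_def one_minus_def using that HS by (intro S_diff S(5)) (auto simp: S)
  have pow_S: "mat_pow m D k i j \<in> S" if "i < m" "j < m" for k i j
    using that by (induction k arbitrary: i j) (auto intro!: S_sum S D_S)
  define g where "g i j n = sqrt_coeff n *\<^sub>R mat_pow m D n i j" for i j n
  have g_summable: "summable (\<lambda>n. norm (g i j n))" if "i < m" "j < m" for i j
    by (rule summable_comparison_test'[OF summable_abs_sqrt_coeff, of 0])
      (use bound[folded D_def] that in \<open>auto simp: g_def intro!: mult_left_le\<close>)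
  define R where "R i j = (\<Sum>n. g i j n)" for i j
  have g_sums: "g i j sums R i j" if "i < m" "j < m" for i j
    unfolding R_def by (rule summable_sums[OF summable_norm_cancel[OF g_summable[OF that]]])
  have R_S: "R i j \<in> S" if "i < m" "j < m" for i j
  proof (rule Lim_in_closed_set[OF S(1) _ _ g_sums[OF that, unfolded sums_def]])
    show "\<forall>\<^sub>F n in sequentially. (\<Sum>k<n. g i j k) \<in> S"
      by (intro always_eventually allI S_sum) (auto simp: g_def intro!: S pow_S that)
  qed simp
  have R_herm: "star (R i j) = R j i" if "i < m" "j < m" for i j
  proof -
    have "(\<lambda>n. star (g i j n)) sums star (R i j)"
      by (rule bounded_linear.sums[OF bounded_linear_star g_sums[OF that]])
    moreover have "(\<lambda>n. star (g i j n)) = g j i"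
      by (rule ext) (simp add: g_def star_scaleR star_mat_pow[OF D_herm] that)
    ultimately show ?thesis using g_sums[OF that(2,1)] sums_unique2[of "g j i"] by simp
  qed
  \<comment> \<open>In the Cauchy product the inner sum over \<open>p\<close> merges
    \<open>D^l\<close> and \<open>D^(n-l)\<close> into \<open>D^n\<close>; the convolution of
    coefficients that remains vanishes for \<open>n > 1\<close>.\<close>
  have conv: "(\<Sum>p<m. R i p * R p j) = (1 / t) *\<^sub>R H i j" if "i < m" "j < m" for i j
  proof -
    have "(\<lambda>n. \<Sum>p<m. \<Sum>l\<le>n. g i p l * g p j (n - l)) sums (\<Sum>p<m. R i p * R p j)"
      unfolding R_def by (intro sums_sum Cauchy_product_sums g_summable) (use that in auto)
    moreover have "(\<Sum>p<m. \<Sum>l\<le>n. g i p l * g p j (n - l)) =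
        (if n = 0 then 1 else if n = 1 then - 1 else 0) *\<^sub>R mat_pow m D n i j" for n
    proof -
      have "(\<Sum>p<m. \<Sum>l\<le>n. g i p l * g p j (n - l)) =
          (\<Sum>l\<le>n. (sqrt_coeff l * sqrt_coeff (n - l)) *\<^sub>R
            (\<Sum>p<m. mat_pow m D l i p * mat_pow m D (n - l) p j))"
        by (subst sum.swap) (simp add: g_def scaleR_sum_right mult.commute)
      also have "\<dots> = (\<Sum>l\<le>n. (sqrt_coeff l * sqrt_coeff (n - l)) *\<^sub>R mat_pow m D n i j)"
        using that by (intro sum.cong refl) (simp flip: mat_pow_add)
      finally show ?thesis by (simp add: sqrt_coeff_convolution flip: scaleR_sum_left)
    qed
    ultimately have "(\<lambda>n. (if n = 0 then 1 else if n = 1 then - 1 else 0) *\<^sub>R mat_pow m D n i j)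
      sums (\<Sum>p<m. R i p * R p j)" by simp
    moreover have "(\<lambda>n. (if n = 0 then 1 else if n = 1 then - 1 else 0) *\<^sub>R mat_pow m D n i j)
      sums (\<Sum>n\<in>{0, 1}. (if n = 0 then 1 else if n = 1 then - 1 else 0) *\<^sub>R mat_pow m D n i j)"
      by (rule sums_finite) auto
    ultimately have "(\<Sum>p<m. R i p * R p j) = (if i = j then 1 else 0) - D i j"
      using sums_unique2[of _ "\<Sum>p<m. R i p * R p j"] that by (simp add: sum_mult_delta split del: if_split)
    then show ?thesis by (simp add: D_def one_minus_def)
  qed
  show thesis
  \<comment> \<open>The factor \<open>sqrt t\<close> undoes the scaling by \<open>1 / t\<close>;
    since \<open>R\<close> is Hermitian, the Gram matrix of its rows is its square.\<close>
  proof (rule that[of "\<lambda>i j. sqrt t *\<^sub>R R i j"])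
    show "sqrt t *\<^sub>R R i j \<in> S" if "i < m" "j < m" for i j
      by (intro S(5) R_S that)
    fix i j assume ij: "i < m" "j < m"
    have "(\<Sum>k<m. star (sqrt t *\<^sub>R R k i) * (sqrt t *\<^sub>R R k j)) = t *\<^sub>R (\<Sum>k<m. R i k * R k j)"
      using ij t by (simp add: star_scaleR R_herm scaleR_sum_right)
    then show "H i j = (\<Sum>k<m. star (sqrt t *\<^sub>R R k i) * (sqrt t *\<^sub>R R k j))"
      using conv[OF ij] t by simp
  qed
qed

section \<open>Norm estimates through vector states\<close>

context UHF_3_infinity
begin

lemma vstate_add: "vstate n r \<Longrightarrow> x \<in> L n \<Longrightarrow> y \<in> L n \<Longrightarrow> r (x + y) = r x + r y"
  and vstate_scaleR: "vstate n r \<Longrightarrow> x \<in> L n \<Longrightarrow> r (c *\<^sub>R x) = c * r x"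
  and vstate_star: "vstate n r \<Longrightarrow> x \<in> L n \<Longrightarrow> r (star x) = r x"
  and vstate_nonneg: "vstate n r \<Longrightarrow> x \<in> L n \<Longrightarrow> 0 \<le> r (star x * x)"
  and vstate_mult_le:
    "vstate n r \<Longrightarrow> x \<in> L n \<Longrightarrow> y \<in> L n \<Longrightarrow> r (star (x * y) * (x * y)) \<le> (norm x)\<^sup>2 * r (star y * y)"
  and vstate_one: "vstate n r \<Longrightarrow> r 1 \<le> 1"
  by (auto simp: vstate_def)

lemma vstate_zero: "vstate n r \<Longrightarrow> r 0 = 0"
  using vstate_scaleR[of n r 0 0] by (simp add: L_zero)

lemma vstate_diff: "vstate n r \<Longrightarrow> x \<in> L n \<Longrightarrow> y \<in> L n \<Longrightarrow> r (x - y) = r x - r y"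
  using vstate_add[of n r x "- y"] vstate_scaleR[of n r y "-1"] by (simp add: L_uminus)

lemma vstate_sum:
  "vstate n r \<Longrightarrow> (\<And>i. i \<in> I \<Longrightarrow> g i \<in> L n) \<Longrightarrow> r (\<Sum>i\<in>I. g i) = (\<Sum>i\<in>I. r (g i))"
  by (induction I rule: infinite_finite_induct) (auto simp: vstate_zero vstate_add L_sum)

lemma L_sum_list: "(\<And>x. x \<in> set xs \<Longrightarrow> g x \<in> L n) \<Longrightarrow> (\<Sum>x\<leftarrow>xs. g x) \<in> L n"
  by (induction xs) (auto simp: L_closed)

lemma vstate_sum_list:
  "vstate n r \<Longrightarrow> (\<And>x. x \<in> set xs \<Longrightarrow> g x \<in> L n) \<Longrightarrow> r (\<Sum>x\<leftarrow>xs. g x) = (\<Sum>x\<leftarrow>xs. r (g x))"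
  by (induction xs) (auto simp: vstate_zero vstate_add L_sum_list)

text \<open>Cauchy-Schwarz together with the inequality of arithmetic and geometric means: expand
  \<open>0 \<le> r (star z * z)\<close> for \<open>z = s x - h y\<close> with
  \<open>s = norm h\<close>, then divide by \<open>s\<close>.\<close>

lemma vstate_sandwich_le:
  assumes r: "vstate n r" and L: "x \<in> L n" "h \<in> L n" "y \<in> L n"
  shows "r (star x * h * y) \<le> norm h / 2 * (r (star x * x) + r (star y * y))"
proof (cases "h = 0")
  case True
  then show ?thesis using vstate_zero[OF r] by simp
next
  case False
  define s where "s = norm h"
  have s: "s > 0" using False by (simp add: s_def)
  define z where "z = s *\<^sub>R x - h * y"
  have "r (star (h * y) * x) = r (star x * (h * y))"
    using vstate_star[OF r, of "star x * (h * y)"] L by (simp add: star_mult star_star L_closed)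
  moreover have "star z * z = s\<^sup>2 *\<^sub>R (star x * x) - s *\<^sub>R (star x * (h * y)) - s *\<^sub>R (star (h * y) * x)
      + star (h * y) * (h * y)"
    by (simp add: z_def star_diff star_scaleR algebra_simps power2_eq_square)
  ultimately have "r (star z * z) = s\<^sup>2 * r (star x * x) - 2 * s * r (star x * (h * y)) + r (star (h * y) * (h * y))"
    using r L by (simp add: vstate_add vstate_diff vstate_scaleR L_closed)
  moreover have "0 \<le> r (star z * z)" using r L by (intro vstate_nonneg) (auto simp: z_def L_closed)
  moreover have "r (star (h * y) * (h * y)) \<le> s\<^sup>2 * r (star y * y)"
    unfolding s_def using r L by (intro vstate_mult_le)
  ultimately have "s * (2 * r (star x * (h * y))) \<le> s * (s * (r (star x * x) + r (star y * y)))"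
    by (simp add: algebra_simps power2_eq_square)
  then have "2 * r (star x * (h * y)) \<le> s * (r (star x * x) + r (star y * y))"
    using s by (simp only: mult_le_cancel_left_pos)
  then show ?thesis by (simp add: s_def mult.assoc)
qed

lemma vstate_le_norm:
  assumes r: "vstate n r" and a: "a \<in> L n"
  shows "r a \<le> norm a"
proof -
  have "r a \<le> norm a * r 1" using vstate_sandwich_le[OF r L_one a L_one] by simp
  also have "\<dots> \<le> norm a" using vstate_one[OF r] by (intro mult_left_le) auto
  finally show ?thesis .
qed

lemma dense_sequence: "\<exists>s. (\<forall>l. s l \<in> L l) \<and> s \<longlonglongrightarrow> x"
proof (subst seq_limit_in_sets_iff, safe)
  fix e :: real assume "e > 0"
  have "x \<in> closure (\<Union>n. L n)" using emb_dense by (simp add: L_def)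
  then obtain n y where "y \<in> L n" "dist y x < e"
    unfolding closure_approachable using \<open>e > 0\<close> by blast
  then show "\<forall>\<^sub>F n in sequentially. \<exists>y\<in>L n. dist y x < e"
    by (auto simp: eventually_sequentially intro!: exI[of _ n] bexI[of _ y] intro: L_mono)
qed (use L_zero in blast)

text \<open>Adding squares cannot lower the norm of \<open>star x * x\<close>. On a finite stage
  each vector state sees this, and density extends it to the whole algebra.\<close>

lemma norm_square_le_add_squares:
  fixes x :: 'u
  shows "(norm x)\<^sup>2 \<le> norm (star x * x + (\<Sum>y\<leftarrow>ys. star y * y))"
proof -
  have "\<forall>x. \<exists>s. (\<forall>l. s l \<in> L l) \<and> s \<longlonglongrightarrow> x" using dense_sequence by blast
  then obtain s where s: "\<And>x l. s x l \<in> L l" "\<And>x. s x \<longlonglongrightarrow> x" by metis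
  have "(norm (s x l))\<^sup>2 \<le> norm (star (s x l) * s x l + (\<Sum>y\<leftarrow>ys. star (s y l) * s y l))" for l
  proof (rule norm_square_le_vstate[OF s(1)])
    fix r assume r: "vstate l r"
    have "(\<Sum>y\<leftarrow>ys. r (star (s y l) * s y l)) \<ge> 0"
      by (intro sum_list_nonneg) (auto intro!: vstate_nonneg[OF r] s)
    then have "r (star (s x l) * s x l) \<le> r (star (s x l) * s x l + (\<Sum>y\<leftarrow>ys. star (s y l) * s y l))"
      by (simp add: vstate_add[OF r] vstate_sum_list[OF r] L_closed L_sum_list s)
    also have "\<dots> \<le> norm (star (s x l) * s x l + (\<Sum>y\<leftarrow>ys. star (s y l) * s y l))"
      by (intro vstate_le_norm[OF r]) (simp add: L_closed L_sum_list s)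
    finally show "r (star (s x l) * s x l) \<le> norm (star (s x l) * s x l + (\<Sum>y\<leftarrow>ys. star (s y l) * s y l))" .
  qed
  then show ?thesis
    by (intro LIMSEQ_le[of "\<lambda>l. (norm (s x l))\<^sup>2" _ "\<lambda>l. norm (star (s x l) * s x l + (\<Sum>y\<leftarrow>ys. star (s y l) * s y l))"])
      (auto intro!: tendsto_intros tendsto_sum_list s)
qed

text \<open>A Gram matrix \<open>H\<close> bounded by \<open>t\<close> makes
  \<open>1 - H / t\<close> a contraction on columns, for the seminorm induced by \<open>r\<close>.
  With \<open>B\<close> the form of \<open>H\<close> and \<open>q\<close> the squared seminorm, the
  claim reads \<open>q u - (2/t) B u u + q (H u) / t^2 \<le> q u\<close>; it follows from
  \<open>q (H u) \<le> t B u u\<close>, the fact \<open>key\<close>.\<close>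

lemma local_contraction:
  assumes r: "vstate n r" and xs: "\<And>x i. x \<in> set xs \<Longrightarrow> i < m \<Longrightarrow> x i \<in> L n"
    and t: "t > 0" "(\<Sum>i<m. \<Sum>j<m. norm (gram xs i j)) \<le> t"
    and u: "\<And>i. i < m \<Longrightarrow> u i \<in> L n"
  shows "(\<Sum>i<m. r (star (\<Sum>j<m. one_minus t (gram xs) i j * u j) * (\<Sum>j<m. one_minus t (gram xs) i j * u j)))
    \<le> (\<Sum>i<m. r (star (u i) * u i))"
proof -
  define H where "H = gram xs"
  \<comment> \<open>In matrix terms: \<open>ap w\<close> is \<open>H w\<close>,
    \<open>ev w x\<close> is the row \<open>x\<close> applied to the column \<open>w\<close>, and
    \<open>B w w'\<close> is the pairing of \<open>w\<close> with \<open>H w'\<close>.\<close>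
  define ap where "ap w i = (\<Sum>j<m. H i j * w j)" for w i
  define ev where "ev w x = (\<Sum>j<m. x j * w j)" for w and x :: "nat \<Rightarrow> 'u"
  define q where "q w = (\<Sum>i<m. r (star (w i) * w i))" for w
  define B where "B w w' = (\<Sum>i<m. r (star (w i) * ap w' i))" for w w'
  have H_L: "H i j \<in> L n" if "i < m" "j < m" for i j
    unfolding H_def gram_def using that xs by (intro L_sum_list L_mult L_star) auto
  have ap_L: "ap w i \<in> L n" if "\<And>i. i < m \<Longrightarrow> w i \<in> L n" "i < m" for w i
    unfolding ap_def using that H_L by (intro L_sum L_mult) auto
  have ev_L: "ev w x \<in> L n" if "\<And>i. i < m \<Longrightarrow> w i \<in> L n" "x \<in> set xs" for w x
    unfolding ev_def using that xs by (intro L_sum L_mult) auto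
  have B_eq: "(\<Sum>x\<leftarrow>xs. r (star (ev w x) * ev w' x)) = B w w'"
    if w: "\<And>i. i < m \<Longrightarrow> w i \<in> L n" "\<And>i. i < m \<Longrightarrow> w' i \<in> L n" for w w'
  proof -
    have "(\<Sum>x\<leftarrow>xs. r (star (ev w x) * ev w' x)) = r (\<Sum>x\<leftarrow>xs. star (ev w x) * ev w' x)"
      by (rule vstate_sum_list[OF r, symmetric]) (intro L_mult L_star ev_L w)
    also have "(\<Sum>x\<leftarrow>xs. star (ev w x) * ev w' x) = (\<Sum>i<m. star (w i) * ap w' i)"
      unfolding ev_def ap_def H_def by (rule gram_sandwich)
    also have "r \<dots> = B w w'" unfolding B_def
      by (rule vstate_sum[OF r]) (auto intro!: L_mult L_star w ap_L)
    finally show ?thesis .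
  qed
  \<comment> \<open>Since \<open>H\<close> is Hermitian, pairing \<open>w\<close> with
    \<open>H (H w)\<close> is pairing \<open>H w\<close> with itself.\<close>
  have B_ap: "B w (ap w) = q (ap w)" if w: "\<And>i. i < m \<Longrightarrow> w i \<in> L n" for w
  proof -
    have "(\<Sum>i<m. star (w i) * ap (ap w) i) = (\<Sum>i<m. \<Sum>p<m. \<Sum>j<m. star (w i) * H i p * (H p j * w j))"
      by (simp add: ap_def sum_distrib_left mult.assoc)
    also have "\<dots> = (\<Sum>p<m. \<Sum>i<m. \<Sum>j<m. star (w i) * H i p * (H p j * w j))" by (rule sum.swap)
    also have "\<dots> = (\<Sum>p<m. star (ap w p) * ap w p)"
      by (simp add: ap_def star_sum star_mult sum_product H_def star_gram)
    finally have "r (\<Sum>i<m. star (w i) * ap (ap w) i) = r (\<Sum>j<m. star (ap w j) * ap w j)" by simp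
    then show ?thesis unfolding B_def q_def
      by (subst (asm) (1 2) vstate_sum[OF r]) (auto intro!: L_mult L_star w ap_L)
  qed
  have q_nonneg: "q w \<ge> 0" if w: "\<And>i. i < m \<Longrightarrow> w i \<in> L n" for w
    unfolding q_def by (intro sum_nonneg vstate_nonneg[OF r] w) auto
  \<comment> \<open>Every entry contributes at most its norm times \<open>q w\<close>, so the sum of
    all entry norms bounds the form.\<close>
  have B_le: "B w w \<le> t * q w" if w: "\<And>i. i < m \<Longrightarrow> w i \<in> L n" for w
  proof -
    have wq: "r (star (w i) * w i) \<le> q w" if "i < m" for i
      unfolding q_def by (rule member_le_sum) (use that in \<open>auto intro!: vstate_nonneg[OF r] w\<close>)
    have "B w w = (\<Sum>i<m. \<Sum>j<m. r (star (w i) * H i j * w j))"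
      unfolding B_def ap_def sum_distrib_left
      by (intro sum.cong refl, subst vstate_sum[OF r]) (auto intro!: L_mult L_star H_L w simp: mult.assoc)
    also have "\<dots> \<le> (\<Sum>i<m. \<Sum>j<m. norm (H i j) / 2 * (r (star (w i) * w i) + r (star (w j) * w j)))"
      by (intro sum_mono vstate_sandwich_le[OF r]) (auto intro!: H_L w)
    also have "\<dots> \<le> (\<Sum>i<m. \<Sum>j<m. norm (H i j) / 2 * (q w + q w))"
      by (intro sum_mono mult_left_mono add_mono wq) auto
    also have "\<dots> = (\<Sum>i<m. \<Sum>j<m. norm (H i j)) * q w"
      by (simp add: sum_distrib_right)
    also have "\<dots> \<le> t * q w" using t q_nonneg[OF w] by (intro mult_right_mono) (auto simp: H_def)
    finally show ?thesis .
  qed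
  have apu: "ap u i \<in> L n" if "i < m" for i using ap_L[of u i] u that by blast
  have square_diff: "r (star (a - c *\<^sub>R b) * (a - c *\<^sub>R b)) =
      r (star a * a) - 2 * c * r (star a * b) + c\<^sup>2 * r (star b * b)"
    if ab: "a \<in> L n" "b \<in> L n" for a b c
  proof -
    have "r (star b * a) = r (star a * b)"
      using vstate_star[OF r, of "star a * b"] ab by (simp add: star_mult star_star L_closed)
    moreover have "star (a - c *\<^sub>R b) * (a - c *\<^sub>R b) =
        star a * a - c *\<^sub>R (star a * b) - c *\<^sub>R (star b * a) + c\<^sup>2 *\<^sub>R (star b * b)"
      by (simp add: star_diff star_scaleR algebra_simps power2_eq_square)
    ultimately show ?thesis using r ab by (simp add: vstate_add vstate_diff vstate_scaleR L_closed)
  qed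
  \<comment> \<open>Positivity of \<open>B\<close> at the column \<open>u - H u / t\<close>, read
    off row by row; with \<open>B u (H u) = q (H u)\<close> and \<open>B_le\<close> at
    \<open>H u\<close> this becomes \<open>key\<close>.\<close>
  have "0 \<le> (\<Sum>x\<leftarrow>xs. r (star (ev u x - (1 / t) *\<^sub>R ev (ap u) x) * (ev u x - (1 / t) *\<^sub>R ev (ap u) x)))"
    by (intro sum_list_nonneg) (auto intro!: vstate_nonneg[OF r] L_diff L_scaleR ev_L u apu)
  also have "\<dots> = (\<Sum>x\<leftarrow>xs. r (star (ev u x) * ev u x) - 2 * (1 / t) * r (star (ev u x) * ev (ap u) x)
      + (1 / t)\<^sup>2 * r (star (ev (ap u) x) * ev (ap u) x))"
    by (intro arg_cong[where f = sum_list] map_cong refl square_diff ev_L u apu)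
  also have "\<dots> = B u u - 2 * (1 / t) * B u (ap u) + (1 / t)\<^sup>2 * B (ap u) (ap u)"
    unfolding sum_list_addf sum_list_subtractf sum_list_const_mult
    by (simp only: B_eq u apu)
  also have "\<dots> \<le> B u u - 2 * (1 / t) * q (ap u) + (1 / t)\<^sup>2 * (t * q (ap u))"
    using B_le[of "ap u", OF apu] B_ap[OF u] by (simp add: mult_left_mono)
  also have "\<dots> = B u u - q (ap u) / t"
    using t by (simp add: power2_eq_square field_simps)
  finally have key: "q (ap u) / t \<le> B u u" by simp
  have ap_eq: "(\<Sum>j<m. one_minus t (gram xs) i j * u j) = u i - (1 / t) *\<^sub>R ap u i" if "i < m" for i
    using that unfolding one_minus_def ap_def H_def left_diff_distrib sum_subtractf
    by (simp add: sum_delta_mult scaleR_sum_right)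
  have "(\<Sum>i<m. r (star (\<Sum>j<m. one_minus t (gram xs) i j * u j) * (\<Sum>j<m. one_minus t (gram xs) i j * u j))) =
    (\<Sum>i<m. r (star (u i) * u i) - 2 * (1 / t) * r (star (u i) * ap u i) + (1 / t)\<^sup>2 * r (star (ap u i) * ap u i))"
    by (intro sum.cong refl) (simp only: ap_eq lessThan_iff square_diff u apu)
  also have "\<dots> = q u - 2 * (1 / t) * B u u + (1 / t)\<^sup>2 * q (ap u)"
    unfolding sum.distrib sum_subtractf sum_distrib_left[symmetric] q_def B_def ..
  also have "\<dots> = q u - (1 / t) * (2 * B u u - q (ap u) / t)"
    by (simp add: power2_eq_square right_diff_distrib)
  also have "\<dots> \<le> q u"
  proof -
    have "q (ap u) / t \<ge> 0" using q_nonneg[OF apu] t by simp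
    then have "(1 / t) * (2 * B u u - q (ap u) / t) \<ge> 0"
      using key t by (intro mult_nonneg_nonneg) auto
    then show ?thesis by simp
  qed
  finally show ?thesis by (simp add: q_def)
qed

text \<open>Column \<open>j\<close> of the \<open>k\<close>-th power is the unit column, of squared
  seminorm \<open>r 1 \<le> 1\<close>, after \<open>k\<close> contractions; one entry never exceeds
  the whole column.\<close>

lemma local_power_bound:
  assumes xs: "\<And>x i. x \<in> set xs \<Longrightarrow> i < m \<Longrightarrow> x i \<in> L n"
    and t: "t > 0" "(\<Sum>i<m. \<Sum>j<m. norm (gram xs i j)) \<le> t"
    and ij: "i < m" "j < m"
  shows "norm (mat_pow m (one_minus t (gram xs)) k i j) \<le> 1"
proof -
  let ?P = "\<lambda>k i. mat_pow m (one_minus t (gram xs)) k i j"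
  have D_L: "one_minus t (gram xs) i j \<in> L n" if "i < m" "j < m" for i j
    unfolding one_minus_def gram_def using that xs
    by (intro L_diff L_scaleR L_sum_list L_mult L_star) (auto simp: L_closed)
  have P_L: "?P k i \<in> L n" if "i < m" for k i
    using that by (induction k arbitrary: i) (auto simp: L_closed D_L intro!: L_sum L_mult)
  have "(norm (?P k i))\<^sup>2 \<le> 1"
  proof (rule norm_square_le_vstate[OF P_L[OF ij(1)]])
    fix r assume r: "vstate n r"
    have sum_le: "(\<Sum>i<m. r (star (?P k i) * ?P k i)) \<le> 1" for k
    proof (induction k)
      case 0
      have "(\<Sum>i<m. r (star (?P 0 i) * ?P 0 i)) = (\<Sum>i<m. if i = j then r 1 else 0)"
        by (intro sum.cong) (auto simp: vstate_zero[OF r])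
      then show ?case using ij vstate_one[OF r] by simp
    next
      case (Suc k)
      have "(\<Sum>i<m. r (star (?P (Suc k) i) * ?P (Suc k) i)) \<le> (\<Sum>i<m. r (star (?P k i) * ?P k i))"
        unfolding mat_pow.simps by (rule local_contraction[OF r _ t]) (use xs P_L in auto)
      then show ?case using Suc by simp
    qed
    have "r (star (?P k i) * ?P k i) \<le> (\<Sum>i<m. r (star (?P k i) * ?P k i))"
      using ij P_L by (intro member_le_sum vstate_nonneg[OF r]) auto
    then show "r (star (?P k i) * ?P k i) \<le> 1" using sum_le[of k] by linarith
  qed
  then show ?thesis by (simp add: abs_le_square_iff[of _ 1, simplified] power2_le_imp_le)
qed

text \<open>The scale \<open>t\<close> varies with the matrix; the summand 1 keeps it away from 0 in
  the limit.\<close>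

lemma tendsto_one_minus:
  fixes H :: "nat \<Rightarrow> nat \<Rightarrow> nat \<Rightarrow> 'u"
  assumes "\<And>i j. i < m \<Longrightarrow> j < m \<Longrightarrow> (\<lambda>l. H l i j) \<longlonglongrightarrow> H' i j" "i < m" "j < m"
  defines "t G \<equiv> 1 + (\<Sum>i<m. \<Sum>j<m. norm (G i j :: 'u))"
  shows "(\<lambda>l. one_minus (t (H l)) (H l) i j) \<longlonglongrightarrow> one_minus (t H') H' i j"
proof -
  have "t H' > 0" unfolding t_def by (intro add_pos_nonneg sum_nonneg) auto
  then show ?thesis
    unfolding one_minus_def t_def using assms(1-3)
    by (intro tendsto_intros) auto
qed

text \<open>Two passages to the limit: rows over the whole algebra are approximated by rows over the
  stages, and \<open>H\<close> is approximated by Gram matrices.\<close>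

lemma pos_mat_power_bound:
  fixes H :: "nat \<Rightarrow> nat \<Rightarrow> 'u"
  assumes pos: "pos_mat m H" and ij: "i < m" "j < m"
  shows "norm (mat_pow m (one_minus (1 + (\<Sum>i<m. \<Sum>j<m. norm (H i j))) H) k i j) \<le> 1"
proof -
  let ?t = "\<lambda>G. 1 + (\<Sum>i<m. \<Sum>j<m. norm (G i j))"
  have limit: "norm (mat_pow m (one_minus (?t H') H') k i j) \<le> 1"
    if "\<And>l. norm (mat_pow m (one_minus (?t (G l)) (G l)) k i j) \<le> 1"
      "\<And>i j. i < m \<Longrightarrow> j < m \<Longrightarrow> (\<lambda>l. G l i j) \<longlonglongrightarrow> H' i j"
    for G :: "nat \<Rightarrow> nat \<Rightarrow> nat \<Rightarrow> 'u" and H'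
    by (rule LIMSEQ_le_const2[OF tendsto_norm[OF tendsto_mat_pow[OF tendsto_one_minus[OF that(2)] ij]]])
      (use that(1) in auto)
  have "\<forall>x. \<exists>s. (\<forall>l. s l \<in> L l) \<and> s \<longlonglongrightarrow> x" using dense_sequence by blast
  then obtain s where s: "\<And>x l. s x l \<in> L l" "\<And>x. s x \<longlonglongrightarrow> x" by metis
  have gram: "norm (mat_pow m (one_minus (?t (gram xs)) (gram xs)) k i j) \<le> 1" for xs :: "(nat \<Rightarrow> 'u) list"
  proof (rule limit)
    define G where "G l = gram (map (\<lambda>x i. s (x i) l) xs)" for l
    show "norm (mat_pow m (one_minus (?t (G l)) (G l)) k i j) \<le> 1" for l
      unfolding G_def
      by (rule local_power_bound[where n = l]) (auto simp: s ij intro!: add_pos_nonneg sum_nonneg)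
    show "(\<lambda>l. G l i j) \<longlonglongrightarrow> gram xs i j" for i j
      unfolding G_def gram_def map_map comp_def by (intro tendsto_sum_list tendsto_intros s)
  qed
  obtain X where X: "\<forall>i<m. \<forall>j<m. (\<lambda>l. gram (X l) i j) \<longlonglongrightarrow> H i j"
    using pos unfolding pos_mat_def by blast
  define G where "G l = gram (X l)" for l
  show ?thesis
  proof (rule limit)
    show "norm (mat_pow m (one_minus (?t (G l)) (G l)) k i j) \<le> 1" for l
      unfolding G_def by (rule gram)
    show "(\<lambda>l. G l i j) \<longlonglongrightarrow> H i j" if "i < m" "j < m" for i j
      unfolding G_def using X that by blast
  qed
qed

text \<open>The rows approximating \<open>H\<close> may lie outside \<open>S\<close>; the square
  root series, built from the entries of \<open>H\<close> alone, supplies \<open>m\<close> rows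
  inside \<open>S\<close>.\<close>

lemma pos_mat_factor:
  fixes H :: "nat \<Rightarrow> nat \<Rightarrow> 'u"
  assumes pos: "pos_mat m H" and S: "cstar_subalgebra S" "1 \<in> S"
    and HS: "\<And>i j. i < m \<Longrightarrow> j < m \<Longrightarrow> H i j \<in> S"
  obtains R where "\<And>i j. i < m \<Longrightarrow> j < m \<Longrightarrow> R i j \<in> S"
    "\<And>i j. i < m \<Longrightarrow> j < m \<Longrightarrow> H i j = (\<Sum>k<m. star (R k i) * R k j)"
proof (rule sqrt_eq_gram[of "1 + (\<Sum>i<m. \<Sum>j<m. norm (H i j))" m H S])
  show "0 < 1 + (\<Sum>i<m. \<Sum>j<m. norm (H i j))" by (intro add_pos_nonneg sum_nonneg) auto
  show "c *\<^sub>R x \<in> S" if "x \<in> S" for c x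
    using that S unfolding cstar_subalgebra_def scaleR_eq_scaleC by blast
qed (use S pos_mat_power_bound[OF pos] pos_mat_star[OF pos] HS that in \<open>auto simp: cstar_subalgebra_def\<close>)

text \<open>Let \<open>M\<close> be the supremum of the norms over the unit ball. Kadison-Schwarz
  bounds the squared norm of \<open>kraus cs y\<close> by that of
  \<open>kraus cs (star y * y)\<close>, hence by \<open>M\<close>; so \<open>M \<le> sqrt M\<close>,
  which forces \<open>M \<le> 1\<close>.\<close>

lemma kraus_contractive:
  assumes one: "kraus cs 1 = (1 :: 'u)"
  shows "norm (kraus cs x) \<le> norm x"
proof -
  define M where "M = Sup ((\<lambda>y. norm (kraus cs y)) ` cball 0 1)"
  have bdd: "bdd_above ((\<lambda>y. norm (kraus cs y)) ` cball 0 1)"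
  proof (rule bdd_aboveI2)
    fix y :: 'u assume "y \<in> cball 0 1"
    then have "(\<Sum>c\<leftarrow>cs. (norm c)\<^sup>2) * norm y \<le> (\<Sum>c\<leftarrow>cs. (norm c)\<^sup>2)"
      by (intro mult_left_le sum_list_nonneg) auto
    then show "norm (kraus cs y) \<le> (\<Sum>c\<leftarrow>cs. (norm c)\<^sup>2)" using norm_kraus_le[of cs y] by linarith
  qed
  have le_M: "norm (kraus cs y) \<le> M" if "norm y \<le> 1" for y
    unfolding M_def using that by (intro cSUP_upper bdd) auto
  then have "M \<ge> 1" using one le_M[of 1] by simp
  have "norm (kraus cs y) \<le> sqrt M" if y: "norm y \<le> 1" for y
  proof -
    let ?z = "kraus cs y"
    have "star ?z * ?z + (\<Sum>w\<leftarrow>map (\<lambda>c. y * c - c * ?z) cs. star w * w) = kraus cs (star y * y)"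
      using kadison_schwarz_identity[of cs y ?z] by (simp add: comp_def one)
    then have "(norm ?z)\<^sup>2 \<le> norm (kraus cs (star y * y))"
      using norm_square_le_add_squares[of ?z] by metis
    also have "\<dots> \<le> M" using y by (intro le_M) (simp add: cstar_identity power_le_one)
    finally show ?thesis by (rule real_le_rsqrt)
  qed
  then have "M \<le> sqrt M" unfolding M_def by (intro cSUP_least) auto
  then have "M * M \<le> M" using \<open>M \<ge> 1\<close> mult_mono[of M "sqrt M" M "sqrt M"] by simp
  then have M1: "M \<le> 1" using \<open>M \<ge> 1\<close> by simp
  show ?thesis
  proof (cases "x = 0")
    case False
    have "norm (kraus cs ((1 / norm x) *\<^sub>R x)) \<le> M" using False by (intro le_M) simp
    then have "norm (kraus cs x) / norm x \<le> 1" using M1 by (simp add: kraus_scaleR)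
    then show ?thesis using False by (simp add: field_simps)
  qed simp
qed

end

section \<open>Slice maps\<close>

text \<open>Hiding the list lets maps built step by step be recognized by closure rules
  alone.\<close>

definition is_kraus :: "('a \<Rightarrow> 'a :: unital_cstar_algebra) \<Rightarrow> bool" where
  "is_kraus \<Phi> \<longleftrightarrow> (\<exists>cs. \<Phi> = kraus cs)"

lemma mult_interchange:
  "g * c = c * g \<Longrightarrow> (a * g) * (c * h) = (a * c) * (g * (h :: 'a :: semigroup_mult))"
  by (metis mult.assoc)

lemma mult_commute_mult:
  "e * x = x * e \<Longrightarrow> g * x = x * g \<Longrightarrow> (e * g) * x = x * (e * (g :: 'a :: semigroup_mult))"
  by (metis mult.assoc)

lemma is_kraus_conj: "is_kraus (\<lambda>x. star c * x * c)"
  unfolding is_kraus_def by (rule exI[of _ "[c]"]) (simp add: fun_eq_iff)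

lemma is_kraus_id: "is_kraus (\<lambda>x. x)"
  using is_kraus_conj[of 1] by simp

lemma is_kraus_comp:
  assumes "is_kraus \<Phi>" "is_kraus \<Psi>"
  shows "is_kraus (\<lambda>x. \<Phi> (\<Psi> x))"
proof -
  obtain cs ds where "\<Phi> = kraus cs" "\<Psi> = kraus ds" using assms by (auto simp: is_kraus_def)
  then show ?thesis unfolding is_kraus_def
    by (intro exI[of _ "concat (map (\<lambda>c. map (\<lambda>d. d * c) ds) cs)"]) (simp add: fun_eq_iff kraus_comp)
qed

lemma is_kraus_add:
  assumes "is_kraus \<Phi>" "is_kraus \<Psi>"
  shows "is_kraus (\<lambda>x. \<Phi> x + \<Psi> x)"
proof -
  obtain cs ds where "\<Phi> = kraus cs" "\<Psi> = kraus ds" using assms by (auto simp: is_kraus_def)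
  then show ?thesis unfolding is_kraus_def by (intro exI[of _ "cs @ ds"]) (simp add: fun_eq_iff)
qed

lemma is_kraus_sum: "(\<And>i. i \<in> I \<Longrightarrow> is_kraus (\<Phi> i)) \<Longrightarrow> is_kraus (\<lambda>x. \<Sum>i\<in>I. \<Phi> i x)"
proof (induction I rule: infinite_finite_induct)
  case (insert i I)
  then show ?case using is_kraus_add[of "\<Phi> i" "\<lambda>x. \<Sum>i\<in>I. \<Phi> i x"] by simp
qed (simp_all add: is_kraus_def exI[of _ "[]"] fun_eq_iff)

lemma is_kraus_scaleR:
  assumes "is_kraus \<Phi>" "a \<ge> 0"
  shows "is_kraus (\<lambda>x. a *\<^sub>R \<Phi> x)"
  \<comment> \<open>Scaling by \<open>a\<close> is compression by \<open>sqrt a\<close> times the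
    unit.\<close>
  using is_kraus_comp[OF is_kraus_conj[of "sqrt a *\<^sub>R 1"] assms(1)] assms(2)
  by (simp add: star_scaleR)

lemma is_kraus_bounded_linear: "is_kraus \<Phi> \<Longrightarrow> bounded_linear \<Phi>"
  unfolding is_kraus_def using bounded_linear_kraus by blast

lemma is_kraus_scaleC: "is_kraus \<Phi> \<Longrightarrow> \<Phi> (c *\<^sub>C x) = c *\<^sub>C \<Phi> x"
  unfolding is_kraus_def using kraus_scaleC by blast

lemma is_kraus_pos_mat: "is_kraus \<Phi> \<Longrightarrow> pos_mat m H \<Longrightarrow> pos_mat m (\<lambda>i j. \<Phi> (H i j))"
  unfolding is_kraus_def using pos_mat_kraus by blast

lemmas is_kraus_linear = bounded_linear.linear[OF is_kraus_bounded_linear]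
lemmas is_kraus_map_add = linear_add[OF is_kraus_linear]
lemmas is_kraus_map_diff = linear_diff[OF is_kraus_linear]

context UHF_3_infinity
begin

lemma is_kraus_contractive: "is_kraus \<Phi> \<Longrightarrow> \<Phi> 1 = 1 \<Longrightarrow> norm (\<Phi> x) \<le> norm (x :: 'u)"
  unfolding is_kraus_def using kraus_contractive by blast

section \<open>Slices along one tensor factor\<close>

text \<open>On \<open>L (Suc n)\<close> this is the coefficient of \<open>f n i j\<close>: the sum
  over \<open>p\<close> spreads that entry along the diagonal of factor \<open>n\<close>. The
  formula makes sense on the whole algebra and has Kraus form for \<open>i = j\<close>.\<close>

definition slice :: "nat \<Rightarrow> nat \<Rightarrow> nat \<Rightarrow> 'u \<Rightarrow> 'u" where
  "slice n i j x = (\<Sum>p<3. f n p i * x * f n j p)"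

lemma f_sum_one': "(\<Sum>p<3. f n p p) = 1"
  using f_sum_one[of n] by (simp add: sum_lessThan_3)

lemma slice_mult_left: "x \<in> L n \<Longrightarrow> slice n i j (x * w) = x * slice n i j w"
  by (simp add: slice_def sum_distrib_left f_commute flip: mult.assoc)

lemma slice_f:
  assumes "i < 3" "j < 3" "k < 3" "l < 3"
  shows "slice n i j (f n k l) = (if i = k \<and> j = l then 1 else 0)"
proof -
  have "slice n i j (f n k l) = (\<Sum>p<3. if i = k \<and> j = l then f n p p else 0)"
    unfolding slice_def using assms by (intro sum.cong) (auto simp: f_mult)
  then show ?thesis by (cases "i = k \<and> j = l") (auto simp: f_sum_one')
qed

lemma slice_one: "i < 3 \<Longrightarrow> slice n i i 1 = 1"
  by (simp add: slice_def f_mult f_sum_one')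

lemma bounded_linear_slice: "bounded_linear (slice n i j)"
  unfolding slice_def
  by (intro bounded_linear_sum bounded_linear_compose[OF bounded_linear_mult_left]
      bounded_linear_mult_right)

lemmas slice_add = linear_add[OF bounded_linear.linear[OF bounded_linear_slice]]
  and slice_sum = linear_sum[OF bounded_linear.linear[OF bounded_linear_slice]]

lemma is_kraus_slice: "is_kraus (slice n i i)"
  unfolding slice_def
  by (intro is_kraus_sum) (use is_kraus_conj[of "f n i _"] in simp)

lemma slice_decomp:
  assumes "\<And>k l. y k l \<in> L n" "i < 3" "j < 3"
  shows "slice n i j (\<Sum>k<3. \<Sum>l<3. y k l * f n k l) = y i j"
proof -
  have "slice n i j (\<Sum>k<3. \<Sum>l<3. y k l * f n k l) =
      (\<Sum>k<3. \<Sum>l<3. if i = k then if j = l then y k l else 0 else 0)"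
    unfolding slice_sum using assms
    by (intro sum.cong) (auto simp: slice_mult_left slice_f)
  also have "\<dots> = (\<Sum>k<3. if i = k then y k j else 0)"
    using assms by (intro sum.cong) auto
  also have "\<dots> = y i j" using assms by simp
  finally show ?thesis .
qed

lemma slice_L:
  assumes "x \<in> L (Suc n)" "i < 3" "j < 3"
  shows "slice n i j x \<in> L n"
proof -
  obtain y where "\<And>i j. y i j \<in> L n" "x = (\<Sum>i<3. \<Sum>j<3. y i j * f n i j)"
    by (rule L_Suc_decomp[OF assms(1)]) (rule that)
  then show ?thesis using assms by (simp add: slice_decomp)
qed

lemma slice_sum_f:
  assumes "x \<in> L (Suc n)"
  shows "(\<Sum>i<3. \<Sum>j<3. slice n i j x * f n i j) = x"
proof -
  obtain y where "\<And>i j. y i j \<in> L n" "x = (\<Sum>i<3. \<Sum>j<3. y i j * f n i j)"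
    by (rule L_Suc_decomp[OF assms(1)]) (rule that)
  then show ?thesis by (simp add: slice_decomp)
qed

text \<open>Induction on \<open>n\<close>: slices are bounded, so the slices of a limit lie in the
  closed set \<open>L n\<close>, and they reassemble to the limit. Stage 0 is an isometric copy of
  the complete complex plane.\<close>

lemma closed_L: "closed (L n)"
proof (induction n)
  case 0
  show ?case
    unfolding closed_sequential_limits
  proof (intro allI impI, elim conjE)
    fix s :: "nat \<Rightarrow> 'u" and x assume s: "\<forall>l. s l \<in> L 0" "s \<longlonglongrightarrow> x"
    then have "\<forall>l. \<exists>c. s l = c *\<^sub>C 1" using L_0 by blast
    from choice[OF this] obtain c where c: "\<And>l. s l = c l *\<^sub>C 1" by blast
    have "norm (s k - s l) = cmod (c k - c l)" for k l
      by (simp add: c norm_scaleC flip: cspace.scale_left_diff_distrib)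
    then have "Cauchy c" using LIMSEQ_imp_Cauchy[OF s(2)] by (simp add: Cauchy_def dist_norm)
    from Cauchy_convergent[OF this] obtain a where "c \<longlonglongrightarrow> a" by (auto simp: convergent_def)
    moreover have "norm (s l - a *\<^sub>C 1) = norm (c l - a)" for l
      by (simp add: c norm_scaleC flip: cspace.scale_left_diff_distrib)
    ultimately have "s \<longlonglongrightarrow> a *\<^sub>C 1"
      by (simp add: tendsto_iff dist_norm)
    then have "x = a *\<^sub>C 1" by (rule LIMSEQ_unique[OF s(2)])
    then show "x \<in> L 0" by (simp add: L_closed)
  qed
next
  case (Suc n)
  show ?case
    unfolding closed_sequential_limits
  proof (intro allI impI, elim conjE)
    fix s :: "nat \<Rightarrow> 'u" and x assume s: "\<forall>l. s l \<in> L (Suc n)" "s \<longlonglongrightarrow> x"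
    have lim: "(\<lambda>l. slice n i j (s l)) \<longlonglongrightarrow> slice n i j x" for i j
      using s(2) by (rule bounded_linear.tendsto[OF bounded_linear_slice])
    have in_L: "slice n i j x \<in> L n" if "i < 3" "j < 3" for i j
      by (rule closed_sequentially[OF Suc _ lim]) (use slice_L s that in auto)
    have "(\<lambda>l. \<Sum>i<3. \<Sum>j<3. slice n i j (s l) * f n i j) \<longlonglongrightarrow> (\<Sum>i<3. \<Sum>j<3. slice n i j x * f n i j)"
      by (intro tendsto_intros lim)
    then have "s \<longlonglongrightarrow> (\<Sum>i<3. \<Sum>j<3. slice n i j x * f n i j)"
      using s(1) by (simp add: slice_sum_f)
    then have "x = (\<Sum>i<3. \<Sum>j<3. slice n i j x * f n i j)"
      by (rule LIMSEQ_unique[OF s(2)])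
    also have "\<dots> \<in> L (Suc n)" by (intro L_sum L_mult L_Suc in_L f_L) auto
    finally show "x \<in> L (Suc n)" .
  qed
qed

text \<open>The normalized partial trace over the \<open>n\<close>-th factor.\<close>

definition T :: "nat \<Rightarrow> 'u \<Rightarrow> 'u" where
  "T n x = (1 / 3) *\<^sub>R (\<Sum>i<3. slice n i i x)"

lemma is_kraus_T: "is_kraus (T n)"
  unfolding T_def by (intro is_kraus_scaleR is_kraus_sum is_kraus_slice) auto

lemma T_mult_left: "x \<in> L n \<Longrightarrow> T n (x * w) = x * T n w"
  by (simp add: T_def slice_mult_left sum_distrib_left)

lemma T_one: "T n 1 = 1"
proof -
  have "(\<Sum>i<3. slice n i i 1) = 3 *\<^sub>R 1"
    using scaleR_left_distrib[of 1 2 "1 :: 'u"] scaleR_left_distrib[of 1 1 "1 :: 'u"]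
    by (simp add: slice_one sum_lessThan_3)
  then show ?thesis by (simp only: T_def) simp
qed

lemma T_L_id: "x \<in> L n \<Longrightarrow> T n x = x"
  using T_mult_left[of x n 1] by (simp add: T_one)

lemma T_L: "x \<in> L (Suc n) \<Longrightarrow> T n x \<in> L n"
  unfolding T_def by (intro L_scaleR L_sum slice_L) auto

section \<open>The projections that split two adjacent factors\<close>

definition q :: "nat \<Rightarrow> 'u" where
  "q n = f n 1 1"

text \<open>The matrix \<open>\<beta>\<^sup>1\<close> with index \<open>p + 1\<close>, placed in the factors \<open>n\<close> and \<open>n + 1\<close>.\<close>

definition b :: "nat \<Rightarrow> nat \<Rightarrow> 'u" where
  "b n p = f n p p * f (Suc n) 0 0 + f n ((p + 2) mod 3) ((p + 2) mod 3) * f (Suc n) 2 2"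

lemma q_L: "q n \<in> L (Suc n)"
  by (simp add: q_def)

lemma star_q [simp]: "star (q n) = q n"
  by (simp add: q_def)

lemma q_mult_q [simp]: "q n * q n = q n"
  by (simp add: q_def f_mult)

lemma q_commute: "x \<in> L n \<Longrightarrow> q n * x = x * q n"
  by (simp add: q_def f_commute)

lemma T_q: "T n (q n) = (1 / 3) *\<^sub>R 1"
  by (simp add: T_def q_def sum_lessThan_3 slice_f)

lemma f_f_commute: "f (Suc n) i j * f n k l = f n k l * f (Suc n) i j"
  by (rule f_commute) simp

lemma f_f_mult:
  "f n i j * f (Suc n) i' j' * (f n k l * f (Suc n) k' l') = (f n i j * f n k l) * (f (Suc n) i' j' * f (Suc n) k' l')"
  by (rule mult_interchange) (rule f_f_commute)

lemma b_L: "b n p \<in> L (Suc (Suc n))"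
  unfolding b_def by (intro L_add L_mult) (auto intro: L_Suc)

lemma star_b [simp]: "star (b n p) = b n p"
  by (simp add: b_def star_add star_mult f_f_commute)

lemma b_commute: "x \<in> L n \<Longrightarrow> b n p * x = x * b n p"
  unfolding b_def distrib_left distrib_right
  by (intro arg_cong2[where f = "(+)"] mult_commute_mult f_commute L_Suc)

lemma less_3_cases: "p < (3 :: nat) \<Longrightarrow> p = 0 \<or> p = 1 \<or> p = 2"
  by linarith

lemma b_mult_b: "p < 3 \<Longrightarrow> r < 3 \<Longrightarrow> b n p * b n r = (if p = r then b n p else 0)"
  unfolding b_def by (auto simp: distrib_left distrib_right f_f_mult f_mult dest!: less_3_cases)

lemma q_mult_b: "p < 3 \<Longrightarrow> q (Suc n) * b n p = 0"
proof -
  have "f (Suc n) 1 1 * (f n i i * f (Suc n) k k) = f n i i * (f (Suc n) 1 1 * f (Suc n) k k)" for i k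
    by (simp add: f_f_commute flip: mult.assoc)
  then show ?thesis by (simp add: q_def b_def distrib_left f_mult)
qed

lemma b_mult_q: "p < 3 \<Longrightarrow> b n p * q (Suc n) = 0"
  using arg_cong[OF q_mult_b, of p star n] by (simp add: star_mult)

text \<open>Together with the product rules: a partition of unity into orthogonal projections. The
  \<open>b n p\<close> use the positions 0 and 2 of factor \<open>n + 1\<close>, and
  \<open>p + 2\<close> runs through all positions of factor \<open>n\<close> as \<open>p\<close>
  does.\<close>

lemma q_sum_b: "q (Suc n) + (\<Sum>p<3. b n p) = 1"
proof -
  have "(\<Sum>p<3. b n p) = (f n 0 0 + f n 1 1 + f n 2 2) * f (Suc n) 0 0 + (f n 0 0 + f n 1 1 + f n 2 2) * f (Suc n) 2 2"
    by (simp add: sum_lessThan_3 b_def algebra_simps numeral_2_eq_2)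
  then show ?thesis using f_sum_one[of "Suc n"] f_sum_one[of n] by (simp add: q_def add_ac)
qed

lemma one_minus_q: "1 - q (Suc n) = (\<Sum>p<3. b n p)"
  using q_sum_b[of n] by (simp add: algebra_simps)

end

section \<open>The algebras \<open>\<A>\<^sub>n\<close>\<close>

lemma kron_one_left: "1\<^sub>m (Suc 0) \<otimes>\<^sub>K A = A"
  by (rule eq_matI) auto

lemma kron_power_carrier: "A \<in> carrier_mat 3 3 \<Longrightarrow> kron_power A n \<in> M3 n"
  by (induction n) auto

lemma mat_unit_carrier: "mat_unit i j \<in> carrier_mat 3 3"
  by (simp add: mat_unit_eq_matE)

lemma mat_unit_2_2: "mat_unit 2 2 = matE 1 1"
  by (simp add: mat_unit_eq_matE)

lemma \<alpha>_0: "\<alpha> 0 j = matE ((j + 2) mod 3) ((j + 2) mod 3)"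
  by (simp add: \<alpha>_def kron_one_right mat_unit_eq_matE)

lemma \<alpha>_Suc: "\<alpha> (Suc n) j = \<alpha> n j \<otimes>\<^sub>K matE 1 1"
  by (simp add: \<alpha>_def kron_assoc mat_unit_2_2)

lemma \<beta>_1: "\<beta> (Suc 0) j = matE ((j + 2) mod 3) ((j + 2) mod 3) \<otimes>\<^sub>K matE 0 0
    + matE ((j + 4) mod 3) ((j + 4) mod 3) \<otimes>\<^sub>K matE 2 2"
  by (simp add: \<beta>_def kron_one_right mat_unit_eq_matE add.commute[of j])

lemma \<beta>_Suc: "k \<ge> 1 \<Longrightarrow> \<beta> (Suc k) j = \<beta> k j \<otimes>\<^sub>K matE 1 1"
  by (cases k) (simp_all add: \<beta>_def kron_assoc mat_unit_2_2)

lemma \<alpha>_M3: "\<alpha> n j \<in> M3 (Suc n)"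
  using kron_carrier[OF mat_unit_carrier kron_power_carrier[OF mat_unit_carrier]]
  by (simp add: \<alpha>_def power_Suc mult.commute)

lemma kron_M3_M3: "A \<in> M3 m \<Longrightarrow> B \<in> M3 n \<Longrightarrow> A \<otimes>\<^sub>K B \<in> M3 (m + n)"
  by (simp add: power_add)

lemma \<beta>_M3: "k \<ge> 1 \<Longrightarrow> \<beta> k j \<in> M3 (Suc k)"
proof (induction k rule: dec_induct)
  case base
  have "matE i i \<otimes>\<^sub>K matE l l \<in> carrier_mat 9 9" for i l
    using kron_carrier[OF matE_carrier matE_carrier] by simp
  then show ?case by (simp add: \<beta>_1 power_Suc)
next
  case (step k)
  have "matE 1 1 \<in> M3 1" by simp
  from kron_M3_M3[OF step.IH this] show ?case
    unfolding \<beta>_Suc[OF step(1)] by (simp only: One_nat_def add_Suc_right add_0_right)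
qed

lemma cspan_induct:
  assumes "x \<in> cspan S" "P 0" "\<And>x y. P x \<Longrightarrow> P y \<Longrightarrow> P (x + y)" "\<And>c x. P x \<Longrightarrow> P (c *\<^sub>C x)"
    "\<And>x. x \<in> S \<Longrightarrow> P x"
  shows "P x"
  by (rule cspace.span_induct_alt[OF assms(1)]) (use assms in auto)

context UHF_3_infinity
begin

lemma A_fin_add: "x \<in> A_fin emb n \<Longrightarrow> y \<in> A_fin emb n \<Longrightarrow> x + y \<in> A_fin emb n"
  unfolding A_fin_def by (rule cspace.span_add)

lemma A_fin_scaleC: "x \<in> A_fin emb n \<Longrightarrow> c *\<^sub>C x \<in> A_fin emb n"
  unfolding A_fin_def by (rule cspace.span_scale)

lemma A_fin_zero: "0 \<in> A_fin emb n"
  unfolding A_fin_def by (rule cspace.span_zero)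

lemma A_fin_sum: "(\<And>i. i \<in> I \<Longrightarrow> g i \<in> A_fin emb n) \<Longrightarrow> (\<Sum>i\<in>I. g i) \<in> A_fin emb n"
  unfolding A_fin_def by (rule cspace.span_sum)

lemma emb_kron_\<beta>_1:
  assumes "A \<in> M3 n" "(j + 2) mod 3 = p"
  shows "emb (Suc (Suc n)) (A \<otimes>\<^sub>K \<beta> (Suc 0) j) = emb n A * b n p"
proof -
  \<comment> \<open>The second index \<open>j + 2\<close> of \<open>\<beta>\<close> stands at
    position \<open>(j + 4) mod 3\<close>, which is \<open>p + 2\<close> modulo 3.\<close>
  have p': "(j + 4) mod 3 = (p + 2) mod 3" using assms(2) by presburger
  have A: "A \<otimes>\<^sub>K matE i i \<in> M3 (Suc n)" for i using assms by simp
  have c: "matE i i \<otimes>\<^sub>K matE l l \<in> carrier_mat (3 * 3) (3 * 3)" for i l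
    by (rule kron_carrier) auto
  have "A \<otimes>\<^sub>K \<beta> (Suc 0) j =
      (A \<otimes>\<^sub>K matE p p) \<otimes>\<^sub>K matE 0 0 + (A \<otimes>\<^sub>K matE ((p + 2) mod 3) ((p + 2) mod 3)) \<otimes>\<^sub>K matE 2 2"
    unfolding \<beta>_1 assms(2) p' kron_assoc by (rule kron_add_right[OF c c])
  then show ?thesis
    using assms(1) A emb_add[OF kron_M3[OF A matE_carrier] kron_M3[OF A matE_carrier]]
    by (simp add: emb_kron_matE b_def distrib_left mult.assoc)
qed

text \<open>For \<open>k = 1\<close> the generator is new and has the form \<open>y * b n p\<close>;
  for larger \<open>k\<close> it is a generator for \<open>k - 1\<close> tensored with the middle
  matrix unit, that is, multiplied by \<open>q (Suc n)\<close>.\<close>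

lemma A_fin_generator_Suc:
  assumes "x \<in> M3 (Suc n - k)" "k \<in> {1..Suc n}" "j \<in> {1..3}"
  shows "(\<exists>a\<in>A_fin emb n. emb (Suc (Suc n)) (x \<otimes>\<^sub>K \<beta> k j) = a * q (Suc n)) \<or>
    (\<exists>y\<in>L n. \<exists>p<3. emb (Suc (Suc n)) (x \<otimes>\<^sub>K \<beta> k j) = y * b n p)"
proof (cases "k = 1")
  case True
  have "emb (Suc (Suc n)) (x \<otimes>\<^sub>K \<beta> (Suc 0) j) = emb n x * b n ((j + 2) mod 3)"
    by (rule emb_kron_\<beta>_1) (use assms True in auto)
  then show ?thesis using assms True by (intro disjI2 bexI[of _ "emb n x"] exI[of _ "(j + 2) mod 3"]) (auto intro: L_I)
next
  case False
  then obtain k' where k': "k = Suc k'" "k' \<ge> 1" "k' \<le> n" using assms by (cases k) auto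
  have x: "x \<in> M3 (n - k')" using assms k' by simp
  have "x \<otimes>\<^sub>K \<beta> k' j \<in> M3 (n - k' + Suc k')" by (intro kron_M3_M3 x \<beta>_M3 k')
  then have M: "x \<otimes>\<^sub>K \<beta> k' j \<in> M3 (Suc n)" using k' by simp
  have "x \<otimes>\<^sub>K \<beta> k j = (x \<otimes>\<^sub>K \<beta> k' j) \<otimes>\<^sub>K matE 1 1"
    by (simp add: k'(1) \<beta>_Suc[OF k'(2)] kron_assoc)
  then have "emb (Suc (Suc n)) (x \<otimes>\<^sub>K \<beta> k j) = emb (Suc n) (x \<otimes>\<^sub>K \<beta> k' j) * q (Suc n)"
    using M by (simp add: emb_kron_matE q_def)
  moreover have "emb (Suc n) (x \<otimes>\<^sub>K \<beta> k' j) \<in> A_fin emb n"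
    unfolding A_fin_def Suc_eq_plus1
    by (intro cspace.span_base imageI UnI2 CollectI exI conjI refl) (use x k' assms in auto)
  ultimately show ?thesis by blast
qed

lemma emb_\<alpha>_Suc: "emb (Suc (Suc n)) (\<alpha> (Suc n) j) = emb (Suc n) (\<alpha> n j) * q (Suc n)"
  using \<alpha>_M3[of n j] by (simp add: \<alpha>_Suc emb_kron_matE q_def)

lemma emb_\<alpha>_A_fin: "j \<in> {1..3} \<Longrightarrow> emb (Suc n) (\<alpha> n j) \<in> A_fin emb n"
  unfolding A_fin_def Suc_eq_plus1
  by (intro cspace.span_base imageI UnI1) auto

lemma A_fin_q:
  assumes "a \<in> A_fin emb n"
  shows "a * q (Suc n) \<in> A_fin emb (Suc n)"
  using assms unfolding A_fin_def[of emb n]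
proof (rule cspan_induct)
  fix x assume "x \<in> emb (n + 1) ` ({\<alpha> n j |j. j \<in> {1..3}} \<union>
      {x \<otimes>\<^sub>K \<beta> k j |x k j. j \<in> {1..3} \<and> k \<in> {1..n} \<and> x \<in> M3 (n - k)})"
  then consider j where "x = emb (Suc n) (\<alpha> n j)" "j \<in> {1..3}"
    | y k j where "x = emb (Suc n) (y \<otimes>\<^sub>K \<beta> k j)" "j \<in> {1..3}" "k \<in> {1..n}" "y \<in> M3 (n - k)"
    by auto
  then show "x * q (Suc n) \<in> A_fin emb (Suc n)"
  proof cases
    case 1
    then show ?thesis by (simp add: emb_\<alpha>_A_fin flip: emb_\<alpha>_Suc)
  next
    case 2
    have "y \<otimes>\<^sub>K \<beta> k j \<in> M3 (n - k + Suc k)" by (intro kron_M3_M3 \<beta>_M3) (use 2 in auto)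
    then have M: "y \<otimes>\<^sub>K \<beta> k j \<in> M3 (Suc n)" using 2 by simp
    have "x * q (Suc n) = emb (Suc (Suc n)) ((y \<otimes>\<^sub>K \<beta> k j) \<otimes>\<^sub>K matE 1 1)"
      using M 2 by (simp add: emb_kron_matE q_def)
    also have "(y \<otimes>\<^sub>K \<beta> k j) \<otimes>\<^sub>K matE 1 1 = y \<otimes>\<^sub>K \<beta> (Suc k) j"
      using 2 by (simp add: \<beta>_Suc kron_assoc)
    also have "emb (Suc (Suc n)) (y \<otimes>\<^sub>K \<beta> (Suc k) j) \<in> A_fin emb (Suc n)"
      unfolding A_fin_def Suc_eq_plus1
      by (intro cspace.span_base imageI UnI2 CollectI exI conjI refl) (use 2 in auto)
    finally show ?thesis .
  qed
qed (simp_all add: A_fin_zero A_fin_add A_fin_scaleC distrib_right mult_scaleC_left)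

lemma A_fin_b:
  assumes "y \<in> L n" "p < 3"
  shows "y * b n p \<in> A_fin emb (Suc n)"
proof -
  obtain A where A: "A \<in> M3 n" "y = emb n A" using assms by (auto simp: L_def)
  \<comment> \<open>Position \<open>p\<close>, counted from 0, carries the index
    \<open>Suc p\<close> in \<open>{1..3}\<close>.\<close>
  have "(Suc p + 2) mod 3 = p" using assms by presburger
  then have "y * b n p = emb (Suc (Suc n)) (A \<otimes>\<^sub>K \<beta> (Suc 0) (Suc p))"
    using A emb_kron_\<beta>_1[of A n "Suc p" p] by simp
  also have "\<dots> \<in> A_fin emb (Suc n)"
    unfolding A_fin_def Suc_eq_plus1
    by (intro cspace.span_base imageI UnI2 CollectI exI conjI refl) (use A assms in auto)
  finally show ?thesis .
qed

text \<open>With the elimination rule \<open>A_fin_Suc_E\<close> this is the recursive description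
  of the algebras on which the inductions on \<open>n\<close> rest.\<close>

lemma A_fin_Suc_I:
  "a \<in> A_fin emb n \<Longrightarrow> (\<And>p. p < 3 \<Longrightarrow> y p \<in> L n) \<Longrightarrow>
    a * q (Suc n) + (\<Sum>p<3. y p * b n p) \<in> A_fin emb (Suc n)"
  by (intro A_fin_add A_fin_sum A_fin_q A_fin_b) auto

lemma A_fin_Suc_E:
  assumes "x \<in> A_fin emb (Suc n)"
  obtains a y where "a \<in> A_fin emb n" "\<And>p. y p \<in> L n" "x = a * q (Suc n) + (\<Sum>p<3. y p * b n p)"
proof -
  let ?P = "\<lambda>x. \<exists>a y. a \<in> A_fin emb n \<and> (\<forall>p. y p \<in> L n) \<and> x = a * q (Suc n) + (\<Sum>p<3. y p * b n p)"
  have P_q: "?P (a * q (Suc n))" if "a \<in> A_fin emb n" for a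
    by (rule exI[of _ a], rule exI[of _ "\<lambda>_. 0"]) (use that in \<open>auto simp: L_closed\<close>)
  have P_b: "?P (y * b n p)" if "y \<in> L n" "p < 3" for y p
  proof (rule exI[of _ 0], rule exI[of _ "\<lambda>r. if r = p then y else 0"], intro conjI)
    have "(\<Sum>r<3. (if r = p then y else 0) * b n r) = (\<Sum>r<3. if r = p then y * b n r else 0)"
      by (intro sum.cong) auto
    then show "y * b n p = 0 * q (Suc n) + (\<Sum>r<3. (if r = p then y else 0) * b n r)"
      using that by simp
  qed (use that in \<open>auto simp: A_fin_zero L_zero\<close>)
  have "?P x"
    using assms unfolding A_fin_def[of emb "Suc n"]
  proof (rule cspan_induct)
    show "?P 0" using P_q[OF A_fin_zero] by simp
    fix x assume "x \<in> emb (Suc n + 1) ` ({\<alpha> (Suc n) j |j. j \<in> {1..3}} \<union>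
      {x \<otimes>\<^sub>K \<beta> k j |x k j. j \<in> {1..3} \<and> k \<in> {1..Suc n} \<and> x \<in> M3 (Suc n - k)})"
    then consider j where "x = emb (Suc (Suc n)) (\<alpha> (Suc n) j)" "j \<in> {1..3}"
      | y k j where "x = emb (Suc (Suc n)) (y \<otimes>\<^sub>K \<beta> k j)" "j \<in> {1..3}" "k \<in> {1..Suc n}" "y \<in> M3 (Suc n - k)"
      by auto
    then show "?P x"
    proof cases
      case 1
      show ?thesis unfolding 1 emb_\<alpha>_Suc by (rule P_q[OF emb_\<alpha>_A_fin[OF 1(2)]])
    next
      case 2
      show ?thesis using A_fin_generator_Suc[OF 2(4,3,2)] unfolding 2(1)[symmetric]
      proof (elim disjE bexE exE conjE)
        fix a assume "a \<in> A_fin emb n" "x = a * q (Suc n)"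
        then show ?thesis using P_q by simp
      next
        fix y p assume "y \<in> L n" "p < 3" "x = y * b n p"
        then show ?thesis using P_b by simp
      qed
    qed
  next
    fix x x' assume "?P x" "?P x'"
    then obtain a y a' y' where *: "a \<in> A_fin emb n" "\<forall>p. y p \<in> L n" "x = a * q (Suc n) + (\<Sum>p<3. y p * b n p)"
      "a' \<in> A_fin emb n" "\<forall>p. y' p \<in> L n" "x' = a' * q (Suc n) + (\<Sum>p<3. y' p * b n p)" by (elim exE conjE)
    show "?P (x + x')"
      by (rule exI[of _ "a + a'"], rule exI[of _ "\<lambda>p. y p + y' p"])
        (use * in \<open>auto simp: A_fin_add L_add distrib_right sum.distrib\<close>)
  next
    fix c x assume "?P x"
    then obtain a y where *: "a \<in> A_fin emb n" "\<forall>p. y p \<in> L n" "x = a * q (Suc n) + (\<Sum>p<3. y p * b n p)"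
      by (elim exE conjE)
    show "?P (c *\<^sub>C x)"
      by (rule exI[of _ "c *\<^sub>C a"], rule exI[of _ "\<lambda>p. c *\<^sub>C y p"])
        (use * in \<open>auto simp: A_fin_scaleC L_scaleC scaleC_add_right scaleC_sum_right mult_scaleC_left\<close>)
  qed
  then show thesis using that by blast
qed

lemma f_0_eq: "f 0 p p = emb 1 (matE p p)"
  by (simp add: f_def kron_one_left)

text \<open>The range of \<open>k\<close> is empty for \<open>n = 0\<close>, so the first algebra is
  the diagonal of factor 0.\<close>

lemma A_fin_0_I: "(\<Sum>p<3. c p *\<^sub>C f 0 p p) \<in> A_fin emb 0"
proof (intro A_fin_sum A_fin_scaleC)
  fix p :: nat assume "p \<in> {..<3}"
  then have "(Suc p + 2) mod 3 = p" unfolding lessThan_iff by presburger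
  then have "f 0 p p = emb (Suc 0) (\<alpha> 0 (Suc p))" by (simp add: f_0_eq \<alpha>_0)
  then show "f 0 p p \<in> A_fin emb 0" using emb_\<alpha>_A_fin[of "Suc p" 0] \<open>p \<in> {..<3}\<close> by simp
qed

lemma A_fin_0_E:
  assumes "x \<in> A_fin emb 0"
  obtains c where "x = (\<Sum>p<3. c p *\<^sub>C f 0 p p)"
proof -
  let ?P = "\<lambda>x. \<exists>c. x = (\<Sum>p<3. c p *\<^sub>C f 0 p p)"
  have "?P x"
    using assms unfolding A_fin_def
  proof (rule cspan_induct)
    show "?P 0" by (rule exI[of _ "\<lambda>_. 0"]) simp
  next
    fix x y assume "?P x" "?P y"
    then obtain c d where "x = (\<Sum>p<3. c p *\<^sub>C f 0 p p)" "y = (\<Sum>p<3. d p *\<^sub>C f 0 p p)" by (elim exE)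
    then show "?P (x + y)"
      by (intro exI[of _ "\<lambda>p. c p + d p"]) (simp add: scaleC_add_left sum.distrib)
  next
    fix a x assume "?P x"
    then obtain c where "x = (\<Sum>p<3. c p *\<^sub>C f 0 p p)" by (elim exE)
    then show "?P (a *\<^sub>C x)"
      by (intro exI[of _ "\<lambda>p. a * c p"]) (simp add: scaleC_sum_right)
  next
    fix x assume "x \<in> emb (0 + 1) ` ({\<alpha> 0 j |j. j \<in> {1..3}} \<union>
      {x \<otimes>\<^sub>K \<beta> k j |x k j. j \<in> {1..3} \<and> k \<in> {1..0} \<and> x \<in> M3 (0 - k)})"
    then obtain j where x: "x = emb 1 (\<alpha> 0 j)" by auto
    let ?r = "(j + 2) mod 3"
    have "(\<Sum>p<3. (if p = ?r then 1 else 0) *\<^sub>C f 0 p p) = (\<Sum>p<3. if p = ?r then f 0 p p else 0)"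
      by (intro sum.cong) auto
    then have "x = (\<Sum>p<3. (if p = ?r then 1 else 0) *\<^sub>C f 0 p p)"
      unfolding x \<alpha>_0 by (simp add: f_0_eq)
    then show "?P x" by (rule exI[of _ "\<lambda>p. if p = ?r then 1 else 0"])
  qed
  then show thesis using that by blast
qed

lemma A_fin_L: "x \<in> A_fin emb n \<Longrightarrow> x \<in> L (Suc n)"
proof (induction n arbitrary: x)
  case 0
  then obtain c where "x = (\<Sum>p<3. c p *\<^sub>C f 0 p p)" by (rule A_fin_0_E)
  then show ?case by (auto intro!: L_sum L_scaleC)
next
  case (Suc n)
  from Suc.prems obtain a y where *: "a \<in> A_fin emb n" "\<And>p. y p \<in> L n"
    "x = a * q (Suc n) + (\<Sum>p<3. y p * b n p)" by (rule A_fin_Suc_E) (rule that)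
  then show ?case
    using Suc.IH by (auto intro!: L_add L_mult L_sum b_L q_L intro: L_Suc)
qed

lemma A_fin_one: "1 \<in> A_fin emb n"
proof (induction n)
  case 0
  show ?case using A_fin_0_I[of "\<lambda>_. 1"] by (simp add: f_sum_one')
next
  case (Suc n)
  then show ?case using A_fin_Suc_I[of 1 n "\<lambda>_. 1"] by (simp add: L_one q_sum_b)
qed

lemma A_fin_star: "x \<in> A_fin emb n \<Longrightarrow> star x \<in> A_fin emb n"
proof (induction n arbitrary: x)
  case 0
  then obtain c where "x = (\<Sum>p<3. c p *\<^sub>C f 0 p p)" by (rule A_fin_0_E)
  then have "star x = (\<Sum>p<3. cnj (c p) *\<^sub>C f 0 p p)" by (simp add: star_sum star_scaleC)
  then show ?case using A_fin_0_I by simp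
next
  case (Suc n)
  from Suc.prems obtain a y where *: "a \<in> A_fin emb n" "\<And>p. y p \<in> L n"
    "x = a * q (Suc n) + (\<Sum>p<3. y p * b n p)" by (rule A_fin_Suc_E) (rule that)
  have "star x = star a * q (Suc n) + (\<Sum>p<3. star (y p) * b n p)"
    using * by (simp add: star_add star_sum star_mult q_commute[OF L_star[OF A_fin_L]] b_commute[OF L_star])
  then show ?case using * Suc.IH by (auto intro!: A_fin_Suc_I L_star)
qed

text \<open>\<open>q (Suc n)\<close> commutes with the component in \<open>A_fin emb n\<close>, each
  \<open>b n p\<close> commutes with \<open>L n\<close>, and these projections are orthogonal; so
  products are formed componentwise.\<close>

lemma A_fin_mult: "x \<in> A_fin emb n \<Longrightarrow> x' \<in> A_fin emb n \<Longrightarrow> x * x' \<in> A_fin emb n"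
proof (induction n arbitrary: x x')
  case 0
  obtain c where x: "x = (\<Sum>p<3. c p *\<^sub>C f 0 p p)" using 0(1) by (rule A_fin_0_E)
  obtain d where x': "x' = (\<Sum>p<3. d p *\<^sub>C f 0 p p)" using 0(2) by (rule A_fin_0_E)
  have "x * x' = (\<Sum>p<3. (c p * d p) *\<^sub>C f 0 p p)"
    unfolding x x' by (simp add: sum_lessThan_3 distrib_left distrib_right mult_scaleC_left mult_scaleC_right
        f_mult mult.commute)
  then show ?case using A_fin_0_I by simp
next
  case (Suc n)
  from Suc.prems(1) obtain a y where x: "a \<in> A_fin emb n" "\<And>p. y p \<in> L n"
    "x = a * q (Suc n) + (\<Sum>p<3. y p * b n p)" by (rule A_fin_Suc_E) (rule that)
  from Suc.prems(2) obtain a' y' where x': "a' \<in> A_fin emb n" "\<And>p. y' p \<in> L n"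
    "x' = a' * q (Suc n) + (\<Sum>p<3. y' p * b n p)" by (rule A_fin_Suc_E) (rule that)
  have qq: "a * q (Suc n) * (a' * q (Suc n)) = a * a' * q (Suc n)"
    using mult_interchange[OF q_commute[OF A_fin_L[OF x'(1)]], of a "q (Suc n)"] by simp
  have qb: "a * q (Suc n) * (y' p * b n p) = 0" if "p < 3" for p
    using mult_interchange[OF q_commute[OF L_Suc[OF x'(2)]], of a p "b n p"] that by (simp add: q_mult_b)
  have bq: "y p * b n p * (a' * q (Suc n)) = 0" if "p < 3" for p
  proof -
    have "y p * b n p * (a' * q (Suc n)) = y p * (b n p * q (Suc n)) * a'"
      using q_commute[OF A_fin_L[OF x'(1)]] by (simp add: mult.assoc)
    then show ?thesis using that by (simp add: b_mult_q)
  qed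
  have bb: "y p * b n p * (y' r * b n r) = (if p = r then y p * y' p * b n p else 0)" if "p < 3" "r < 3" for p r
    using mult_interchange[OF b_commute[OF x'(2)], of "y p" p r "b n r"] that by (auto simp: b_mult_b)
  have "(\<Sum>p<3. y p * b n p) * (\<Sum>r<3. y' r * b n r) =
      (\<Sum>p<3. \<Sum>r<3. if p = r then y p * y' p * b n p else 0)"
    unfolding sum_product by (intro sum.cong refl bb) auto
  then have "x * x' = (a * a') * q (Suc n) + (\<Sum>p<3. (y p * y' p) * b n p)"
    unfolding x(3) x'(3) distrib_left distrib_right
    by (simp add: qq qb bq sum_distrib_left sum_distrib_right)
  then show ?case using Suc.IH[OF x(1) x'(1)] x x' by (auto intro!: A_fin_Suc_I L_mult)
qed

section \<open>The limit algebra\<close>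

lemma A_inf_iff:
  "x \<in> A_inf emb \<longleftrightarrow> (\<forall>e>0. \<forall>\<^sub>F n in sequentially. \<exists>y\<in>A_fin emb n. dist y x < e)"
  unfolding A_inf_def using seq_limit_in_sets_iff[of "A_fin emb" x] A_fin_zero by auto

text \<open>The algebraic operations act termwise on sequences with a common index \<open>n\<close>;
  closedness is read off from the eventual form \<open>A_inf_iff\<close>.\<close>

lemma cstar_subalgebra_A_inf: "cstar_subalgebra (A_inf emb)"
  unfolding cstar_subalgebra_def
proof (intro conjI ballI allI)
  show "0 \<in> A_inf emb" unfolding A_inf_def using A_fin_zero by (auto intro!: exI[of _ "\<lambda>_. 0"])
  show "closed (A_inf emb)"
  proof (rule closed_sequential_limits[THEN iffD2], intro allI impI, elim conjE)
    fix s x assume s: "\<forall>n. s n \<in> A_inf emb" "s \<longlonglongrightarrow> x"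
    show "x \<in> A_inf emb" unfolding A_inf_iff
    proof (intro allI impI)
      fix e :: real assume "e > 0"
      then obtain k where k: "dist (s k) x < e / 2"
        using s(2) by (metis half_gt_zero metric_LIMSEQ_D order_refl)
      have "\<forall>\<^sub>F n in sequentially. \<exists>y\<in>A_fin emb n. dist y (s k) < e / 2"
        using s(1) half_gt_zero[OF \<open>e > 0\<close>] unfolding A_inf_iff by blast
      then show "\<forall>\<^sub>F n in sequentially. \<exists>y\<in>A_fin emb n. dist y x < e"
        by eventually_elim (use k dist_triangle_half_l dist_commute in metis)
    qed
  qed
next
  fix x y assume "x \<in> A_inf emb" "y \<in> A_inf emb"
  then obtain s t where "\<forall>n. s n \<in> A_fin emb n" "s \<longlonglongrightarrow> x" "\<forall>n. t n \<in> A_fin emb n" "t \<longlonglongrightarrow> y"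
    unfolding A_inf_def by blast
  note st = this
  show "x + y \<in> A_inf emb" unfolding A_inf_def
    using st by (auto intro!: exI[of _ "\<lambda>n. s n + t n"] A_fin_add tendsto_intros)
  show "x * y \<in> A_inf emb" unfolding A_inf_def
    using st by (auto intro!: exI[of _ "\<lambda>n. s n * t n"] A_fin_mult tendsto_intros)
next
  fix c x assume "x \<in> A_inf emb"
  then obtain s where "\<forall>n. s n \<in> A_fin emb n" "s \<longlonglongrightarrow> x" unfolding A_inf_def by blast
  then show "c *\<^sub>C x \<in> A_inf emb" unfolding A_inf_def
    by (auto intro!: exI[of _ "\<lambda>n. c *\<^sub>C s n"] A_fin_scaleC tendsto_intros)
next
  fix x assume "x \<in> A_inf emb"
  then obtain s where "\<forall>n. s n \<in> A_fin emb n" "s \<longlonglongrightarrow> x" unfolding A_inf_def by blast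
  then show "star x \<in> A_inf emb" unfolding A_inf_def
    by (auto intro!: exI[of _ "\<lambda>n. star (s n)"] A_fin_star tendsto_intros)
qed

lemma A_inf_one: "1 \<in> A_inf emb"
  unfolding A_inf_def using A_fin_one by (auto intro!: exI[of _ "\<lambda>_. 1"])

end

lemma pos_mat_sum:
  fixes l :: nat
  shows "pos_mat m (\<lambda>i j. \<Sum>k<l. star (x k i) * x k j)"
proof -
  have "gram (map x [0..<l]) i j = (\<Sum>k<l. star (x k i) * x k j)" for i j
    by (simp add: gram_def comp_def interv_sum_list_conv_sum_set_nat atLeast0LessThan)
  then show ?thesis using pos_mat_gram[of m "map x [0..<l]"] by presburger
qed

lemma is_kraus_conj_self_adjoint: "is_kraus \<Phi> \<Longrightarrow> star c = c \<Longrightarrow> is_kraus (\<lambda>x. c * \<Phi> x * c)"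
  using is_kraus_comp[OF is_kraus_conj[of c]] by simp

context UHF_3_infinity
begin

section \<open>Conditional expectations onto the algebras \<open>\<A>\<^sub>n\<close>\<close>

text \<open>A coefficient of \<open>b n p\<close> occurs at both of its positions; averaging the two
  slices recovers it and keeps the map unital.\<close>

definition block_avg :: "nat \<Rightarrow> nat \<Rightarrow> 'u \<Rightarrow> 'u" where
  "block_avg n p x = (1 / 2) *\<^sub>R (slice n p p (slice (Suc n) 0 0 x) +
     slice n ((p + 2) mod 3) ((p + 2) mod 3) (slice (Suc n) 2 2 x))"

text \<open>The recursion follows the decomposition of \<open>A_fin emb (Suc n)\<close>. Sandwiching
  between projections keeps Kraus form; on \<open>L (Suc (Suc n))\<close> it agrees with
  multiplication on one side, as the components commute with their projections.\<close>

primrec cexp :: "nat \<Rightarrow> 'u \<Rightarrow> 'u" where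
  "cexp 0 x = (\<Sum>p<3. f 0 p p * slice 0 p p x * f 0 p p)"
| "cexp (Suc n) x = q (Suc n) * cexp n (slice (Suc n) 1 1 x) * q (Suc n) +
     (\<Sum>p<3. b n p * block_avg n p x * b n p)"

lemma is_kraus_block_avg: "is_kraus (block_avg n p)"
  unfolding block_avg_def
  by (intro is_kraus_scaleR is_kraus_add is_kraus_comp[OF is_kraus_slice is_kraus_slice]) simp

lemma is_kraus_cexp: "is_kraus (cexp n)"
proof (induction n)
  case 0
  show ?case unfolding cexp.simps
    by (intro is_kraus_sum is_kraus_conj_self_adjoint is_kraus_slice) simp
next
  case (Suc n)
  show ?case unfolding cexp.simps
    by (intro is_kraus_add is_kraus_sum is_kraus_conj_self_adjoint is_kraus_block_avg
        is_kraus_comp[OF Suc is_kraus_slice]) auto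
qed

lemma block_avg_one:
  assumes "p < 3"
  shows "block_avg n p 1 = 1"
proof -
  have "slice m i i 1 = 1" if "i < 3" for m i by (rule slice_one[OF that])
  from this[of 0] this[of 2] this[OF assms] this[of "(p + 2) mod 3"] show ?thesis
    by (simp only: block_avg_def scaleR_half_double)
qed

lemma cexp_one: "cexp n 1 = 1"
proof (induction n)
  case 0
  show ?case by (simp add: slice_one f_mult f_sum_one')
next
  case (Suc n)
  then show ?case using q_sum_b[of n] by (simp add: slice_one block_avg_one b_mult_b)
qed

lemma block_avg_L: "x \<in> L (Suc (Suc n)) \<Longrightarrow> p < 3 \<Longrightarrow> block_avg n p x \<in> L n"
  unfolding block_avg_def by (intro L_scaleR L_add slice_L) auto

lemma cexp_A_fin: "x \<in> L (Suc n) \<Longrightarrow> cexp n x \<in> A_fin emb n"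
proof (induction n arbitrary: x)
  case 0
  \<comment> \<open>A slice of an element of \<open>L 1\<close> lies in \<open>L 0\<close> and is
    therefore a scalar.\<close>
  have "\<exists>c. f 0 p p * slice 0 p p x * f 0 p p = c *\<^sub>C f 0 p p" if "p < 3" for p
  proof -
    from L_0[OF slice_L[OF 0 that that]] obtain c where "slice 0 p p x = c *\<^sub>C 1" by blast
    then show ?thesis using that by (intro exI[of _ c]) (simp add: mult_scaleC_left mult_scaleC_right f_mult)
  qed
  then have "\<forall>p. \<exists>c. p < 3 \<longrightarrow> f 0 p p * slice 0 p p x * f 0 p p = c *\<^sub>C f 0 p p" by blast
  from choice[OF this] obtain c
    where "\<forall>p. p < 3 \<longrightarrow> f 0 p p * slice 0 p p x * f 0 p p = c p *\<^sub>C f 0 p p" by blast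
  then have "cexp 0 x = (\<Sum>p<3. c p *\<^sub>C f 0 p p)" by simp
  then show ?case using A_fin_0_I by simp
next
  case (Suc n)
  let ?a = "cexp n (slice (Suc n) 1 1 x)"
  have a: "?a \<in> A_fin emb n" using Suc.prems by (intro Suc.IH slice_L) auto
  have "q (Suc n) * ?a * q (Suc n) = ?a * q (Suc n)"
    using q_commute[OF A_fin_L[OF a]] by (simp add: mult.assoc)
  moreover have "b n p * block_avg n p x * b n p = block_avg n p x * b n p" if "p < 3" for p
    using b_commute[OF block_avg_L[OF Suc.prems that]] that by (simp add: mult.assoc b_mult_b)
  ultimately have "cexp (Suc n) x = ?a * q (Suc n) + (\<Sum>p<3. block_avg n p x * b n p)" by simp
  then show ?case using a Suc.prems by (simp add: A_fin_Suc_I block_avg_L)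
qed

lemma slice_q:
  assumes "a \<in> L (Suc n)" "i < 3" "j < 3"
  shows "slice (Suc n) i j (a * q (Suc n)) = (if i = 1 \<and> j = 1 then a else 0)"
  using assms by (simp add: slice_mult_left q_def slice_f)

lemma slice_b:
  assumes y: "y \<in> L n" and "i < 3"
  shows "slice (Suc n) i i (y * b n p) =
    (if i = 0 then y * f n p p else if i = 2 then y * f n ((p + 2) mod 3) ((p + 2) mod 3) else 0)"
proof -
  have "y * b n p = (y * f n p p) * f (Suc n) 0 0 + (y * f n ((p + 2) mod 3) ((p + 2) mod 3)) * f (Suc n) 2 2"
    by (simp add: b_def distrib_left mult.assoc)
  moreover have "y * f n k k \<in> L (Suc n)" for k using y by (intro L_mult L_Suc f_L)
  ultimately show ?thesis using \<open>i < 3\<close> by (simp add: slice_add slice_mult_left slice_f)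
qed

text \<open>The slice at position 1 sees only the component with \<open>q (Suc n)\<close>, those at
  0 and 2 only the \<open>b n p\<close>; so each component is recovered.\<close>

lemma cexp_id: "x \<in> A_fin emb n \<Longrightarrow> cexp n x = x"
proof (induction n arbitrary: x)
  case 0
  then obtain c where x: "x = (\<Sum>p<3. c p *\<^sub>C f 0 p p)" by (rule A_fin_0_E)
  have "slice 0 p p x = c p *\<^sub>C 1" if "p < 3" for p
  proof -
    have "slice 0 p p x = (\<Sum>r<3. if r = p then c r *\<^sub>C 1 else 0)"
      unfolding x slice_sum using that
      by (intro sum.cong) (auto simp: slice_f is_kraus_scaleC[OF is_kraus_slice])
    then show ?thesis using that by simp
  qed
  then show ?case unfolding x cexp.simps
    by (simp add: mult_scaleC_left mult_scaleC_right f_mult)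
next
  case (Suc n)
  from Suc.prems obtain a y where *: "a \<in> A_fin emb n" "\<And>p. y p \<in> L n"
    "x = a * q (Suc n) + (\<Sum>p<3. y p * b n p)" by (rule A_fin_Suc_E) (rule that)
  note a_L = A_fin_L[OF *(1)]
  have "slice (Suc n) 1 1 x = a"
    using * a_L by (simp add: slice_add slice_sum slice_q slice_b)
  moreover have "block_avg n p x = y p" if "p < 3" for p
  proof -
    have "slice (Suc n) 0 0 x = (\<Sum>r<3. y r * f n r r)"
      "slice (Suc n) 2 2 x = (\<Sum>r<3. y r * f n ((r + 2) mod 3) ((r + 2) mod 3))"
      using * a_L by (simp_all add: slice_add slice_sum slice_q slice_b)
    then show ?thesis
      using that *(2) less_3_cases[OF that]
      by (auto simp: block_avg_def sum_lessThan_3 slice_add slice_mult_left slice_f scaleR_half_double)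
  qed
  ultimately have "cexp (Suc n) x = q (Suc n) * a * q (Suc n) + (\<Sum>p<3. b n p * y p * b n p)"
    by (simp add: Suc.IH[OF *(1)])
  also have "\<dots> = x"
    unfolding *(3) by (simp add: q_commute[OF a_L] b_commute[OF *(2)] b_mult_b mult.assoc)
  finally show ?case .
qed

section \<open>Conditional expectations onto the finite stages\<close>

text \<open>Traces out the factors \<open>n\<close>, ..., \<open>n + l - 1\<close>, the last one
  first.\<close>

primrec T_iter :: "nat \<Rightarrow> nat \<Rightarrow> 'u \<Rightarrow> 'u" where
  "T_iter n 0 x = x"
| "T_iter n (Suc l) x = T_iter n l (T (n + l) x)"

lemma is_kraus_T_iter: "is_kraus (T_iter n l)"
proof (induction l)
  case 0
  show ?case unfolding T_iter.simps by (rule is_kraus_id)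
next
  case (Suc l)
  show ?case unfolding T_iter.simps by (rule is_kraus_comp[OF Suc is_kraus_T])
qed

lemma T_iter_one: "T_iter n l 1 = 1"
  by (induction l) (auto simp: T_one)

lemma T_iter_L: "x \<in> L (n + l) \<Longrightarrow> T_iter n l x \<in> L n"
  by (induction l arbitrary: x) (auto simp: T_L)

lemma T_iter_stable: "x \<in> L (n + l) \<Longrightarrow> l \<le> l' \<Longrightarrow> T_iter n l' x = T_iter n l x"
proof (rotate_tac, induction l' rule: dec_induct)
  case (step k)
  then have "x \<in> L (n + k)" by (auto intro: L_mono)
  then show ?case using step by (simp add: T_L_id)
qed simp

definition expect :: "nat \<Rightarrow> 'u \<Rightarrow> 'u" where
  "expect n x = lim (\<lambda>l. T_iter n l x)"

lemma T_iter_contractive: "norm (T_iter n l x) \<le> norm x"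
  by (rule is_kraus_contractive[OF is_kraus_T_iter T_iter_one])

lemma T_iter_diff: "T_iter n l (x - y) = T_iter n l x - T_iter n l y"
  by (rule is_kraus_map_diff[OF is_kraus_T_iter])

text \<open>The iterates become stationary on each finite stage and are contractive, so density
  makes them Cauchy everywhere.\<close>

lemma expect_LIMSEQ: "(\<lambda>l. T_iter n l x) \<longlonglongrightarrow> expect n x"
proof -
  have "Cauchy (\<lambda>l. T_iter n l x)"
  proof (rule CauchyI)
    fix e :: real assume "e > 0"
    obtain s where s: "\<And>l. s l \<in> L l" "s \<longlonglongrightarrow> x" using dense_sequence by blast
    from metric_LIMSEQ_D[OF s(2) half_gt_zero[OF \<open>e > 0\<close>]]
    obtain m where m: "dist (s m) x < e / 2" by blast
    have "norm (T_iter n k x - T_iter n l x) < e" if "k \<ge> m" "l \<ge> m" for k l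
    proof -
      have "s m \<in> L (n + m)" using s(1)[of m] by (rule L_mono) simp
      then have "T_iter n k (s m) = T_iter n l (s m)" using T_iter_stable that by metis
      then have "T_iter n k x - T_iter n l x = T_iter n k (x - s m) - T_iter n l (x - s m)"
        by (simp add: T_iter_diff)
      also have "norm \<dots> \<le> norm (x - s m) + norm (x - s m)"
        by (rule order.trans[OF norm_triangle_ineq4 add_mono[OF T_iter_contractive T_iter_contractive]])
      finally show ?thesis using m by (simp add: dist_norm norm_minus_commute)
    qed
    then show "\<exists>M. \<forall>k\<ge>M. \<forall>l\<ge>M. norm (T_iter n k x - T_iter n l x) < e" by blast
  qed
  then show ?thesis unfolding expect_def by (simp add: Cauchy_convergent_iff convergent_LIMSEQ_iff)
qed

lemma expect_add: "expect n (x + y) = expect n x + expect n y"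
  by (rule LIMSEQ_unique[OF expect_LIMSEQ])
    (unfold is_kraus_map_add[OF is_kraus_T_iter], intro tendsto_add expect_LIMSEQ)

lemma expect_scaleC: "expect n (c *\<^sub>C x) = c *\<^sub>C expect n x"
  by (rule LIMSEQ_unique[OF expect_LIMSEQ])
    (unfold is_kraus_scaleC[OF is_kraus_T_iter], intro tendsto_scaleC expect_LIMSEQ)

lemma expect_diff: "expect n (x - y) = expect n x - expect n y"
  by (rule LIMSEQ_unique[OF expect_LIMSEQ])
    (unfold T_iter_diff, intro tendsto_diff expect_LIMSEQ)

lemma expect_contractive: "norm (expect n x) \<le> norm x"
  by (rule LIMSEQ_le_const2[OF tendsto_norm[OF expect_LIMSEQ]]) (use T_iter_contractive in auto)

lemma expect_L_stable: "x \<in> L (n + l) \<Longrightarrow> expect n x = T_iter n l x"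
  by (rule LIMSEQ_unique[OF expect_LIMSEQ])
    (rule tendsto_eventually, auto simp: eventually_sequentially intro!: exI[of _ l] T_iter_stable)

lemma expect_id: "x \<in> L n \<Longrightarrow> expect n x = x"
  using expect_L_stable[of x n 0] by simp

text \<open>Clear on finite stages; contractivity and closedness of \<open>L n\<close> extend it to
  the whole algebra.\<close>

lemma expect_L: "expect n x \<in> L n"
proof -
  obtain s where s: "\<And>l. s l \<in> L l" "s \<longlonglongrightarrow> x" using dense_sequence by blast
  have lim: "(\<lambda>l. expect n (s l)) \<longlonglongrightarrow> expect n x"
  proof (rule LIM_zero_cancel, rule tendsto_0_le[of "\<lambda>l. s l - x" _ _ 1])
    show "\<forall>\<^sub>F l in sequentially. norm (expect n (s l) - expect n x) \<le> norm (s l - x) * 1"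
      using expect_contractive by (simp flip: expect_diff)
  qed (use s(2) LIM_zero in blast)
  have "expect n (s l) \<in> L n" for l
  proof -
    have "s l \<in> L (n + l)" using s(1)[of l] by (rule L_mono) simp
    then show ?thesis by (simp add: expect_L_stable T_iter_L)
  qed
  then show ?thesis using lim by (rule closed_sequentially[OF closed_L])
qed

lemma expect_pos_mat: "pos_mat m H \<Longrightarrow> pos_mat m (\<lambda>i j. expect n (H i j))"
  by (rule pos_mat_limit[OF is_kraus_pos_mat[OF is_kraus_T_iter] expect_LIMSEQ])

section \<open>Pushing \<open>\<A>\<^sub>n\<close> into \<open>\<A>\<^sub>\<infinity>\<close>\<close>

text \<open>In the next algebra only elements of \<open>L n\<close> may stand beside the complement
  of \<open>q (Suc n)\<close>, so there \<open>x\<close> is replaced by its partial trace; on the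
  corner of \<open>q (Suc n)\<close> it is kept.\<close>

definition push :: "nat \<Rightarrow> 'u \<Rightarrow> 'u" where
  "push n x = q (Suc n) * x * q (Suc n) + (1 - q (Suc n)) * T n x * (1 - q (Suc n))"

lemma is_kraus_push: "is_kraus (push n)"
  unfolding push_def
  by (intro is_kraus_add is_kraus_conj_self_adjoint is_kraus_id is_kraus_T) (auto simp: star_diff)

lemma one_minus_q_square: "(1 - q n) * (1 - q n) = 1 - q n"
  by (simp add: algebra_simps)

lemma push_one: "push n 1 = 1"
  by (simp add: push_def T_one one_minus_q_square)

lemma push_eq:
  assumes "x \<in> L (Suc n)"
  shows "push n x = x * q (Suc n) + T n x * (1 - q (Suc n))"
proof -
  have "(1 - q (Suc n)) * T n x = T n x * (1 - q (Suc n))"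
    using q_commute[OF L_Suc[OF T_L[OF assms]]] by (simp add: algebra_simps)
  then show ?thesis unfolding push_def q_commute[OF assms] by (simp add: mult.assoc one_minus_q_square)
qed

lemma push_L: "x \<in> L (Suc n) \<Longrightarrow> push n x \<in> L (Suc (Suc n))"
  by (auto simp: push_eq intro!: L_add L_mult L_diff q_L L_one intro: L_Suc T_L)

lemma push_A_fin:
  assumes "x \<in> A_fin emb n"
  shows "push n x \<in> A_fin emb (Suc n)"
  using A_fin_Suc_I[OF assms, of "\<lambda>_. T n x"] T_L[OF A_fin_L[OF assms]]
  by (simp add: push_eq[OF A_fin_L[OF assms]] one_minus_q sum_distrib_left)

lemma push_id: "x \<in> L n \<Longrightarrow> push n x = x"
  by (simp add: push_eq L_Suc T_L_id algebra_simps)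

lemma norm_push_diff:
  assumes "x \<in> L (Suc n)"
  shows "norm (push n x - x) \<le> norm (x - T n x)"
proof -
  have "push n x - x = - ((x - T n x) * (1 - q (Suc n)))"
    by (simp add: push_eq[OF assms] algebra_simps)
  then have "norm (push n x - x) \<le> norm (x - T n x) * norm (1 - q (Suc n))"
    using norm_mult_ineq[of "x - T n x" "1 - q (Suc n)"] by (simp only: norm_minus_cancel)
  also have "\<dots> \<le> norm (x - T n x)"
    by (intro mult_left_le norm_projection_le_one) (auto simp: one_minus_q_square star_diff)
  finally show ?thesis .
qed

text \<open>The spectrum of \<open>q - 1/3\<close> is \<open>{-1/3, 2/3}\<close>.\<close>

lemma norm_q_minus_third: "norm (q n - (1 / 3) *\<^sub>R 1) \<le> 2 / 3"
proof -
  let ?p = "q n - (1 / 3) *\<^sub>R 1"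
  have "?p * ?p = (1 / 3) *\<^sub>R q n + (1 / 9) *\<^sub>R 1"
  proof -
    have "?p * ?p = q n - (1 / 3) *\<^sub>R q n - (1 / 3) *\<^sub>R q n + (1 / 9) *\<^sub>R 1"
      by (simp add: algebra_simps)
    also have "q n - (1 / 3) *\<^sub>R q n - (1 / 3) *\<^sub>R q n = (1 - 1 / 3 - 1 / 3) *\<^sub>R q n"
      by (simp only: scaleR_left_diff_distrib scaleR_one)
    finally show ?thesis by simp
  qed
  also have "\<dots> = (1 / 3) *\<^sub>R ?p + (2 / 9) *\<^sub>R 1"
    by (simp add: scaleR_right_diff_distrib flip: scaleR_left_diff_distrib scaleR_left_distrib add_diff_eq)
  finally have "(norm ?p)\<^sup>2 \<le> 1 / 3 * norm ?p + 2 / 9"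
    using norm_self_adjoint_square[of ?p] norm_triangle_ineq[of "(1 / 3) *\<^sub>R ?p" "(2 / 9) *\<^sub>R 1"]
    by (simp add: star_diff star_scaleR)
  then have "(norm ?p - 2 / 3) * (norm ?p + 1 / 3) \<le> 0"
    by (simp add: algebra_simps power2_eq_square)
  then show ?thesis using norm_ge_zero[of ?p] by (simp add: mult_le_0_iff)
qed

text \<open>The new deviation is \<open>(x - T n x) * (q (Suc n) - 1/3)\<close>, where
  \<open>1/3\<close> is the normalized trace of \<open>q (Suc n)\<close>; the second factor has norm
  at most \<open>2/3\<close>.\<close>

lemma norm_push_minus_T:
  assumes x: "x \<in> L (Suc n)"
  shows "norm (push n x - T (Suc n) (push n x)) \<le> 2 / 3 * norm (x - T n x)"
proof -
  have Tx: "T n x \<in> L (Suc n)" by (intro L_Suc T_L x)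
  have "T (Suc n) (1 - q (Suc n)) = 1 - (1 / 3) *\<^sub>R 1"
    by (simp add: is_kraus_map_diff[OF is_kraus_T] T_one T_q)
  then have "T (Suc n) (T n x * (1 - q (Suc n))) = T n x - (1 / 3) *\<^sub>R T n x"
    by (simp only: T_mult_left[OF Tx]) (simp add: right_diff_distrib)
  then have "T (Suc n) (push n x) = (1 / 3) *\<^sub>R x + (T n x - (1 / 3) *\<^sub>R T n x)"
    by (simp add: push_eq[OF x] is_kraus_map_add[OF is_kraus_T] T_mult_left[OF x] T_q)
  then have "push n x - T (Suc n) (push n x) = (x - T n x) * (q (Suc n) - (1 / 3) *\<^sub>R 1)"
    by (simp add: push_eq[OF x] algebra_simps)
  then have "norm (push n x - T (Suc n) (push n x)) \<le> norm (x - T n x) * norm (q (Suc n) - (1 / 3) *\<^sub>R 1)"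
    by (simp add: norm_mult_ineq)
  also have "\<dots> \<le> norm (x - T n x) * (2 / 3)" by (intro mult_left_mono norm_q_minus_third) auto
  finally show ?thesis by (simp add: mult.commute)
qed

primrec push_iter :: "nat \<Rightarrow> nat \<Rightarrow> 'u \<Rightarrow> 'u" where
  "push_iter n 0 x = x"
| "push_iter n (Suc l) x = push (n + l) (push_iter n l x)"

lemma is_kraus_push_iter: "is_kraus (push_iter n l)"
proof (induction l)
  case 0
  show ?case unfolding push_iter.simps by (rule is_kraus_id)
next
  case (Suc l)
  show ?case unfolding push_iter.simps by (rule is_kraus_comp[OF is_kraus_push Suc])
qed

lemma push_iter_one: "push_iter n l 1 = 1"
  by (induction l) (auto simp: push_one)

lemma push_iter_L: "x \<in> L (Suc n) \<Longrightarrow> push_iter n l x \<in> L (Suc (n + l))"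
  by (induction l) (auto simp: push_L)

lemma push_iter_A_fin: "x \<in> A_fin emb n \<Longrightarrow> push_iter n l x \<in> A_fin emb (n + l)"
  by (induction l) (auto simp: push_A_fin)

lemma push_iter_id: "x \<in> L n \<Longrightarrow> push_iter n l x = x"
  by (induction l) (auto intro!: push_id intro: L_mono)

lemma push_iter_minus_T:
  "x \<in> L (Suc n) \<Longrightarrow> norm (push_iter n l x - T (n + l) (push_iter n l x)) \<le> (2 / 3) ^ l * norm (x - T n x)"
proof (induction l)
  case (Suc l)
  then show ?case
    using norm_push_minus_T[OF push_iter_L[OF Suc.prems], of l] by (simp add: power_Suc)
qed simp

definition push_lim :: "nat \<Rightarrow> 'u \<Rightarrow> 'u" where
  "push_lim n x = lim (\<lambda>l. push_iter n l x)"

text \<open>Each step moves the iterate by at most its deviation from its partial trace, and the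
  deviations decay like \<open>(2/3)^l\<close>; so the telescoping series converges.\<close>

lemma push_lim_LIMSEQ:
  assumes x: "x \<in> L (Suc n)"
  shows "(\<lambda>l. push_iter n l x) \<longlonglongrightarrow> push_lim n x"
proof -
  have bound: "norm (push_iter n (Suc l) x - push_iter n l x) \<le> (2 / 3) ^ l * norm (x - T n x)" for l
    using norm_push_diff[OF push_iter_L[OF x, of l]] push_iter_minus_T[OF x, of l] by simp
  have "summable (\<lambda>l. (2 / 3 :: real) ^ l * norm (x - T n x))"
    by (rule summable_mult2[OF summable_geometric]) simp
  then have "summable (\<lambda>l. push_iter n (Suc l) x - push_iter n l x)"
    by (rule summable_comparison_test'[where N = 0]) (rule bound)
  from tendsto_add[OF tendsto_const summable_LIMSEQ[OF this], of "push_iter n 0 x"]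
  have "(\<lambda>l. push_iter n l x) \<longlonglongrightarrow> push_iter n 0 x + (\<Sum>k. push_iter n (Suc k) x - push_iter n k x)"
    unfolding sum_lessThan_telescope[of "\<lambda>l. push_iter n l x"] add_diff_eq add_diff_cancel_left' .
  then have "convergent (\<lambda>l. push_iter n l x)" by (rule convergentI)
  then show ?thesis unfolding push_lim_def by (simp add: convergent_LIMSEQ_iff)
qed

lemma push_lim_add: "x \<in> L (Suc n) \<Longrightarrow> y \<in> L (Suc n) \<Longrightarrow> push_lim n (x + y) = push_lim n x + push_lim n y"
  by (rule LIMSEQ_unique[OF push_lim_LIMSEQ[OF L_add]])
    (unfold is_kraus_map_add[OF is_kraus_push_iter], auto intro!: tendsto_add push_lim_LIMSEQ)

lemma push_lim_scaleC: "x \<in> L (Suc n) \<Longrightarrow> push_lim n (c *\<^sub>C x) = c *\<^sub>C push_lim n x"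
  by (rule LIMSEQ_unique[OF push_lim_LIMSEQ[OF L_scaleC]])
    (unfold is_kraus_scaleC[OF is_kraus_push_iter], auto intro!: tendsto_scaleC push_lim_LIMSEQ)

lemma push_lim_diff:
  "x \<in> L (Suc n) \<Longrightarrow> y \<in> L (Suc n) \<Longrightarrow> push_lim n (x - y) = push_lim n x - push_lim n y"
  by (rule LIMSEQ_unique[OF push_lim_LIMSEQ[OF L_diff]])
    (unfold is_kraus_map_diff[OF is_kraus_push_iter], auto intro!: tendsto_diff push_lim_LIMSEQ)

lemma push_lim_contractive: "x \<in> L (Suc n) \<Longrightarrow> norm (push_lim n x) \<le> norm x"
  by (rule LIMSEQ_le_const2[OF tendsto_norm[OF push_lim_LIMSEQ]])
    (use is_kraus_contractive[OF is_kraus_push_iter push_iter_one] in auto)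

lemma push_lim_id: "x \<in> L n \<Longrightarrow> push_lim n x = x"
  by (rule LIMSEQ_unique[OF push_lim_LIMSEQ[OF L_Suc]]) (simp_all add: push_iter_id)

lemma push_lim_A_inf:
  assumes "x \<in> A_fin emb n"
  shows "push_lim n x \<in> A_inf emb"
  unfolding A_inf_def
proof (intro CollectI exI conjI allI)
  \<comment> \<open>The places below \<open>n\<close> are filled with 0, which lies in every
    \<open>A_fin emb m\<close>; only the shifted tail decides the limit.\<close>
  let ?s = "\<lambda>m. if m < n then 0 else push_iter n (m - n) x"
  show "?s m \<in> A_fin emb m" for m
    using push_iter_A_fin[OF assms, of "m - n"] by (cases "m < n") (simp_all add: A_fin_zero)
  have "(\<lambda>l. ?s (l + n)) \<longlonglongrightarrow> push_lim n x"
    using push_lim_LIMSEQ[OF A_fin_L[OF assms]] by simp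
  then show "?s \<longlonglongrightarrow> push_lim n x" by (rule LIMSEQ_offset)
qed

lemma push_lim_pos_mat:
  assumes "pos_mat m H" "\<And>i j. i < m \<Longrightarrow> j < m \<Longrightarrow> H i j \<in> L (Suc n)"
  shows "pos_mat m (\<lambda>i j. push_lim n (H i j))"
  by (rule pos_mat_limit[OF is_kraus_pos_mat[OF is_kraus_push_iter assms(1)] push_lim_LIMSEQ])
    (rule assms(2))

end

section \<open>Nuclearity\<close>

lemma cstar_subalgebra_uminus:
  assumes "cstar_subalgebra S" "x \<in> S"
  shows "- x \<in> S"
proof -
  have "(- 1) *\<^sub>C x \<in> S" using assms unfolding cstar_subalgebra_def by blast
  then show ?thesis by simp
qed

lemma abelian_group_subalg:
  assumes "cstar_subalgebra S"
  shows "abelian_group (subalg S)"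
proof (rule abelian_groupI)
  fix x assume x: "x \<in> carrier (subalg S)"
  then show "\<exists>y\<in>carrier (subalg S). y \<oplus>\<^bsub>subalg S\<^esub> x = \<zero>\<^bsub>subalg S\<^esub>"
    by (intro bexI[of _ "- x"]) (simp_all add: subalg_def cstar_subalgebra_uminus[OF assms])
qed (use assms in \<open>auto simp: cstar_subalgebra_def subalg_def add_ac\<close>)

lemma minus_subalg:
  assumes S: "cstar_subalgebra S" and "x \<in> S" "y \<in> S"
  shows "x \<ominus>\<^bsub>subalg S\<^esub> y = x - y"
proof -
  interpret abelian_group "subalg S" by (rule abelian_group_subalg[OF S])
  have "\<ominus>\<^bsub>subalg S\<^esub> y = - y"
    using \<open>y \<in> S\<close> cstar_subalgebra_uminus[OF S \<open>y \<in> S\<close>]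
    by (intro minus_equality) (auto simp: subalg_def)
  then show ?thesis by (simp add: a_minus_def) (simp add: subalg_def)
qed

lemma finsum_subalg:
  assumes S: "cstar_subalgebra S" and g: "\<And>k. k \<in> I \<Longrightarrow> g k \<in> S" and "finite I"
  shows "finsum (subalg S) g I = (\<Sum>k\<in>I. g k)"
  using \<open>finite I\<close> g
proof (induction I)
  case empty
  interpret abelian_group "subalg S" by (rule abelian_group_subalg[OF S])
  show ?case unfolding finsum_empty by (simp add: subalg_def)
next
  case (insert k I)
  interpret abelian_group "subalg S" by (rule abelian_group_subalg[OF S])
  have "finsum (subalg S) g (insert k I) = g k \<oplus>\<^bsub>subalg S\<^esub> finsum (subalg S) g I"
    by (rule finsum_insert) (use insert in \<open>auto simp: subalg_def\<close>)
  then show ?case using insert by simp (simp add: subalg_def)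
qed

lemma matrix_positive_subalg:
  assumes S: "cstar_subalgebra S"
  shows "matrix_positive (subalg S) m a \<longleftrightarrow>
    (\<exists>x. (\<forall>i<m. \<forall>j<m. x i j \<in> S) \<and> (\<forall>i<m. \<forall>j<m. a i j = (\<Sum>k<m. star (x k i) * x k j)))"
proof -
  have "finsum (subalg S) (\<lambda>k. star (x k i) * x k j) {..<m} = (\<Sum>k<m. star (x k i) * x k j)"
    if "\<forall>i<m. \<forall>j<m. x i j \<in> S" "i < m" "j < m" for x i j
    by (rule finsum_subalg[OF S]) (use that S in \<open>auto simp: cstar_subalgebra_def\<close>)
  moreover have "carrier (subalg S) = S" "\<And>x y. adj (subalg S) x \<otimes>\<^bsub>subalg S\<^esub> y = star x * y"
    by (simp_all add: subalg_def)
  ultimately show ?thesis unfolding matrix_positive_def by (intro ex_cong1) auto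
qed

lemma abelian_monoid_mat_alg: "abelian_monoid (mat_alg n)"
  by (rule abelian_monoidI)
    (auto simp: mat_alg_def intro: assoc_add_mat comm_add_mat)

context UHF_3_infinity
begin

lemma cstar_subalgebra_L: "cstar_subalgebra (L n)"
  unfolding cstar_subalgebra_def by (simp add: L_closed closed_L)

lemma emb_finsum_mat_alg:
  assumes "finite I" "\<And>k. k \<in> I \<Longrightarrow> g k \<in> M3 n"
  shows "finsum (mat_alg (3 ^ n)) g I \<in> M3 n \<and> emb n (finsum (mat_alg (3 ^ n)) g I) = (\<Sum>k\<in>I. emb n (g k))"
  using assms
proof (induction I)
  case empty
  interpret abelian_monoid "mat_alg (3 ^ n)" by (rule abelian_monoid_mat_alg)
  show ?case unfolding finsum_empty by (simp add: mat_alg_def emb_zero)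
next
  case (insert k I)
  interpret abelian_monoid "mat_alg (3 ^ n)" by (rule abelian_monoid_mat_alg)
  have "finsum (mat_alg (3 ^ n)) g (insert k I) = g k \<oplus>\<^bsub>mat_alg (3 ^ n)\<^esub> finsum (mat_alg (3 ^ n)) g I"
    by (rule finsum_insert) (use insert in \<open>auto simp: mat_alg_def\<close>)
  then have "finsum (mat_alg (3 ^ n)) g (insert k I) = g k + finsum (mat_alg (3 ^ n)) g I"
    by (simp add: mat_alg_def)
  then show ?case using insert by (simp add: emb_add)
qed

definition mat_of :: "nat \<Rightarrow> 'u \<Rightarrow> complex mat" where
  "mat_of n = inv_into (M3 n) (emb n)"

lemma mat_of_M3: "x \<in> L n \<Longrightarrow> mat_of n x \<in> M3 n"
  unfolding mat_of_def L_def by (rule inv_into_into)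

lemma emb_mat_of: "x \<in> L n \<Longrightarrow> emb n (mat_of n x) = x"
  unfolding mat_of_def L_def by (rule f_inv_into_f)

text \<open>Transports positivity along \<open>emb n\<close>, so that factors found in
  \<open>L n\<close> count as matrices. Membership of the entries is stated separately because
  \<open>emb n\<close> determines a matrix only within \<open>M3 n\<close>.\<close>

lemma matrix_positive_mat_alg:
  "matrix_positive (mat_alg (3 ^ n)) m a \<longleftrightarrow>
    (\<forall>i<m. \<forall>j<m. a i j \<in> M3 n) \<and> (\<exists>x. (\<forall>i<m. \<forall>j<m. x i j \<in> L n) \<and>
      (\<forall>i<m. \<forall>j<m. emb n (a i j) = (\<Sum>k<m. star (x k i) * x k j)))"
  (is "?lhs \<longleftrightarrow> ?rhs")
proof -
  have sum: "finsum (mat_alg (3 ^ n)) (\<lambda>k. mat_adjoint (y k i) * y k j) {..<m} \<in> M3 n \<and>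
      emb n (finsum (mat_alg (3 ^ n)) (\<lambda>k. mat_adjoint (y k i) * y k j) {..<m}) =
        (\<Sum>k<m. star (emb n (y k i)) * emb n (y k j))"
    if y: "\<forall>i<m. \<forall>j<m. y i j \<in> M3 n" and ij: "i < m" "j < m" for y i j
  proof -
    have M: "mat_adjoint (y k i) * y k j \<in> M3 n" if "k < m" for k
      using that y ij by (intro mult_carrier_mat[of _ _ "3 ^ n"] mat_adjoint_carrier) auto
    have "emb n (mat_adjoint (y k i) * y k j) = star (emb n (y k i)) * emb n (y k j)" if "k < m" for k
      using that y ij by (simp add: emb_mult emb_adjoint)
    then show ?thesis
      using emb_finsum_mat_alg[of "{..<m}" "\<lambda>k. mat_adjoint (y k i) * y k j" n] M by simp
  qed
  have fields: "carrier (mat_alg (3 ^ n)) = M3 n"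
    "\<And>x y. adj (mat_alg (3 ^ n)) x \<otimes>\<^bsub>mat_alg (3 ^ n)\<^esub> y = mat_adjoint x * y"
    by (simp_all add: mat_alg_def)
  show ?thesis
  proof
    assume ?lhs
    then obtain y where y: "\<forall>i<m. \<forall>j<m. y i j \<in> M3 n"
      "\<forall>i<m. \<forall>j<m. a i j = finsum (mat_alg (3 ^ n)) (\<lambda>k. mat_adjoint (y k i) * y k j) {..<m}"
      unfolding matrix_positive_def fields by (elim exE conjE)
    show ?rhs
    proof (intro conjI exI[of _ "\<lambda>i j. emb n (y i j)"])
      show "\<forall>i<m. \<forall>j<m. a i j \<in> M3 n" using y(2) sum[OF y(1)] by simp
      show "\<forall>i<m. \<forall>j<m. emb n (y i j) \<in> L n" using y(1) L_I by simp
      show "\<forall>i<m. \<forall>j<m. emb n (a i j) = (\<Sum>k<m. star (emb n (y k i)) * emb n (y k j))"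
        using y(2) sum[OF y(1)] by simp
    qed
  next
    assume ?rhs
    then obtain x where a: "\<forall>i<m. \<forall>j<m. a i j \<in> M3 n" and x: "\<forall>i<m. \<forall>j<m. x i j \<in> L n"
      "\<forall>i<m. \<forall>j<m. emb n (a i j) = (\<Sum>k<m. star (x k i) * x k j)" by (elim exE conjE)
    let ?y = "\<lambda>i j. mat_of n (x i j)"
    have y: "\<forall>i<m. \<forall>j<m. ?y i j \<in> M3 n" using x(1) mat_of_M3 by simp
    show ?lhs
      unfolding matrix_positive_def fields
    proof (intro exI[of _ ?y] conjI allI impI)
      fix i j assume ij: "i < m" "j < m"
      show "?y i j \<in> M3 n" using y ij by simp
      have "emb n (a i j) = (\<Sum>k<m. star (emb n (?y k i)) * emb n (?y k j))"
        using x ij by (simp add: emb_mat_of)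
      then show "a i j = finsum (mat_alg (3 ^ n)) (\<lambda>k. mat_adjoint (?y k i) * ?y k j) {..<m}"
        using sum[OF y ij] a ij by (intro emb_inj[of _ n]) auto
    qed
  qed
qed

section \<open>The two maps of the factorization\<close>

definition down :: "nat \<Rightarrow> 'u \<Rightarrow> complex mat" where
  "down n x = mat_of n (expect n x)"

text \<open>The matrices have size \<open>3 ^ Suc n\<close> because \<open>A_fin emb n\<close> lies
  in \<open>L (Suc n)\<close>.\<close>

definition up :: "nat \<Rightarrow> complex mat \<Rightarrow> 'u" where
  "up n A = push_lim n (cexp n (emb (Suc n) A))"

lemma emb_down: "emb n (down n x) = expect n x"
  unfolding down_def by (rule emb_mat_of[OF expect_L])

lemma down_M3: "down n x \<in> M3 n"
  unfolding down_def by (rule mat_of_M3[OF expect_L])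

lemma pos_mat_cong:
  assumes "pos_mat m H" "\<And>i j. i < m \<Longrightarrow> j < m \<Longrightarrow> H i j = H' i j"
  shows "pos_mat m (H' :: nat \<Rightarrow> nat \<Rightarrow> 'u)"
  using assms unfolding pos_mat_def by auto

lemma contractive_cp_down:
  assumes S: "cstar_subalgebra S"
  shows "contractive_cp (subalg S) (mat_alg (3 ^ n)) (down n)"
  unfolding contractive_cp_def completely_positive_def star_alg_linear_def
proof (intro conjI allI ballI impI)
  show "down n \<in> carrier (subalg S) \<rightarrow> carrier (mat_alg (3 ^ n))"
    by (auto simp: mat_alg_def down_M3)
  fix x y
  have "down n (x + y) = down n x + down n y"
    by (rule emb_inj[of _ n]) (simp_all add: down_M3 emb_add emb_down expect_add)
  then show "down n (x \<oplus>\<^bsub>subalg S\<^esub> y) = down n x \<oplus>\<^bsub>mat_alg (3 ^ n)\<^esub> down n y"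
    by (simp add: subalg_def mat_alg_def)
next
  fix c x
  have "down n (c *\<^sub>C x) = c \<cdot>\<^sub>m down n x"
    by (rule emb_inj[of _ n]) (simp_all add: down_M3 emb_smult emb_down expect_scaleC)
  then show "down n (c \<odot>\<^bsub>subalg S\<^esub> x) = c \<odot>\<^bsub>mat_alg (3 ^ n)\<^esub> down n x"
    by (simp add: subalg_def mat_alg_def)
next
  fix x
  show "nrm (mat_alg (3 ^ n)) (down n x) \<le> nrm (subalg S) x"
    using expect_contractive[of n x] emb_norm[OF down_M3, of n x]
    by (simp add: mat_alg_def subalg_def emb_down)
next
  fix m a assume "matrix_positive (subalg S) m a"
  then obtain x where "\<forall>i<m. \<forall>j<m. a i j = (\<Sum>k<m. star (x k i) * x k j)"
    unfolding matrix_positive_subalg[OF S] by (elim exE conjE)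
  then have "pos_mat m a" by (intro pos_mat_cong[OF pos_mat_sum]) auto
  then have "pos_mat m (\<lambda>i j. expect n (a i j))" by (rule expect_pos_mat)
  \<comment> \<open>The limit of Gram matrices may use rows outside \<open>L n\<close>; factoring
    inside \<open>L n\<close> yields rows that are matrices again.\<close>
  from this cstar_subalgebra_L L_one expect_L
  obtain R where R: "\<And>i j. i < m \<Longrightarrow> j < m \<Longrightarrow> R i j \<in> L n"
    "\<And>i j. i < m \<Longrightarrow> j < m \<Longrightarrow> expect n (a i j) = (\<Sum>k<m. star (R k i) * R k j)"
    by (rule pos_mat_factor) (rule that)
  then show "matrix_positive (mat_alg (3 ^ n)) m (\<lambda>i j. down n (a i j))"
    unfolding matrix_positive_mat_alg emb_down by (intro conjI exI[of _ R]) (auto simp: down_M3)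
qed

lemma contractive_cp_up: "contractive_cp (mat_alg (3 ^ Suc n)) (subalg (A_inf emb)) (up n)"
  unfolding contractive_cp_def completely_positive_def star_alg_linear_def
proof (intro conjI allI ballI impI)
  have A: "cexp n (emb (Suc n) A) \<in> A_fin emb n" if "A \<in> M3 (Suc n)" for A
    using that by (intro cexp_A_fin L_I)
  note L = A_fin_L[OF A]
  have M: "carrier (mat_alg (3 ^ Suc n)) = M3 (Suc n)" by (simp add: mat_alg_def)
  have up_A_inf: "up n B \<in> A_inf emb" if "B \<in> M3 (Suc n)" for B
    unfolding up_def using that by (intro push_lim_A_inf A)
  then show "up n \<in> carrier (mat_alg (3 ^ Suc n)) \<rightarrow> carrier (subalg (A_inf emb))"
    unfolding M by (intro Pi_I) (simp only: subalg_def partial_object.select_convs)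
  {
    fix x y assume "x \<in> carrier (mat_alg (3 ^ Suc n))" "y \<in> carrier (mat_alg (3 ^ Suc n))"
    then have "up n (x + y) = up n x + up n y"
      using L[of x] L[of y] unfolding M up_def
      by (simp only: emb_add is_kraus_map_add[OF is_kraus_cexp] push_lim_add)
    then show "up n (x \<oplus>\<^bsub>mat_alg (3 ^ Suc n)\<^esub> y) = up n x \<oplus>\<^bsub>subalg (A_inf emb)\<^esub> up n y"
      by (simp add: subalg_def mat_alg_def)
  next
    fix c x assume "x \<in> carrier (mat_alg (3 ^ Suc n))"
    then have "up n (c \<cdot>\<^sub>m x) = c *\<^sub>C up n x"
      using L[of x] unfolding M up_def
      by (simp only: emb_smult is_kraus_scaleC[OF is_kraus_cexp] push_lim_scaleC)
    then show "up n (c \<odot>\<^bsub>mat_alg (3 ^ Suc n)\<^esub> x) = c \<odot>\<^bsub>subalg (A_inf emb)\<^esub> up n x"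
      by (simp add: subalg_def mat_alg_def)
  next
    fix x assume "x \<in> carrier (mat_alg (3 ^ Suc n))"
    then have x: "x \<in> M3 (Suc n)" by (simp only: M)
    have "norm (up n x) \<le> norm (cexp n (emb (Suc n) x))"
      unfolding up_def by (rule push_lim_contractive[OF L[OF x]])
    also have "\<dots> \<le> norm (emb (Suc n) x)" by (rule is_kraus_contractive[OF is_kraus_cexp cexp_one])
    finally have "norm (up n x) \<le> op_norm x" by (simp only: emb_norm[OF x])
    then show "nrm (subalg (A_inf emb)) (up n x) \<le> nrm (mat_alg (3 ^ Suc n)) x"
      by (simp add: mat_alg_def subalg_def)
  next
    fix m a assume "matrix_positive (mat_alg (3 ^ Suc n)) m a"
    then obtain x where a: "\<forall>i<m. \<forall>j<m. a i j \<in> M3 (Suc n)"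
      and x: "\<forall>i<m. \<forall>j<m. emb (Suc n) (a i j) = (\<Sum>k<m. star (x k i) * x k j)"
      unfolding matrix_positive_mat_alg by (elim exE conjE)
    from x have "pos_mat m (\<lambda>i j. emb (Suc n) (a i j))"
      by (intro pos_mat_cong[OF pos_mat_sum[of m x m]]) auto
    then have "pos_mat m (\<lambda>i j. cexp n (emb (Suc n) (a i j)))"
      by (rule is_kraus_pos_mat[OF is_kraus_cexp])
    then have pos: "pos_mat m (\<lambda>i j. up n (a i j))"
      unfolding up_def using a by (intro push_lim_pos_mat L) auto
    show "matrix_positive (subalg (A_inf emb)) m (\<lambda>i j. up n (a i j))"
      unfolding matrix_positive_subalg[OF cstar_subalgebra_A_inf]
    proof (rule pos_mat_factor[OF pos cstar_subalgebra_A_inf A_inf_one])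
      show "up n (a i j) \<in> A_inf emb" if "i < m" "j < m" for i j
        using up_A_inf a that by blast
    next
      fix R assume R: "\<And>i j. i < m \<Longrightarrow> j < m \<Longrightarrow> R i j \<in> A_inf emb"
        "\<And>i j. i < m \<Longrightarrow> j < m \<Longrightarrow> up n (a i j) = (\<Sum>k<m. star (R k i) * R k j)"
      then show "\<exists>x. (\<forall>i<m. \<forall>j<m. x i j \<in> A_inf emb) \<and>
          (\<forall>i<m. \<forall>j<m. up n (a i j) = (\<Sum>k<m. star (x k i) * x k j))"
        by (intro exI[of _ R]) auto
    qed
  }
qed

text \<open>\<open>c\<close> is fixed by both conditional expectations and \<open>y\<close> by
  \<open>push_lim n\<close>. Passing from \<open>a\<close> through \<open>c\<close> and
  \<open>y\<close>, the three errors are below \<open>e\<close>, \<open>2 * e\<close> and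
  \<open>e\<close>.\<close>

lemma norm_up_down_le:
  assumes y: "y \<in> L n" "norm (y - a) < e" and c: "c \<in> A_fin emb n" "norm (c - a) < e"
  shows "norm (up n (down (Suc n) a) - a) < 4 * e"
proof -
  let ?P = "push_lim n"
  let ?z = "cexp n (expect (Suc n) a)"
  have yL: "y \<in> L (Suc n)" and cL: "c \<in> L (Suc n)" using y c L_Suc A_fin_L by auto
  have zL: "?z \<in> L (Suc n)" by (intro A_fin_L cexp_A_fin expect_L)
  have "?z - c = cexp n (expect (Suc n) (a - c))"
    by (simp add: expect_diff expect_id[OF cL] is_kraus_map_diff[OF is_kraus_cexp] cexp_id[OF c(1)])
  then have "norm (?z - c) \<le> norm (a - c)"
    using is_kraus_contractive[OF is_kraus_cexp cexp_one, of n "expect (Suc n) (a - c)"]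
      expect_contractive[of "Suc n" "a - c"] by simp
  then have zc: "norm (?z - c) < e" using c(2) by (simp add: norm_minus_commute)
  have cy: "norm (c - y) < 2 * e"
    using c(2) y(2) norm_triangle_ineq4[of "c - a" "y - a"] by simp
  have "up n (down (Suc n) a) - a = ?P (?z - c) + ?P (c - y) + (y - a)"
    by (simp add: up_def emb_down push_lim_diff[OF zL cL] push_lim_diff[OF cL yL] push_lim_id[OF y(1)])
  also have "norm \<dots> \<le> norm (?P (?z - c)) + norm (?P (c - y)) + norm (y - a)"
    using norm_triangle_ineq[of "?P (?z - c) + ?P (c - y)" "y - a"]
      norm_triangle_ineq[of "?P (?z - c)" "?P (c - y)"] by linarith
  also have "\<dots> \<le> norm (?z - c) + norm (c - y) + norm (y - a)"
    by (intro add_mono push_lim_contractive L_diff zL cL yL order.refl)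
  finally show ?thesis using zc cy y(2) by linarith
qed

lemma nuclear_A_inf: "nuclear (subalg (A_inf emb))"
  unfolding nuclear_def
proof (intro allI impI, elim conjE)
  fix F and \<epsilon> :: real
  assume F: "finite F" "F \<subseteq> carrier (subalg (A_inf emb))" and \<epsilon>: "\<epsilon> > 0"
  define d where "d = \<epsilon> / 4"
  have d: "d > 0" using \<epsilon> by (simp add: d_def)
  from F have F_A: "a \<in> A_inf emb" if "a \<in> F" for a using that by (auto simp: subalg_def)
  have ev: "\<forall>\<^sub>F n in sequentially. (\<exists>y\<in>L n. dist y a < d) \<and> (\<exists>c\<in>A_fin emb n. dist c a < d)"
    if "a \<in> F" for a
  proof (intro eventually_conj)
    show "\<forall>\<^sub>F n in sequentially. \<exists>y\<in>L n. dist y a < d"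
      using dense_sequence[of a] d L_zero by (subst (asm) seq_limit_in_sets_iff) auto
    show "\<forall>\<^sub>F n in sequentially. \<exists>c\<in>A_fin emb n. dist c a < d"
      using F_A[OF that] d by (simp add: A_inf_iff)
  qed
  \<comment> \<open>Finiteness of \<open>F\<close> yields one \<open>n\<close> at which every
    element is near both \<open>L n\<close> and \<open>A_fin emb n\<close>.\<close>
  have "\<forall>\<^sub>F n in sequentially. \<forall>a\<in>F. (\<exists>y\<in>L n. dist y a < d) \<and> (\<exists>c\<in>A_fin emb n. dist c a < d)"
    using F(1) ev by (intro eventually_ball_finite) auto
  from eventually_happens'[OF sequentially_bot this]
  obtain n where n: "\<forall>a\<in>F. (\<exists>y\<in>L n. dist y a < d) \<and> (\<exists>c\<in>A_fin emb n. dist c a < d)" ..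
  have close: "nrm (subalg (A_inf emb)) (up n (down (Suc n) a) \<ominus>\<^bsub>subalg (A_inf emb)\<^esub> a) < \<epsilon>" if "a \<in> F" for a
  proof -
    obtain y c where "y \<in> L n" "norm (y - a) < d" "c \<in> A_fin emb n" "norm (c - a) < d"
      using bspec[OF n \<open>a \<in> F\<close>] unfolding dist_norm by blast
    then have "norm (up n (down (Suc n) a) - a) < 4 * d" by (rule norm_up_down_le)
    moreover have "up n (down (Suc n) a) \<in> A_inf emb"
      unfolding up_def by (intro push_lim_A_inf cexp_A_fin L_I down_M3)
    ultimately show ?thesis
      using minus_subalg[OF cstar_subalgebra_A_inf _ F_A[OF that]] by (simp add: d_def) (simp add: subalg_def)
  qed
  show "\<exists>n \<phi> \<psi>. n \<ge> 1 \<and> contractive_cp (subalg (A_inf emb)) (mat_alg n) \<phi> \<and>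
      contractive_cp (mat_alg n) (subalg (A_inf emb)) \<psi> \<and>
      (\<forall>a\<in>F. nrm (subalg (A_inf emb)) (\<psi> (\<phi> a) \<ominus>\<^bsub>subalg (A_inf emb)\<^esub> a) < \<epsilon>)"
    by (rule exI[of _ "3 ^ Suc n"], rule exI[of _ "down (Suc n)"], rule exI[of _ "up n"])
      (use close contractive_cp_down[OF cstar_subalgebra_A_inf, of "Suc n"] contractive_cp_up[of n] in simp)
qed

end

theorem corollary2p24:
  fixes emb :: "nat \<Rightarrow> complex mat \<Rightarrow> 'u :: unital_cstar_algebra"
  assumes "UHF_3_infinity emb"
  shows "cstar_subalgebra (A_inf emb) \<and> nuclear (subalg (A_inf emb))"
  using UHF_3_infinity.cstar_subalgebra_A_inf[OF assms] UHF_3_infinity.nuclear_A_inf[OF assms] ..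

end
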